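(* Let $V(x,y)=y^2 f(x,y)$ with $f(x,y)=f(x,0)+(\text{higher order terms in } y)$ and $f(x,0)\neq 0$, and consider the two-degree-of-freedom Hamiltonian system with Hamiltonian $$H(x,p_x,y,p_y)=\frac{p_x^2+p_y^2}{2}+V(x,y).$$ Let $a,b$ be real parameters with $a\neq 0$. Suppose that $f$ belongs to one of the following families: 1. (Hermite) $2f(x,0)=1-ax^2$; 2. (Bessel, $b\neq 0$) $2f(x,0)=b-\dfrac{a}{x^2}$ with $b\neq 0$; 3. (Legendre, $b\neq 0$) $2f(x,0)=-b+\dfrac{a}{\cosh^2 x}$ with $b\neq 0$; 4. (Lamé) $2f(x,0)=-b-a\,\wp(x+\omega_3)$. Then the semiclassical approximation $K_{\mathrm{WKB}}$ of the Feynman propagator of the system is not integrable; that is, it is not true that for every fixed classical path $\gamma$ the function $K_{\mathrm{WKB}}=K_{\mathrm{WKB}}(t_1)$ is a Liouvillian function over the coefficient field of the variational equation associated with $\gamma$.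
   Context: The Hamiltonian system is $\dot x=p_x$, $\dot p_x=-\partial V/\partial x$, $\dot y=p_y$, $\dot p_y=-\partial V/\partial y$. The function $\wp$ is the Weierstrass elliptic function, satisfying $(\wp')^2=4\wp^3-g_2\wp-g_3$, with $g_2,g_3$ real and $\Delta=g_2^3-27g_3^2>0$; its basic periods are $2\omega_1$ (real) and $2\omega_3$ (purely imaginary). Semiclassical propagator. Let $\gamma$ be a classical path $(\mathbf{x}(t),t)$, $0\le t\le t_1$, in configuration space from $(\mathbf{x}_0,0)$ to $(\mathbf{x}_1,t_1)$ (without focal points). The semiclassical (WKB) approximation of the propagator for two degrees of freedom is given by the Pauli–Morette formula $$K_{\mathrm{WKB}}(\mathbf{x}_1,t_1\,|\,\mathbf{x}_0,0)=\frac{1}{2\pi i\hbar}\,\frac{1}{\sqrt{\det J(t_1,0)}}\,e^{\frac{i}{\hbar}S(\gamma)}.$$ Here $S(\gamma)=\int_0^{t_1}(p_x\dot x+p_y\dot y-H)\,dt$ is the action along $\gamma$. The $2\times 2$ matrix $J(t_1,0)=\big(\partial\xi_i(t_1)/\partial\eta_j(0)\big)$ is the block of the fundamental matrix (equal to the identity at $t=0$) of the variational equation of the Hamiltonian system along the phase curve of $\gamma$ giving the derivative of position variations $\xi_i$ with respect to initial momentum variations $\eta_j$. The points $\mathbf{x}_0,\mathbf{x}_1$ are considered fixed, so that $K_{\mathrm{WKB}}$ is regarded as a function of $t_1$ only. For each $E>0$ one has in particular the free-particle path $\gamma_E$: $x_E(t)=\sqrt{2E}\,t+x_0$, $y=0$,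 with $p_x=\sqrt{2E}$, $p_y=0$. For this path $S(\gamma_E)=\frac{(x_1-x_0)^2}{2t_1}$, where $x_1=x_E(t_1)$, and $\det J(t_1,0)=t_1\,\phi_{12}(t_1)$, where $\phi_{12}$ is the solution of the normal variational equation $\ddot\xi+2f(x_E(t),0)\,\xi=0$ with $\phi_{12}(0)=0$, $\dot\phi_{12}(0)=1$. The coefficient field of the variational equation along $\gamma_E$ is the differential field generated by the function $f(x_E(t),0)$. Definitions. A Liouvillian function over a differential field of functions $\mathcal{K}$ is a function obtained by a combination of algebraic functions, integrals, and exponentials of integrals of functions in $\mathcal{K}$. The semiclassical approximation of the Feynman propagator is called integrable if for any fixed classical path $\gamma$ the expression $K_{\mathrm{WKB}}=K_{\mathrm{WKB}}(t_1)$ is a Liouvillian function over the coefficient field of the associated variational equation. Hence it is not integrable if there exists a classical path for which $K_{\mathrm{WKB}}(t_1)$ is not Liouvillian. *)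

theory Defs
  imports "HOL-Complex_Analysis.Complex_Analysis"
begin

section \<open>Liouvillian functions over differential fields of meromorphic functions\<close>

text \<open>
  A field of functions on a connected open set \<open>D\<close> consists of meromorphic functions, two of
  which are identified if they agree off a subset of \<open>D\<close> without accumulation points in \<open>D\<close>
  (\<open>\<forall>\<^sub>\<approx>z\<in>D\<close>); the sets below are saturated for this identification. With
  \<open>inverse 0 = 0\<close> pointwise, the zero function needs no exception in the clause for inverses.
\<close>

definition diff_field_on :: "complex set \<Rightarrow> (complex \<Rightarrow> complex) set \<Rightarrow> bool" where
  "diff_field_on D F \<longleftrightarrow>
     (\<forall>f\<in>F. f meromorphic_on D) \<and>
     (\<forall>f\<in>F. \<forall>g. g meromorphic_on D \<and> (\<forall>\<^sub>\<approx>z\<in>D. f z = g z) \<longrightarrow> g \<in> F) \<and>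
     (\<forall>c. (\<lambda>_. c) \<in> F) \<and>
     (\<forall>f\<in>F. \<forall>g\<in>F. (\<lambda>z. f z + g z) \<in> F \<and> (\<lambda>z. f z * g z) \<in> F) \<and>
     (\<forall>f\<in>F. (\<lambda>z. - f z) \<in> F \<and> (\<lambda>z. inverse (f z)) \<in> F \<and> deriv f \<in> F)"

definition diff_field_gen :: "complex set \<Rightarrow> (complex \<Rightarrow> complex) set \<Rightarrow> (complex \<Rightarrow> complex) set" where
  "diff_field_gen D G = \<Inter>{F. diff_field_on D F \<and> G \<subseteq> F}"

definition algebraic_over :: "complex set \<Rightarrow> (complex \<Rightarrow> complex) set \<Rightarrow> (complex \<Rightarrow> complex) \<Rightarrow> bool" where
  "algebraic_over D F \<alpha> \<longleftrightarrow>
     (\<exists>(n::nat) c. (\<forall>i\<le>n. c i \<in> F) \<and> \<not> (\<forall>\<^sub>\<approx>z\<in>D. c n z = 0) \<and>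
        (\<forall>\<^sub>\<approx>z\<in>D. (\<Sum>i\<le>n. c i z * \<alpha> z ^ i) = 0))"

definition liouvillian_step ::
  "complex set \<Rightarrow> (complex \<Rightarrow> complex) set \<Rightarrow> (complex \<Rightarrow> complex) set \<Rightarrow> bool" where
  "liouvillian_step D F F' \<longleftrightarrow>
     (\<exists>\<alpha>. \<alpha> meromorphic_on D \<and> F' = diff_field_gen D (insert \<alpha> F) \<and>
        (algebraic_over D F \<alpha> \<or>
         (\<exists>h\<in>F. \<forall>\<^sub>\<approx>z\<in>D. deriv \<alpha> z = h z) \<or>
         (\<exists>h\<in>F. \<forall>\<^sub>\<approx>z\<in>D. deriv \<alpha> z = h z * \<alpha> z)))"

definition liouvillian_over ::
  "complex set \<Rightarrow> (complex \<Rightarrow> complex) set \<Rightarrow> (complex \<Rightarrow> complex) \<Rightarrow> bool" where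
  "liouvillian_over D F g \<longleftrightarrow> (\<exists>F'. (liouvillian_step D)\<^sup>*\<^sup>* F F' \<and> g \<in> F')"

section \<open>Natural Hamiltonian systems with two degrees of freedom\<close>

definition hamiltonian :: "(real \<Rightarrow> real \<Rightarrow> real) \<Rightarrow> real \<Rightarrow> real \<Rightarrow> real \<Rightarrow> real \<Rightarrow> real" where
  "hamiltonian V x px y py = (px\<^sup>2 + py\<^sup>2) / 2 + V x y"

definition d1 :: "(real \<Rightarrow> real \<Rightarrow> real) \<Rightarrow> real \<Rightarrow> real \<Rightarrow> real" where
  "d1 V x y = deriv (\<lambda>s. V s y) x"

definition d2 :: "(real \<Rightarrow> real \<Rightarrow> real) \<Rightarrow> real \<Rightarrow> real \<Rightarrow> real" where
  "d2 V x y = deriv (\<lambda>s. V x s) y"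

definition hessian :: "(real \<Rightarrow> real \<Rightarrow> real) \<Rightarrow> real \<Rightarrow> real \<Rightarrow> real^2^2" where
  "hessian V x y = vector [vector [d1 (d1 V) x y, d2 (d1 V) x y],
                           vector [d1 (d2 V) x y, d2 (d2 V) x y]]"

text \<open>\<open>U\<close> is the domain of definition of the potential \<open>V\<close>.\<close>

definition phase_curve ::
  "(real \<times> real) set \<Rightarrow> (real \<Rightarrow> real \<Rightarrow> real) \<Rightarrow> real \<Rightarrow>
   (real \<Rightarrow> real) \<Rightarrow> (real \<Rightarrow> real) \<Rightarrow> (real \<Rightarrow> real) \<Rightarrow> (real \<Rightarrow> real) \<Rightarrow> bool" where
  "phase_curve U V T x px y py \<longleftrightarrow>
     (\<forall>t\<in>{0..T}. (x t, y t) \<in> U \<and>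
        (x has_real_derivative px t) (at t within {0..T}) \<and>
        (px has_real_derivative - d1 V (x t) (y t)) (at t within {0..T}) \<and>
        (y has_real_derivative py t) (at t within {0..T}) \<and>
        (py has_real_derivative - d2 V (x t) (y t)) (at t within {0..T}))"

text \<open>
  Matrix of the variational equation \<open>\<xi>' = \<eta>\<close>, \<open>\<eta>' = - V'' \<xi>\<close>. Indices \<open>Inl i\<close> stand for the
  position variations \<open>\<xi>\<^sub>i\<close>, indices \<open>Inr i\<close> for the momentum variations \<open>\<eta>\<^sub>i\<close>.
\<close>

definition variational_matrix ::
  "(real \<Rightarrow> real \<Rightarrow> real) \<Rightarrow> real \<Rightarrow> real \<Rightarrow> real^(2 + 2)^(2 + 2)" where
  "variational_matrix V x y = (\<chi> i j. case (i, j) of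
      (Inl i, Inl j) \<Rightarrow> 0
    | (Inl i, Inr j) \<Rightarrow> (if i = j then 1 else 0)
    | (Inr i, Inl j) \<Rightarrow> - hessian V x y $ i $ j
    | (Inr i, Inr j) \<Rightarrow> 0)"

definition fundamental_matrix ::
  "(real \<Rightarrow> real \<Rightarrow> real) \<Rightarrow> real \<Rightarrow> (real \<Rightarrow> real) \<Rightarrow> (real \<Rightarrow> real) \<Rightarrow>
   (real \<Rightarrow> real^(2 + 2)^(2 + 2)) \<Rightarrow> bool" where
  "fundamental_matrix V T x y \<Phi> \<longleftrightarrow>
     \<Phi> 0 = mat 1 \<and>
     (\<forall>t\<in>{0..T}. (\<Phi> has_vector_derivative variational_matrix V (x t) (y t) ** \<Phi> t)
                  (at t within {0..T}))"

definition morette_block :: "real^(2 + 2)^(2 + 2) \<Rightarrow> real^2^2" where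
  "morette_block M = (\<chi> i j. M $ Inl i $ Inr j)"

section \<open>The semiclassical propagator\<close>

definition action ::
  "(real \<Rightarrow> real \<Rightarrow> real) \<Rightarrow> (real \<Rightarrow> real) \<Rightarrow> (real \<Rightarrow> real) \<Rightarrow> (real \<Rightarrow> real) \<Rightarrow> (real \<Rightarrow> real) \<Rightarrow>
   real \<Rightarrow> real" where
  "action V x px y py t1 =
     integral {0..t1} (\<lambda>t. px t * deriv x t + py t * deriv y t - hamiltonian V (x t) (px t) (y t) (py t))"

text \<open>
  The real square root is the right one: \<open>J(t,0)\<close> is asymptotic to \<open>t\<close> times the identity as
  \<open>t\<close> tends to \<open>0\<close>, so its determinant stays positive up to the first focal point.
\<close>

definition K_WKB ::
  "real \<Rightarrow> (real \<Rightarrow> real \<Rightarrow> real) \<Rightarrow> (real \<Rightarrow> real) \<Rightarrow> (real \<Rightarrow> real) \<Rightarrow> (real \<Rightarrow> real) \<Rightarrow> (real \<Rightarrow> real) \<Rightarrow>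
   (real \<Rightarrow> real^(2 + 2)^(2 + 2)) \<Rightarrow> real \<Rightarrow> complex" where
  "K_WKB hbar V x px y py \<Phi> t1 =
     1 / (2 * of_real pi * \<i> * of_real hbar)
     * (1 / of_real (sqrt (det (morette_block (\<Phi> t1)))))
     * exp (\<i> / of_real hbar * of_real (action V x px y py t1))"

text \<open>
  Liouvillian functions are in general multivalued, and the coefficients and \<open>K_WKB\<close> are functions
  of a real variable. So they are continued holomorphically to some disc centred on the time axis,
  on which the tower of extensions consists of single-valued meromorphic functions. Shrinking or
  moving the disc removes branch points of the functions in the tower.
\<close>

definition wkb_liouvillian ::
  "real \<Rightarrow> (real \<Rightarrow> real \<Rightarrow> real) \<Rightarrow> real \<Rightarrow>
   (real \<Rightarrow> real) \<Rightarrow> (real \<Rightarrow> real) \<Rightarrow> (real \<Rightarrow> real) \<Rightarrow> (real \<Rightarrow> real) \<Rightarrow>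
   (real \<Rightarrow> real^(2 + 2)^(2 + 2)) \<Rightarrow> bool" where
  "wkb_liouvillian hbar V T x px y py \<Phi> \<longleftrightarrow>
     (\<exists>(c::real) r (A :: 2 + 2 \<Rightarrow> 2 + 2 \<Rightarrow> complex \<Rightarrow> complex) K.
        0 < r \<and> {c-r<..<c+r} \<subseteq> {0<..<T} \<and>
        (\<forall>i j. A i j holomorphic_on ball (of_real c) r) \<and>
        K holomorphic_on ball (of_real c) r \<and>
        (\<forall>t\<in>{c-r<..<c+r}.
           (\<forall>i j. A i j (of_real t) = of_real (variational_matrix V (x t) (y t) $ i $ j)) \<and>
           K (of_real t) = K_WKB hbar V x px y py \<Phi> t) \<and>
        liouvillian_over (ball (of_real c) r)
          (diff_field_gen (ball (of_real c) r) {A i j | i j. True}) K)"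

definition wkb_integrable :: "real \<Rightarrow> (real \<times> real) set \<Rightarrow> (real \<Rightarrow> real \<Rightarrow> real) \<Rightarrow> bool" where
  "wkb_integrable hbar U V \<longleftrightarrow>
     (\<forall>T x px y py \<Phi>.
        0 < T \<and> phase_curve U V T x px y py \<and> fundamental_matrix V T x y \<Phi> \<and>
        (\<forall>t\<in>{0<..T}. det (morette_block (\<Phi> t)) \<noteq> 0)
        \<longrightarrow> wkb_liouvillian hbar V T x px y py \<Phi>)"

section \<open>The potentials\<close>

definition real_analytic2_on :: "(real \<Rightarrow> real \<Rightarrow> real) \<Rightarrow> (real \<times> real) set \<Rightarrow> bool" where
  "real_analytic2_on f U \<longleftrightarrow>
     (\<forall>(x0, y0)\<in>U. \<exists>r>0. \<exists>c :: nat \<Rightarrow> nat \<Rightarrow> real. \<forall>x y. \<bar>x - x0\<bar> < r \<and> \<bar>y - y0\<bar> < r \<longrightarrow>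
        ((\<lambda>(i, j). c i j * (x - x0) ^ i * (y - y0) ^ j) has_sum f x y) UNIV)"

definition period_lattice :: "complex \<Rightarrow> complex \<Rightarrow> complex set" where
  "period_lattice \<omega>1 \<omega>3 = {2 * of_int m * \<omega>1 + 2 * of_int n * \<omega>3 | m n. True}"

definition weierstrass_p :: "complex \<Rightarrow> complex \<Rightarrow> complex \<Rightarrow> complex" where
  "weierstrass_p \<omega>1 \<omega>3 z =
     1 / z\<^sup>2 + (\<Sum>\<^sub>\<infinity>\<omega>\<in>period_lattice \<omega>1 \<omega>3 - {0}. 1 / (z - \<omega>)\<^sup>2 - 1 / \<omega>\<^sup>2)"

text \<open>
  The differential equation determines the invariants \<open>g2\<close>, \<open>g3\<close> of the lattice.
\<close>

definition real_rectangular_weierstrass :: "real \<Rightarrow> real \<Rightarrow> complex \<Rightarrow> complex \<Rightarrow> bool" where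
  "real_rectangular_weierstrass g2 g3 \<omega>1 \<omega>3 \<longleftrightarrow>
     g2 ^ 3 - 27 * g3\<^sup>2 > 0 \<and>
     \<omega>1 \<noteq> 0 \<and> Im \<omega>1 = 0 \<and> \<omega>3 \<noteq> 0 \<and> Re \<omega>3 = 0 \<and>
     (\<forall>z. z \<notin> period_lattice \<omega>1 \<omega>3 \<longrightarrow>
        (deriv (weierstrass_p \<omega>1 \<omega>3) z)\<^sup>2 =
          4 * weierstrass_p \<omega>1 \<omega>3 z ^ 3 - of_real g2 * weierstrass_p \<omega>1 \<omega>3 z - of_real g3)"

text \<open>In the following, \<open>u x = 2 f(x, 0)\<close> and \<open>X\<close> is the set of \<open>x\<close> for which this is defined.\<close>

definition hermite_family :: "real \<Rightarrow> real set \<Rightarrow> (real \<Rightarrow> real) \<Rightarrow> bool" where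
  "hermite_family a X u \<longleftrightarrow> (\<forall>x\<in>X. u x = 1 - a * x\<^sup>2)"

definition bessel_family :: "real \<Rightarrow> real \<Rightarrow> real set \<Rightarrow> (real \<Rightarrow> real) \<Rightarrow> bool" where
  "bessel_family a b X u \<longleftrightarrow> b \<noteq> 0 \<and> (\<forall>x\<in>X. x \<noteq> 0 \<and> u x = b - a / x\<^sup>2)"

definition legendre_family :: "real \<Rightarrow> real \<Rightarrow> real set \<Rightarrow> (real \<Rightarrow> real) \<Rightarrow> bool" where
  "legendre_family a b X u \<longleftrightarrow> b \<noteq> 0 \<and> (\<forall>x\<in>X. u x = - b + a / (cosh x)\<^sup>2)"

definition lame_family :: "real \<Rightarrow> real \<Rightarrow> real set \<Rightarrow> (real \<Rightarrow> real) \<Rightarrow> bool" where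
  "lame_family a b X u \<longleftrightarrow>
     (\<exists>g2 g3 \<omega>1 \<omega>3. real_rectangular_weierstrass g2 g3 \<omega>1 \<omega>3 \<and>
        (\<forall>x\<in>X. of_real (u x) = - of_real b - of_real a * weierstrass_p \<omega>1 \<omega>3 (of_real x + \<omega>3)))"

end

theory Submission
  imports Defs "HOL-Computational_Algebra.Fundamental_Theorem_Algebra"
begin

text \<open>
  On the path \<open>y = 0\<close>, \<open>x = x0 + s t\<close> of energy \<open>E = s\<^sup>2 / 2\<close> one has \<open>det J = t \<phi>(t)\<close>, where
  \<open>\<phi>'' = r \<phi>\<close> and \<open>r = - 2 f(x, 0)\<close>. So if the propagator is Liouvillian, then so is \<open>\<phi>\<close>, and the
  tower contains a solution \<open>W\<close> of the Riccati equation \<open>d W = Q + R W - W\<^sup>2\<close>, where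
  \<open>W = m \<phi>' / \<phi> - q\<close> and \<open>d = m d/dt\<close>. Then \<open>X - W\<close> is a Darboux polynomial: it divides its
  image under the derivation \<open>d + (Q + R X - X\<^sup>2) \<partial>/\<partial>X\<close>. The existence of a Darboux polynomial of
  positive degree descends through each step \<open>K(\<alpha>)\<close> of the tower: for transcendental \<open>\<alpha>\<close> by
  passing to leading coefficients, for algebraic \<open>\<alpha>\<close> by contracting an ideal. This ends in
  \<open>\<complex>(v)\<close>, where \<open>v\<close> is \<open>x\<^sup>2\<close> (Hermite), \<open>x\<close> (Bessel), \<open>tanh x\<close> (Legendre) or \<open>\<wp>(x + \<omega>\<^sub>3)\<close> (Lame),
  and \<open>d v\<close> is a polynomial in \<open>v\<close>. There the cofactor is a polynomial, and its values at the
  singular points are sums of local exponents. Comparing them with its behaviour at infinity, as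
  in the Fuchs relation, gives a relation with integer coefficients between \<open>1\<close> and the differences
  of exponents, which involve \<open>e = 1 / s\<^sup>2\<close>. For a suitable energy there is no such relation.
\<close>

text \<open>A Liouvillian solution of a second order equation need not have its logarithmic
  derivative in \<open>\<complex>(v)\<close>; in general it is only algebraic over it, of unknown
  degree. So rational solutions of the Riccati equation are too few, and Darboux polynomials of
  arbitrary degree \<open>N\<close> take their place: they survive both kinds of extension, and
  neither a differential Galois group nor a bound on \<open>N\<close> enters. The price is that the
  integers in the final relation are unknown, so one energy has to defeat all of them at once.
  Integrability speaks of every path, which leaves the energy free; an explicit irrational square
  root or a countability argument supplies it. The factor \<open>m\<close> in \<open>d\<close> is
  chosen to make \<open>d v\<close> polynomial, so that \<open>d\<close> has no finite poles and
  vanishes at the finite singular points, where the equation for the coefficients becomes purely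
  algebraic. The towers consist of functions with arbitrary values at poles, which form no field;
  their Laurent expansions at the centre of the disc lie in one, and connectedness of the disc makes
  a vanishing expansion mean a vanishing function.\<close>

text \<open>
  For a derivation \<open>d\<close>, the polynomial \<open>F\<close> of degree \<open>N\<close> with coefficients \<open>f j\<close> satisfies
  \<open>d F + (Q + R X - X\<^sup>2) F' = (g - N X) F\<close>; the top coefficient forces the linear part of the cofactor.
\<close>

definition darboux_seq ::
  "('a :: comm_ring_1 \<Rightarrow> 'a) \<Rightarrow> 'a \<Rightarrow> 'a \<Rightarrow> nat \<Rightarrow> 'a \<Rightarrow> (nat \<Rightarrow> 'a) \<Rightarrow> bool" where
  "darboux_seq d Q R N g f \<longleftrightarrow>
     f N \<noteq> 0 \<and> (\<forall>j>N. f j = 0) \<and>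
     (\<forall>j. d (f j) + of_nat (Suc j) * Q * f (Suc j) + of_nat j * R * f j
          + (case j of 0 \<Rightarrow> 0 | Suc i \<Rightarrow> (of_nat N - of_nat i) * f i) = g * f j)"

text \<open>At the largest \<open>D\<close> with \<open>f D \<noteq> 0\<close> the equation for
  \<open>Suc D\<close> reduces to \<open>(N - D) f D = 0\<close>. So when coefficients are replaced
  by leading coefficients or by values at a point, the degree \<open>N\<close> cannot drop, and one
  surviving coefficient is enough.\<close>

lemma darboux_seq_top:
  fixes f :: "nat \<Rightarrow> 'a :: {idom, ring_char_0}"
  assumes d0: "d 0 = 0"
    and supp: "\<forall>j>N. f j = 0"
    and eq: "\<And>j. d (f j) + of_nat (Suc j) * Q * f (Suc j) + of_nat j * R * f j
          + (case j of 0 \<Rightarrow> 0 | Suc i \<Rightarrow> (of_nat N - of_nat i) * f i) = g * f j"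
    and nz: "f j0 \<noteq> 0"
  shows "darboux_seq d Q R N g f"
proof -
  define D where "D = Max {j. j \<le> N \<and> f j \<noteq> 0}"
  have fin: "finite {j. j \<le> N \<and> f j \<noteq> 0}" by simp
  have "j0 \<in> {j. j \<le> N \<and> f j \<noteq> 0}" using nz supp by (auto simp: not_less[symmetric])
  hence D: "D \<in> {j. j \<le> N \<and> f j \<noteq> 0}" unfolding D_def using fin Max_in by blast
  have up: "f j = 0" if "j > D" for j
  proof (rule ccontr)
    assume "f j \<noteq> 0"
    hence "j \<in> {j. j \<le> N \<and> f j \<noteq> 0}" using supp by (auto simp: not_less[symmetric])
    hence "j \<le> D" unfolding D_def using fin by simp
    thus False using that by simp
  qed
  have "(of_nat N - of_nat D) * f D = 0"
    using eq[of "Suc D"] up[of "Suc D"] up[of "Suc (Suc D)"] d0 by simp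
  hence "(of_nat N :: 'a) = of_nat D" using D by simp
  hence "N = D" by simp
  hence "f N \<noteq> 0" using D by simp
  thus ?thesis unfolding darboux_seq_def using supp eq by blast
qed

section \<open>Subfields of a differential field\<close>

locale derivation =
  fixes d :: "'a :: field_char_0 \<Rightarrow> 'a"
  assumes d_add: "d (x + y) = d x + d y"
    and d_mult: "d (x * y) = d x * y + x * d y"
begin

lemma d_0 [simp]: "d 0 = 0"
  using d_add[of 0 0] by simp

lemma d_1 [simp]: "d 1 = 0"
  using d_mult[of 1 1] by simp

lemma d_minus: "d (- x) = - d x"
  using d_add[of x "- x"] by (simp add: eq_neg_iff_add_eq_0 add.commute)

lemma d_diff: "d (x - y) = d x - d y"
  using d_add[of x "- y"] by (simp add: d_minus)

lemma d_inverse: "d (inverse x) = - d x * inverse x * inverse x"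
proof (cases "x = 0")
  case False
  have "d x * inverse x + x * d (inverse x) = 0"
    using d_mult[of x "inverse x"] False by simp
  thus ?thesis using False by (simp add: field_simps eq_neg_iff_add_eq_0)
qed auto

definition dp :: "'a poly \<Rightarrow> 'a poly" where
  "dp = map_poly d"

lemma coeff_dp [simp]: "coeff (dp p) n = d (coeff p n)"
  by (simp add: dp_def coeff_map_poly)

lemma dp_0 [simp]: "dp 0 = 0" by (rule poly_eqI) simp

lemma dp_add: "dp (p + q) = dp p + dp q"
  by (rule poly_eqI) (simp add: d_add)

lemma dp_pCons: "dp (pCons a p) = pCons (d a) (dp p)"
  by (rule poly_eqI) (auto simp: coeff_pCons split: nat.splits)

lemma dp_smult: "dp (smult a p) = smult (d a) p + smult a (dp p)"
  by (rule poly_eqI) (simp add: d_mult)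

lemma dp_mult: "dp (p * q) = dp p * q + p * dp q"
  by (induction p)
    (simp_all add: dp_pCons dp_add dp_smult algebra_simps)

lemma d_poly: "d (poly p x) = poly (dp p) x + poly (pderiv p) x * d x"
  by (induction p) (simp_all add: dp_pCons pderiv_pCons d_add d_mult algebra_simps)

definition is_subfield :: "'a set \<Rightarrow> bool" where
  "is_subfield K \<longleftrightarrow> 1 \<in> K \<and> (\<forall>x\<in>K. \<forall>y\<in>K. x + y \<in> K \<and> x * y \<in> K) \<and>
     (\<forall>x\<in>K. - x \<in> K \<and> inverse x \<in> K \<and> d x \<in> K)"

context
  fixes K assumes K: "is_subfield K"
begin

lemma K_1: "1 \<in> K" and K_add: "x \<in> K \<Longrightarrow> y \<in> K \<Longrightarrow> x + y \<in> K"
  and K_mult: "x \<in> K \<Longrightarrow> y \<in> K \<Longrightarrow> x * y \<in> K"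
  and K_minus: "x \<in> K \<Longrightarrow> - x \<in> K" and K_inverse: "x \<in> K \<Longrightarrow> inverse x \<in> K"
  and K_d: "x \<in> K \<Longrightarrow> d x \<in> K"
  using K by (auto simp: is_subfield_def)

lemma K_0: "0 \<in> K"
  using K_add[OF K_1 K_minus[OF K_1]] by simp

lemma K_diff: "x \<in> K \<Longrightarrow> y \<in> K \<Longrightarrow> x - y \<in> K"
  using K_add[of x "- y"] K_minus[of y] by simp

lemma K_divide: "x \<in> K \<Longrightarrow> y \<in> K \<Longrightarrow> x / y \<in> K"
  using K_mult[of x "inverse y"] K_inverse[of y] by (simp add: divide_inverse)

lemma K_of_nat: "of_nat n \<in> K"
  by (induction n) (auto intro: K_0 K_1 K_add)

lemma K_sum: "(\<And>i. i \<in> A \<Longrightarrow> f i \<in> K) \<Longrightarrow> sum f A \<in> K"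
  by (induction A rule: infinite_finite_induct) (auto intro: K_0 K_add)

lemma K_power: "x \<in> K \<Longrightarrow> x ^ n \<in> K"
  by (induction n) (auto intro: K_1 K_mult)

end

lemmas K_intros = K_1 K_0 K_add K_mult K_minus K_inverse K_d K_diff K_divide K_of_nat K_sum K_power

end

definition polys :: "'a :: zero set \<Rightarrow> 'a poly set" where
  "polys K = {p. \<forall>i. coeff p i \<in> K}"

context derivation
begin

context
  fixes K assumes K: "is_subfield K"
begin

lemma polys_add: "p \<in> polys K \<Longrightarrow> q \<in> polys K \<Longrightarrow> p + q \<in> polys K"
  by (auto simp: polys_def K_add[OF K])

lemma polys_diff: "p \<in> polys K \<Longrightarrow> q \<in> polys K \<Longrightarrow> p - q \<in> polys K"
  by (auto simp: polys_def K_diff[OF K])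

lemma polys_minus: "p \<in> polys K \<Longrightarrow> - p \<in> polys K"
  by (auto simp: polys_def K_minus[OF K])

lemma polys_mult: "p \<in> polys K \<Longrightarrow> q \<in> polys K \<Longrightarrow> p * q \<in> polys K"
  by (auto simp: polys_def coeff_mult intro!: K_sum[OF K] K_mult[OF K])

lemma polys_smult: "c \<in> K \<Longrightarrow> q \<in> polys K \<Longrightarrow> smult c q \<in> polys K"
  by (auto simp: polys_def K_mult[OF K])

lemma polys_0: "0 \<in> polys K"
  by (auto simp: polys_def K_0[OF K])

lemma polys_pCons: "c \<in> K \<Longrightarrow> q \<in> polys K \<Longrightarrow> pCons c q \<in> polys K"
  by (auto simp: polys_def coeff_pCons split: nat.splits)

lemma polys_monom: "c \<in> K \<Longrightarrow> monom c n \<in> polys K"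
  by (auto simp: polys_def K_0[OF K])

lemma polys_pderiv: "q \<in> polys K \<Longrightarrow> pderiv q \<in> polys K"
  by (auto simp: polys_def coeff_pderiv simp del: of_nat_Suc intro!: K_mult[OF K] K_of_nat[OF K])

lemma polys_dp: "q \<in> polys K \<Longrightarrow> dp q \<in> polys K"
  by (auto simp: polys_def K_d[OF K])

lemma polys_1: "1 \<in> polys K"
  using polys_pCons[OF K_1[OF K] polys_0] by (simp add: one_pCons)

lemma poly_in_K: "p \<in> polys K \<Longrightarrow> x \<in> K \<Longrightarrow> poly p x \<in> K"
  by (auto simp: polys_def poly_altdef intro!: K_sum[OF K] K_mult[OF K] K_power[OF K])

lemma polys_sum: "(\<And>i. i \<in> A \<Longrightarrow> f i \<in> polys K) \<Longrightarrow> sum f A \<in> polys K"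
  by (induction A rule: infinite_finite_induct) (auto intro: polys_0 polys_add)

text \<open>Long division inverts only the leading coefficient of \<open>H\<close>, so quotient and
  remainder stay over \<open>K\<close>.\<close>

lemma polys_division:
  assumes "H \<in> polys K" "H \<noteq> 0" "G \<in> polys K"
  shows "\<exists>q\<in>polys K. \<exists>r\<in>polys K. G = q * H + r \<and> (r = 0 \<or> degree r < degree H)"
  using assms(3)
proof (induction "degree G" arbitrary: G rule: less_induct)
  case less
  show ?case
  proof (cases "G = 0 \<or> degree G < degree H")
    case True
    thus ?thesis using less.prems polys_0 by (intro bexI[of _ 0] bexI[of _ G]) auto
  next
    case False
    define c where "c = lead_coeff G / lead_coeff H"
    define q0 where "q0 = monom c (degree G - degree H)"
    define G' where "G' = G - q0 * H"
    have c: "c \<in> K" "c \<noteq> 0" using less.prems assms False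
      by (auto simp: c_def polys_def intro!: K_divide[OF K])
    have q0: "q0 \<in> polys K" unfolding q0_def by (rule polys_monom) fact
    have G': "G' \<in> polys K" unfolding G'_def
      by (intro polys_diff polys_mult less.prems q0 assms)
    have nz: "q0 \<noteq> 0" using c by (simp add: q0_def monom_eq_0_iff)
    have deg: "degree (q0 * H) = degree G"
      using False c nz assms by (simp add: degree_mult_eq q0_def degree_monom_eq)
    have lc: "coeff (q0 * H) (degree G) = lead_coeff G"
      using deg lead_coeff_mult[of q0 H] assms c
      by (simp add: q0_def degree_monom_eq c_def)
    have "G' = 0 \<or> degree G' < degree G"
    proof (cases "degree G = 0")
      case True
      have "G' = 0"
      proof (rule poly_eqI)
        fix n show "coeff G' n = coeff 0 n"
        using lc deg True by (cases n) (auto simp: G'_def coeff_eq_0)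
      qed
      thus ?thesis ..
    next
      case False
      have "degree G' \<le> degree G" unfolding G'_def by (intro degree_diff_le) (auto simp: deg)
      moreover have "coeff G' (degree G) = 0" using lc by (simp add: G'_def)
      ultimately show ?thesis
        by (metis False leading_coeff_0_iff le_neq_implies_less)
    qed
    thus ?thesis
    proof
      assume "G' = 0"
      thus ?thesis using q0 polys_0 by (intro bexI[of _ q0] bexI[of _ 0]) (auto simp: G'_def)
    next
      assume "degree G' < degree G"
      from less.hyps[OF this G'] obtain q r where qr: "q \<in> polys K" "r \<in> polys K"
        "G' = q * H + r" "r = 0 \<or> degree r < degree H" by blast
      have "G = (q0 + q) * H + r" using qr(3) by (simp add: G'_def algebra_simps)
      thus ?thesis using qr q0 polys_add by blast
    qed
  qed
qed

end

lemmas polys_intros = polys_add polys_diff polys_minus polys_mult polys_smult polys_0 polys_pCons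
  polys_monom polys_pderiv polys_dp polys_1 polys_sum

text \<open>A denominator with \<open>poly q \<alpha> = 0\<close> is harmless: the quotient is then
  \<open>0\<close>, which belongs to \<open>K(\<alpha>)\<close> anyway.\<close>

definition adjoin :: "'a set \<Rightarrow> 'a \<Rightarrow> 'a set" where
  "adjoin K \<alpha> = {poly p \<alpha> / poly q \<alpha> | p q. p \<in> polys K \<and> q \<in> polys K}"

lemma adjoinI: "p \<in> polys K \<Longrightarrow> q \<in> polys K \<Longrightarrow> x = poly p \<alpha> / poly q \<alpha> \<Longrightarrow> x \<in> adjoin K \<alpha>"
  by (auto simp: adjoin_def)

lemma adjoinE:
  assumes "x \<in> adjoin K \<alpha>" "is_subfield K"
  obtains p q where "p \<in> polys K" "q \<in> polys K" "poly q \<alpha> \<noteq> 0" "x = poly p \<alpha> / poly q \<alpha>"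
proof -
  obtain p q where pq: "p \<in> polys K" "q \<in> polys K" "x = poly p \<alpha> / poly q \<alpha>"
    using assms by (auto simp: adjoin_def)
  show ?thesis
  proof (cases "poly q \<alpha> = 0")
    case True
    thus ?thesis using that[of 0 1] pq polys_0 polys_1 assms(2) by auto
  qed (use that pq in blast)
qed

lemma in_adjoin: "is_subfield K \<Longrightarrow> \<alpha> \<in> adjoin K \<alpha>"
  by (rule adjoinI[of "[:0, 1:]" _ 1]) (auto intro!: polys_intros K_intros)

lemma subset_adjoin: "is_subfield K \<Longrightarrow> K \<subseteq> adjoin K \<alpha>"
proof
  fix x assume "is_subfield K" "x \<in> K"
  thus "x \<in> adjoin K \<alpha>"
    by (intro adjoinI[of "[:x:]" _ 1]) (auto intro!: polys_intros K_intros)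
qed

lemma is_subfield_adjoin:
  assumes K: "is_subfield K" and da: "d \<alpha> \<in> adjoin K \<alpha>"
  shows "is_subfield (adjoin K \<alpha>)"
proof -
  note I = polys_intros[OF K] K_intros[OF K]
  have add: "x + y \<in> adjoin K \<alpha>" if xy: "x \<in> adjoin K \<alpha>" "y \<in> adjoin K \<alpha>" for x y
  proof -
    obtain p q where 1: "p \<in> polys K" "q \<in> polys K" "poly q \<alpha> \<noteq> 0" "x = poly p \<alpha> / poly q \<alpha>"
      using adjoinE[OF xy(1) K] .
    obtain p' q' where 2: "p' \<in> polys K" "q' \<in> polys K" "poly q' \<alpha> \<noteq> 0" "y = poly p' \<alpha> / poly q' \<alpha>"
      using adjoinE[OF xy(2) K] .
    show ?thesis
      by (rule adjoinI[of "p * q' + p' * q" _ "q * q'"])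
        (use 1 2 in \<open>auto intro!: I simp: add_frac_eq\<close>)
  qed
  have mult: "x * y \<in> adjoin K \<alpha>" if xy: "x \<in> adjoin K \<alpha>" "y \<in> adjoin K \<alpha>" for x y
  proof -
    obtain p q where 1: "p \<in> polys K" "q \<in> polys K" "poly q \<alpha> \<noteq> 0" "x = poly p \<alpha> / poly q \<alpha>"
      using adjoinE[OF xy(1) K] .
    obtain p' q' where 2: "p' \<in> polys K" "q' \<in> polys K" "poly q' \<alpha> \<noteq> 0" "y = poly p' \<alpha> / poly q' \<alpha>"
      using adjoinE[OF xy(2) K] .
    show ?thesis
      by (rule adjoinI[of "p * p'" _ "q * q'"]) (use 1 2 in \<open>auto intro!: I\<close>)
  qed
  have minus: "- x \<in> adjoin K \<alpha>" and inv: "inverse x \<in> adjoin K \<alpha>" if x: "x \<in> adjoin K \<alpha>" for x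
  proof -
    obtain p q where 1: "p \<in> polys K" "q \<in> polys K" "poly q \<alpha> \<noteq> 0" "x = poly p \<alpha> / poly q \<alpha>"
      using adjoinE[OF x K] .
    show "- x \<in> adjoin K \<alpha>"
      by (rule adjoinI[of "- p" _ q]) (use 1 in \<open>auto intro!: I\<close>)
    show "inverse x \<in> adjoin K \<alpha>"
      by (rule adjoinI[of q _ p]) (use 1 in \<open>auto intro!: I\<close>)
  qed
  have poly: "poly p \<alpha> \<in> adjoin K \<alpha>" if "p \<in> polys K" for p
    by (rule adjoinI[of p _ 1]) (use that in \<open>auto intro!: I\<close>)
  have dpoly: "d (poly p \<alpha>) \<in> adjoin K \<alpha>" if "p \<in> polys K" for p
    unfolding d_poly by (intro add mult poly da) (use that in \<open>auto intro!: I\<close>)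
  have der: "d x \<in> adjoin K \<alpha>" if x: "x \<in> adjoin K \<alpha>" for x
  proof -
    obtain p q where 1: "p \<in> polys K" "q \<in> polys K" "poly q \<alpha> \<noteq> 0" "x = poly p \<alpha> / poly q \<alpha>"
      using adjoinE[OF x K] .
    have "d x = d (poly p \<alpha>) * inverse (poly q \<alpha>)
      + poly p \<alpha> * (- d (poly q \<alpha>) * inverse (poly q \<alpha>) * inverse (poly q \<alpha>))"
      unfolding 1 divide_inverse d_mult d_inverse by simp
    also have "\<dots> \<in> adjoin K \<alpha>"
      by (intro add mult minus inv dpoly poly 1)
    finally show ?thesis .
  qed
  have "1 \<in> adjoin K \<alpha>" using poly[of 1] I by simp
  thus ?thesis unfolding is_subfield_def by (intro conjI ballI add mult minus inv der)
qed

definition algebraic_elem :: "'a set \<Rightarrow> 'a \<Rightarrow> bool" where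
  "algebraic_elem K \<alpha> \<longleftrightarrow> (\<exists>p\<in>polys K. p \<noteq> 0 \<and> poly p \<alpha> = 0)"

text \<open>For \<open>p\<close> of least degree annihilating \<alpha>, \<open>pderiv p\<close> is
  nonzero of smaller degree and so does not vanish at \<alpha>. Differentiating
  \<open>poly p \<alpha> = 0\<close> then expresses \<open>d \<alpha>\<close> as a quotient.\<close>

lemma d_algebraic_elem:
  assumes K: "is_subfield K" and a: "algebraic_elem K \<alpha>"
  shows "d \<alpha> \<in> adjoin K \<alpha>"
proof -
  define P where "P p \<longleftrightarrow> p \<in> polys K \<and> p \<noteq> 0 \<and> poly p \<alpha> = 0" for p
  obtain p0 where "P p0" using a by (auto simp: algebraic_elem_def P_def)
  then obtain p where p: "P p" and min: "\<And>q. P q \<Longrightarrow> degree p \<le> degree q"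
    using ex_has_least_nat[of P p0 degree] by blast
  have "degree p \<noteq> 0"
  proof
    assume "degree p = 0"
    then obtain c where "p = [:c:]" by (rule degree_eq_zeroE)
    thus False using p by (simp add: P_def)
  qed
  hence "pderiv p \<noteq> 0" by (simp add: pderiv_eq_0_iff)
  moreover have "degree (pderiv p) < degree p"
    using \<open>degree p \<noteq> 0\<close> by (simp add: degree_pderiv)
  ultimately have nz: "poly (pderiv p) \<alpha> \<noteq> 0"
    using min[of "pderiv p"] p polys_pderiv[OF K] by (auto simp: P_def)
  have "0 = poly (dp p) \<alpha> + poly (pderiv p) \<alpha> * d \<alpha>"
    using p d_poly[of p \<alpha>] by (simp add: P_def)
  hence "d \<alpha> = poly (- dp p) \<alpha> / poly (pderiv p) \<alpha>"
    using nz by (simp add: field_simps eq_neg_iff_add_eq_0)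
  moreover have "p \<in> polys K" using p by (simp add: P_def)
  ultimately show ?thesis by (intro adjoinI[of "- dp p" _ "pderiv p"] polys_intros[OF K])
qed

text \<open>Gaussian elimination on \<open>n + 1\<close> vectors of \<open>K^n\<close>. The relation
  has coefficients in \<open>K\<close>, not only in the surrounding field.\<close>

lemma subfield_dependence:
  assumes K: "is_subfield K" and "\<And>j i :: nat. a j i \<in> K"
  shows "\<exists>c. (\<forall>j. c j \<in> K) \<and> (\<exists>j\<le>n::nat. c j \<noteq> 0) \<and> (\<forall>i<n. (\<Sum>j\<le>n. c j * a j i) = 0)"
  using assms(2)
proof (induction n arbitrary: a)
  case 0
  show ?case by (rule exI[of _ "\<lambda>_. 1"]) (auto intro: K_1[OF K])
next
  case (Suc n)
  show ?case
  proof (cases "\<exists>j\<le>Suc n. a j n \<noteq> 0")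
    case False
    obtain c where c: "\<forall>j. c j \<in> K" "\<exists>j\<le>n. c j \<noteq> 0" "\<forall>i<n. (\<Sum>j\<le>n. c j * a j i) = 0"
      using Suc.IH[of a] Suc.prems by blast
    define c' where "c' j = (if j \<le> n then c j else 0)" for j
    have "(\<Sum>j\<le>Suc n. c' j * a j i) = (\<Sum>j\<le>n. c j * a j i)" for i
      by (simp add: c'_def)
    moreover have "(\<Sum>j\<le>n. c j * a j n) = 0"
      using False by (intro sum.neutral) auto
    ultimately have "\<forall>i<Suc n. (\<Sum>j\<le>Suc n. c' j * a j i) = 0"
      using c(3) less_Suc_eq by auto
    moreover have "\<forall>j. c' j \<in> K" using c(1) K_0[OF K] by (auto simp: c'_def)
    moreover obtain j where "j \<le> n" "c j \<noteq> 0" using c(2) by blast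
    hence "j \<le> Suc n \<and> c' j \<noteq> 0" by (simp add: c'_def)
    ultimately show ?thesis by blast
  next
    case True
    then obtain j0 where j0: "j0 \<le> Suc n" "a j0 n \<noteq> 0" by blast
    \<comment> \<open>The pivot row \<open>j0\<close> is moved to the last place; the multiples
      \<open>l j\<close> of it clear column \<open>n\<close> in the other rows.\<close>
    define \<pi> where "\<pi> = Transposition.transpose j0 (Suc n)"
    define b where "b j = a (\<pi> j)" for j
    define l where "l j = b j n / b (Suc n) n" for j
    have bS: "b (Suc n) n \<noteq> 0" using j0 by (simp add: b_def \<pi>_def)
    have bK: "b j i \<in> K" for j i using Suc.prems by (simp add: b_def)
    have lK: "l j \<in> K" for j unfolding l_def by (intro K_divide[OF K] bK)
    have "b j i - l j * b (Suc n) i \<in> K" for i j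
      by (intro K_diff[OF K] K_mult[OF K] lK bK)
    then obtain c where c: "\<forall>j. c j \<in> K" "\<exists>j\<le>n. c j \<noteq> 0"
      "\<forall>i<n. (\<Sum>j\<le>n. c j * (b j i - l j * b (Suc n) i)) = 0"
      using Suc.IH[of "\<lambda>j i. b j i - l j * b (Suc n) i"] by blast
    define c' where "c' j = (if j \<le> n then c j else - (\<Sum>j\<le>n. c j * l j))" for j
    have c'K: "c' j \<in> K" for j
      using c(1) by (auto simp: c'_def intro!: K_minus[OF K] K_sum[OF K] K_mult[OF K] lK)
    have s: "(\<Sum>j\<le>Suc n. c' j * b j i) = (\<Sum>j\<le>n. c j * (b j i - l j * b (Suc n) i))" for i
      by (simp add: c'_def sum_distrib_left sum_distrib_right algebra_simps sum_subtractf)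
    have "(\<Sum>j\<le>n. c j * (b j n - l j * b (Suc n) n)) = 0"
      using bS by (intro sum.neutral) (auto simp: l_def)
    hence z: "(\<Sum>j\<le>Suc n. c' j * b j i) = 0" if "i < Suc n" for i
      using that c(3) by (cases "i = n") (simp_all add: s del: sum.atMost_Suc)
    have perm: "bij_betw \<pi> {..Suc n} {..Suc n}"
      using j0 unfolding \<pi>_def by (intro permutes_imp_bij permutes_swap_id) auto
    have inv: "\<pi> (\<pi> j) = j" for j by (simp add: \<pi>_def)
    have eq: "(\<Sum>j\<le>Suc n. c' (\<pi> j) * a j i) = (\<Sum>j\<le>Suc n. c' j * b j i)" for i
      using sum.reindex_bij_betw[OF perm, of "\<lambda>j. c' (\<pi> j) * a j i"]
      by (simp add: b_def inv del: sum.atMost_Suc)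
    have "\<forall>i<Suc n. (\<Sum>j\<le>Suc n. c' (\<pi> j) * a j i) = 0" unfolding eq using z by blast
    moreover obtain j where j: "j \<le> n" "c j \<noteq> 0" using c(2) by blast
    have "\<pi> j \<le> Suc n" using perm j(1) by (auto simp: bij_betw_def)
    hence "\<exists>j\<le>Suc n. c' (\<pi> j) \<noteq> 0"
      using j by (intro exI[of _ "\<pi> j"]) (auto simp: inv c'_def)
    ultimately show ?thesis using c'K by (intro exI[of _ "\<lambda>j. c' (\<pi> j)"]) blast
  qed
qed

end

section \<open>Descent of Darboux polynomials\<close>

context derivation
begin

definition darboux_op :: "'a \<Rightarrow> 'a \<Rightarrow> 'a poly \<Rightarrow> 'a poly" where
  "darboux_op Q R F = dp F + [:Q, R, -1:] * pderiv F"

lemma darboux_op_mult: "darboux_op Q R (F * G) = darboux_op Q R F * G + F * darboux_op Q R G"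
  by (simp add: darboux_op_def dp_mult pderiv_mult algebra_simps del: mult_pCons_left mult_pCons_right)

lemma coeff_darboux_op:
  "coeff (darboux_op Q R F) j =
     d (coeff F j) + of_nat (Suc j) * Q * coeff F (Suc j) + of_nat j * R * coeff F j
     - (case j of 0 \<Rightarrow> 0 | Suc i \<Rightarrow> of_nat i * coeff F i)"
  by (auto simp: darboux_op_def coeff_pCons coeff_pderiv algebra_simps split: nat.splits)

text \<open>\<open>N \<ge> 1\<close> excludes the nonzero elements of \<open>K\<close>, which divide
  everything. Membership of the cofactor \<open>g\<close> in \<open>K\<close> is not stated; for
  \<open>R \<in> K\<close> it follows from \<open>darboux_seq_cofactor\<close>.\<close>

definition has_darboux :: "'a set \<Rightarrow> 'a \<Rightarrow> 'a \<Rightarrow> bool" where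
  "has_darboux K Q R \<longleftrightarrow> (\<exists>N\<ge>1. \<exists>g f. (\<forall>j. f j \<in> K) \<and> darboux_seq d Q R N g f)"

lemma darboux_seq_imp_poly:
  assumes "darboux_seq d Q R N g f"
  obtains F where "coeff F = f" "degree F = N" "darboux_op Q R F = F * [:g, - of_nat N:]"
proof
  define F where "F = (\<Sum>j\<le>N. monom (f j) j)"
  have supp: "\<forall>j>N. f j = 0" and fN: "f N \<noteq> 0" using assms by (auto simp: darboux_seq_def)
  show cF: "coeff F = f"
  proof
    fix j show "coeff F j = f j"
      using supp by (cases "j \<le> N") (simp_all add: F_def coeff_sum coeff_monom)
  qed
  show "degree F = N"
    by (rule antisym) (use supp fN cF in \<open>auto intro!: degree_le le_degree\<close>)
  show "darboux_op Q R F = F * [:g, - of_nat N:]"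
  proof (rule poly_eqI)
    fix j
    have "d (f j) + of_nat (Suc j) * Q * f (Suc j) + of_nat j * R * f j
          + (case j of 0 \<Rightarrow> 0 | Suc i \<Rightarrow> (of_nat N - of_nat i) * f i) = g * f j"
      using assms unfolding darboux_seq_def by blast
    thus "coeff (darboux_op Q R F) j = coeff (F * [:g, - of_nat N:]) j"
      unfolding coeff_darboux_op cF
      by (auto simp: coeff_pCons cF algebra_simps split: nat.splits)
  qed
qed

text \<open>The operator raises the degree by at most one, so the cofactor is at most linear, and
  the coefficient at \<open>X^(N + 1)\<close> forces its linear part to be
  \<open>- N X\<close>.\<close>

lemma dvd_imp_darboux_seq:
  assumes "F dvd darboux_op Q R F" "degree F \<ge> 1"
  shows "\<exists>g. darboux_seq d Q R (degree F) g (coeff F)"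
proof -
  define N where "N = degree F"
  have N: "N \<ge> 1" "coeff F N \<noteq> 0" using assms by (auto simp: N_def)
  obtain C where C: "darboux_op Q R F = F * C" using assms(1) by (auto elim: dvdE)
  have z: "coeff F j = 0" if "j > N" for j using that by (simp add: N_def coeff_eq_0)
  have top: "coeff (darboux_op Q R F) (Suc N) = - of_nat N * coeff F N"
    unfolding coeff_darboux_op by (simp add: z)
  have "coeff (darboux_op Q R F) (Suc N) \<noteq> 0" unfolding top using N by simp
  hence C0: "C \<noteq> 0" unfolding C by auto
  have "degree (darboux_op Q R F) \<le> Suc N"
    by (rule degree_le) (auto simp: coeff_darboux_op z split: nat.splits)
  hence "degree C \<le> 1"
    unfolding C using C0 N by (subst (asm) degree_mult_eq) (auto simp: N_def)
  then obtain g c where gc: "C = [:g, c:]"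
    by (metis degree1_coeffs degree_0_id One_nat_def le_SucE le_zero_eq pCons_0_0)
  have "coeff (F * C) (Suc N) = c * coeff F N"
    unfolding gc by (simp add: z coeff_pCons)
  hence "c * coeff F N = (- of_nat N) * coeff F N" using top C by simp
  hence "c = - of_nat N" using N(2) mult_right_cancel by blast
  have "darboux_seq d Q R N g (coeff F)" unfolding darboux_seq_def
  proof (intro conjI allI impI)
    fix j
    show "d (coeff F j) + of_nat (Suc j) * Q * coeff F (Suc j) + of_nat j * R * coeff F j
          + (case j of 0 \<Rightarrow> 0 | Suc i \<Rightarrow> (of_nat N - of_nat i) * coeff F i) = g * coeff F j"
      using arg_cong[OF C, of "\<lambda>p. coeff p j"] unfolding coeff_darboux_op gc \<open>c = _\<close>
      by (auto simp: coeff_pCons algebra_simps split: nat.splits)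
  qed (use N z in auto)
  thus ?thesis unfolding N_def by blast
qed

lemma polys_darboux_op:
  assumes "is_subfield K" "Q \<in> K" "R \<in> K" "F \<in> polys K"
  shows "darboux_op Q R F \<in> polys K"
  unfolding darboux_op_def using assms
  by (intro polys_intros[OF assms(1)] K_intros[OF assms(1)]) auto

section \<open>Descent through algebraic extensions\<close>

lemma polys_pcompose:
  assumes K: "is_subfield K" and "p \<in> polys K" "q \<in> polys K"
  shows "pcompose p q \<in> polys K"
  using assms(2)
proof (induction p)
  case 0
  thus ?case using polys_0[OF K] by simp
next
  case (pCons a p)
  have "coeff (pCons a p) 0 \<in> K" "coeff (pCons a p) (Suc i) \<in> K" for i
    using pCons.prems by (simp_all only: polys_def mem_Collect_eq)
  hence "a \<in> K" "p \<in> polys K" by (simp_all add: polys_def)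
  thus ?case unfolding pcompose_pCons
    by (intro polys_intros[OF K] pCons.IH assms)
qed

text \<open>\<open>P\<close> is any annihilating polynomial, possibly reducible, so inverses are not
  taken modulo \<open>P\<close>. Instead the powers of \<open>z = poly q \<alpha>\<close> lie in the
  span of \<open>n\<close> elements over \<open>K\<close>; hence \<open>z\<close> is algebraic over
  \<open>K\<close>, and \<open>inverse z\<close> is a polynomial in \<open>z\<close>.\<close>

lemma adjoin_algebraic_span:
  assumes K: "is_subfield K" and alg: "algebraic_elem K \<alpha>"
  obtains n where
    "\<And>x. x \<in> adjoin K \<alpha> \<Longrightarrow> \<exists>a. (\<forall>i::nat. a i \<in> K) \<and> x = (\<Sum>i<n. a i * \<alpha> ^ i)"
proof -
  obtain P where P: "P \<in> polys K" "P \<noteq> 0" "poly P \<alpha> = 0"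
    using alg by (auto simp: algebraic_elem_def)
  define n where "n = degree P"
  have n: "n > 0" using P unfolding n_def
    by (metis degree_eq_zeroE mult_eq_0_iff neq0_conv pCons_eq_0_iff poly_0 poly_pCons add.right_neutral)
  have span: "\<exists>a. (\<forall>i::nat. a i \<in> K) \<and> poly p \<alpha> = (\<Sum>i<n. a i * \<alpha> ^ i)" if p: "p \<in> polys K" for p
  proof -
    obtain q r where qr: "q \<in> polys K" "r \<in> polys K" "p = q * P + r" "r = 0 \<or> degree r < n"
      using polys_division[OF K P(1,2) p] unfolding n_def by blast
    have "poly p \<alpha> = poly r \<alpha>" using qr P by simp
    also have "\<dots> = (\<Sum>i<n. coeff r i * \<alpha> ^ i)"
    proof (cases "r = 0")
      case False
      hence "degree r < n" using qr by blast
      thus ?thesis unfolding poly_altdef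
        by (intro sum.mono_neutral_left) (auto simp: coeff_eq_0)
    qed auto
    finally show ?thesis using qr(2) by (intro exI[of _ "coeff r"]) (auto simp: polys_def)
  qed
  have inv: "\<exists>p\<in>polys K. inverse (poly q \<alpha>) = poly p \<alpha>" if q: "q \<in> polys K" "poly q \<alpha> \<noteq> 0" for q
  proof -
    define z where "z = poly q \<alpha>"
    have "q ^ k \<in> polys K" for k by (induction k) (auto intro!: polys_intros[OF K] q)
    hence "\<forall>k. \<exists>a. (\<forall>i::nat. a i \<in> K) \<and> z ^ k = (\<Sum>i<n. a i * \<alpha> ^ i)"
      using span[of "q ^ k" for k] by (simp add: z_def)
    then obtain a where a: "\<And>k i. a k i \<in> K" "\<And>k. z ^ k = (\<Sum>i<n. a k i * \<alpha> ^ i)"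
      by metis
    obtain c where c: "\<forall>j. c j \<in> K" "\<exists>j\<le>n. c j \<noteq> 0" "\<forall>i<n. (\<Sum>j\<le>n. c j * a j i) = 0"
      using subfield_dependence[OF K, of a n] a(1) by blast
    define C where "C = (\<Sum>j\<le>n. monom (c j) j)"
    have C: "C \<in> polys K" unfolding C_def using c(1) by (auto intro!: polys_intros[OF K])
    have "poly C z = (\<Sum>j\<le>n. c j * (\<Sum>i<n. a j i * \<alpha> ^ i))"
      by (simp add: C_def poly_sum poly_monom a(2))
    also have "\<dots> = (\<Sum>i<n. \<Sum>j\<le>n. c j * a j i * \<alpha> ^ i)"
      by (subst sum.swap) (simp add: sum_distrib_left mult.assoc)
    also have "\<dots> = (\<Sum>i<n. (\<Sum>j\<le>n. c j * a j i) * \<alpha> ^ i)" by (simp add: sum_distrib_right)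
    also have "\<dots> = 0" using c(3) by simp
    finally have C0: "poly C z = 0" .
    obtain j where j: "j \<le> n" "c j \<noteq> 0" using c(2) by blast
    have "coeff C j = c j" using j(1) by (simp add: C_def coeff_sum coeff_monom)
    hence Cn: "C \<noteq> 0" using j by auto
    define S where "S p \<longleftrightarrow> p \<in> polys K \<and> p \<noteq> 0 \<and> poly p z = 0" for p
    have "S C" using C C0 Cn by (simp add: S_def)
    then obtain p where p: "S p" and min: "\<And>q. S q \<Longrightarrow> degree p \<le> degree q"
      using ex_has_least_nat[of S C degree] by blast
    obtain b p' where bp: "p = pCons b p'" by (cases p)
    have cf: "coeff p i \<in> K" for i using p by (simp add: S_def polys_def)
    have b: "b \<in> K" using cf[of 0] by (simp add: bp)
    have p': "p' \<in> polys K" using cf[of "Suc i" for i] by (simp add: bp polys_def)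
    \<comment> \<open>If the constant coefficient vanished, division by the variable would leave an
      annihilating polynomial of \<open>z\<close> of smaller degree.\<close>
    have b0: "b \<noteq> 0"
    proof
      assume "b = 0"
      hence "S p'" using p p' q(2) by (auto simp: S_def bp z_def)
      from min[OF this] show False using \<open>b = 0\<close> p by (auto simp: bp S_def)
    qed
    have "b + z * poly p' z = 0" using p by (simp add: S_def bp)
    hence "inverse z = poly p' z * (- inverse b)"
      using b0 q(2) by (simp add: field_simps z_def eq_neg_iff_add_eq_0)
    also have "\<dots> = poly (smult (- inverse b) (pcompose p' q)) \<alpha>"
      by (simp add: poly_pcompose z_def)
    finally show ?thesis unfolding z_def using b p' q
      by (intro bexI[of _ "smult (- inverse b) (pcompose p' q)"])
        (auto intro!: polys_intros[OF K] K_intros[OF K] polys_pcompose[OF K])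
  qed
  show ?thesis
  proof (rule that[of n])
    fix x assume "x \<in> adjoin K \<alpha>"
    from adjoinE[OF this K] obtain p q where pq: "p \<in> polys K" "q \<in> polys K" "poly q \<alpha> \<noteq> 0"
      "x = poly p \<alpha> / poly q \<alpha>" .
    obtain r where r: "r \<in> polys K" "inverse (poly q \<alpha>) = poly r \<alpha>" using inv pq by blast
    have "x = poly (p * r) \<alpha>" using pq r by (simp add: divide_inverse)
    thus "\<exists>a. (\<forall>i::nat. a i \<in> K) \<and> x = (\<Sum>i<n. a i * \<alpha> ^ i)"
      using span[of "p * r"] polys_mult[OF K pq(1) r(1)] by simp
  qed
qed

text \<open>Contraction: the multiples of \<open>F\<close> with coefficients in \<open>K\<close> form an ideal that is stable
  under the derivation, and it is nonzero since \<open>K(\<alpha>)[X]/(F)\<close> has finite dimension over \<open>K\<close>.\<close>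

lemma has_darboux_algebraic:
  assumes K: "is_subfield K" and alg: "algebraic_elem K \<alpha>" and QR: "Q \<in> K" "R \<in> K"
    and S: "has_darboux (adjoin K \<alpha>) Q R"
  shows "has_darboux K Q R"
proof -
  define L where "L = adjoin K \<alpha>"
  have L: "is_subfield L" unfolding L_def
    by (rule is_subfield_adjoin[OF K d_algebraic_elem[OF K alg]])
  obtain n where n: "\<And>x. x \<in> L \<Longrightarrow> \<exists>a. (\<forall>i::nat. a i \<in> K) \<and> x = (\<Sum>i<n. a i * \<alpha> ^ i)"
    using adjoin_algebraic_span[OF K alg] unfolding L_def by blast
  obtain N g f where N: "N \<ge> 1" and f: "\<forall>j. f j \<in> L" and seq: "darboux_seq d Q R N g f"
    using S unfolding has_darboux_def L_def by blast
  obtain F where F: "coeff F = f" "degree F = N" "F dvd darboux_op Q R F"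
    using darboux_seq_imp_poly[OF seq] by (metis dvd_triv_left)
  have FL: "F \<in> polys L" using F(1) f by (simp add: polys_def)
  have F0: "F \<noteq> 0" using F(2) N by auto
  have red: "\<exists>r\<in>polys L. F dvd monom 1 k - r \<and> degree r < N" for k
  proof -
    obtain q r where qr: "q \<in> polys L" "r \<in> polys L" "monom 1 k = q * F + r"
      "r = 0 \<or> degree r < degree F"
      using polys_division[OF L FL F0 polys_monom[OF L K_1[OF L]]] by blast
    have "degree r < N" using qr(4) F(2) N by auto
    moreover have "monom 1 k - r = F * q" using qr(3) by simp
    ultimately show ?thesis using qr(2) by (intro bexI[of _ r]) auto
  qed
  then obtain r where r: "\<And>k. r k \<in> polys L" "\<And>k. F dvd monom 1 k - r k" "\<And>k. degree (r k) < N"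
    by metis
  have "\<forall>k j. \<exists>a. (\<forall>i::nat. a i \<in> K) \<and> coeff (r k) j = (\<Sum>i<n. a i * \<alpha> ^ i)"
    using n r(1) by (auto simp: polys_def)
  then obtain a where a: "\<And>k j i. a k j i \<in> K" "\<And>k j. coeff (r k) j = (\<Sum>i<n. a k j i * \<alpha> ^ i)"
    by metis
  \<comment> \<open>The residue \<open>r k\<close> of \<open>X^k\<close> modulo \<open>F\<close> has
    \<open>N\<close> coefficients with \<open>n\<close> coordinates each over \<open>K\<close>;
    \<open>j * n + i\<close> numbers the pairs. So \<open>m + 1\<close> residues are dependent over
    \<open>K\<close>, and the relation is a multiple \<open>H\<close> of \<open>F\<close> with
    coefficients in \<open>K\<close>.\<close>
  define m where "m = N * n"
  obtain c where c: "\<forall>k. c k \<in> K" "\<exists>k\<le>m. c k \<noteq> 0"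
    "\<forall>l<m. (\<Sum>k\<le>m. c k * a k (l div n) (l mod n)) = 0"
    using subfield_dependence[OF K, of "\<lambda>k l. a k (l div n) (l mod n)" m] a(1) by blast
  have zero: "(\<Sum>k\<le>m. c k * a k j i) = 0" if "j < N" "i < n" for i j
  proof -
    have "j * n + i < m"
    proof -
      have "j * n + i < Suc j * n" using that by simp
      also have "\<dots> \<le> N * n" using that by (intro mult_le_mono1) auto
      finally show ?thesis by (simp add: m_def)
    qed
    moreover have "(j * n + i) div n = j" "(j * n + i) mod n = i" using that by auto
    ultimately show ?thesis using c(3)[rule_format, of "j * n + i"] by simp
  qed
  define H where "H = (\<Sum>k\<le>m. monom (c k) k)"
  have HK: "H \<in> polys K" unfolding H_def using c(1) by (auto intro!: polys_intros[OF K])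
  have sumr: "(\<Sum>k\<le>m. smult (c k) (r k)) = 0"
  proof (rule poly_eqI)
    fix j
    show "coeff (\<Sum>k\<le>m. smult (c k) (r k)) j = coeff 0 j"
    proof (cases "j < N")
      case True
      have "coeff (\<Sum>k\<le>m. smult (c k) (r k)) j = (\<Sum>k\<le>m. \<Sum>i<n. c k * a k j i * \<alpha> ^ i)"
        by (simp add: coeff_sum a(2) sum_distrib_left mult.assoc)
      also have "\<dots> = (\<Sum>i<n. (\<Sum>k\<le>m. c k * a k j i) * \<alpha> ^ i)"
        by (subst sum.swap) (simp add: sum_distrib_right)
      also have "\<dots> = 0" using zero[OF True] by simp
      finally show ?thesis by simp
    next
      case False
      have "coeff (r k) j = 0" for k using r(3)[of k] False by (simp add: coeff_eq_0)
      thus ?thesis by (simp add: coeff_sum)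
    qed
  qed
  have "H = (\<Sum>k\<le>m. smult (c k) (monom 1 k - r k))"
    using sumr by (simp add: H_def smult_diff_right sum_subtractf smult_monom)
  also have "F dvd \<dots>" by (intro dvd_sum dvd_smult r)
  finally have FH: "F dvd H" .
  obtain k where k: "k \<le> m" "c k \<noteq> 0" using c(2) by blast
  have "coeff H k = c k" using k(1) by (simp add: H_def coeff_sum coeff_monom)
  hence H0: "H \<noteq> 0" using k by auto
  \<comment> \<open>The operator maps multiples of \<open>F\<close> to multiples of
    \<open>F\<close>. A member \<open>G\<close> of least degree divides its own image, since a
    nonzero remainder would be a member of smaller degree.\<close>
  define J where "J G \<longleftrightarrow> G \<in> polys K \<and> G \<noteq> 0 \<and> F dvd G" for G
  have "J H" using HK FH H0 by (simp add: J_def)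
  then obtain G where G: "J G" and min: "\<And>G'. J G' \<Longrightarrow> degree G \<le> degree G'"
    using ex_has_least_nat[of J H degree] by blast
  have GK: "G \<in> polys K" "G \<noteq> 0" "F dvd G" using G by (auto simp: J_def)
  have degG: "degree G \<ge> 1" using dvd_imp_degree_le[OF GK(3,2)] F N by simp
  obtain B where B: "G = F * B" using GK by (auto elim: dvdE)
  have FD: "F dvd darboux_op Q R G" unfolding B darboux_op_mult using F(3) by simp
  have DK: "darboux_op Q R G \<in> polys K" by (rule polys_darboux_op[OF K QR GK(1)])
  obtain q t where qt: "q \<in> polys K" "t \<in> polys K" "darboux_op Q R G = q * G + t"
    "t = 0 \<or> degree t < degree G"
    using polys_division[OF K GK(1,2) DK] by blast
  have "t = darboux_op Q R G - q * G" using qt(3) by simp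
  hence "F dvd t" using FD GK(3) by simp
  hence "t = 0" using min[of t] qt(2,4) by (metis J_def leD)
  hence "G dvd darboux_op Q R G" using qt(3) by simp
  from dvd_imp_darboux_seq[OF this degG] show ?thesis
    using GK(1) degG unfolding has_darboux_def polys_def by blast
qed

end

text \<open>\<open>m\<close> and \<open>n\<close> only bound the degrees, so the formula serves a
  whole family of coefficients at once, including those whose degree lies below the common
  bound.\<close>

lemma coeff_mult_bounded:
  fixes p q :: "'a :: comm_semiring_0 poly"
  assumes "degree p \<le> m" "degree q \<le> n"
  shows "coeff (p * q) (m + n) = coeff p m * coeff q n"
proof -
  have "coeff p i * coeff q (m + n - i) = 0" if "i \<le> m + n" "i \<noteq> m" for i
  proof (cases "i < m")
    case True
    hence "coeff q (m + n - i) = 0" using assms by (intro coeff_eq_0) auto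
    thus ?thesis by simp
  next
    case False
    hence "coeff p i = 0" using that assms by (intro coeff_eq_0) auto
    thus ?thesis by simp
  qed
  hence "coeff (p * q) (m + n) = (\<Sum>i\<in>{m}. coeff p i * coeff q (m + n - i))"
    unfolding coeff_mult by (intro sum.mono_neutral_right) auto
  thus ?thesis by simp
qed

section \<open>Descent through transcendental extensions\<close>

context derivation
begin

lemma darboux_seq_eq:
  assumes "darboux_seq d Q R N g f"
  shows "d (f j) + of_nat (Suc j) * Q * f (Suc j) + of_nat j * R * f j
          + (case j of 0 \<Rightarrow> 0 | Suc i \<Rightarrow> (of_nat N - of_nat i) * f i) = g * f j"
  using assms unfolding darboux_seq_def by blast

text \<open>Scaling \<open>F\<close> by \<open>c\<close> adds the logarithmic derivative of
  \<open>c\<close> to the cofactor; this is the price of clearing denominators.\<close>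

lemma darboux_seq_scale:
  assumes "darboux_seq d Q R N g f" "c \<noteq> 0"
  shows "darboux_seq d Q R N (g + d c / c) (\<lambda>j. c * f j)"
  unfolding darboux_seq_def
proof (intro conjI allI impI)
  fix j
  have "d (f j) + of_nat (Suc j) * Q * f (Suc j) + of_nat j * R * f j
          + (case j of 0 \<Rightarrow> 0 | Suc i \<Rightarrow> (of_nat N - of_nat i) * f i) = g * f j" (is "?l = ?r")
    using assms(1) unfolding darboux_seq_def by blast
  hence "c * ?l + d c * f j = c * ?r + d c * f j" by simp
  thus "d (c * f j) + of_nat (Suc j) * Q * (c * f (Suc j)) + of_nat j * R * (c * f j)
          + (case j of 0 \<Rightarrow> 0 | Suc i \<Rightarrow> (of_nat N - of_nat i) * (c * f i))
        = (g + d c / c) * (c * f j)"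
    using assms(2) by (cases j) (simp_all add: d_mult algebra_simps)
qed (use assms in \<open>auto simp: darboux_seq_def\<close>)

lemma darboux_seq_cofactor:
  assumes "darboux_seq d Q R N g f" "N \<ge> 1"
  shows "g = (d (f N) + of_nat N * R * f N + f (N - 1)) / f N"
proof -
  obtain i where i: "N = Suc i" using assms(2) by (cases N) auto
  have "f (Suc N) = 0" "f N \<noteq> 0" using assms(1) unfolding darboux_seq_def by auto
  moreover have "d (f N) + of_nat (Suc N) * Q * f (Suc N) + of_nat N * R * f N
          + (case N of 0 \<Rightarrow> 0 | Suc i \<Rightarrow> (of_nat N - of_nat i) * f i) = g * f N"
    using assms(1) unfolding darboux_seq_def by blast
  ultimately show ?thesis by (simp add: i field_simps)
qed

lemma common_denominator:
  assumes K: "is_subfield K" and "finite J" and "\<And>j. j \<in> J \<Longrightarrow> f j \<in> adjoin K \<alpha>"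
  shows "\<exists>q\<in>polys K. poly q \<alpha> \<noteq> 0 \<and> (\<forall>j\<in>J. \<exists>b\<in>polys K. poly q \<alpha> * f j = poly b \<alpha>)"
  using assms(2,3)
proof (induction J rule: finite_induct)
  case empty
  show ?case by (rule bexI[of _ 1]) (auto intro: polys_1[OF K])
next
  case (insert j J)
  obtain q where q: "q \<in> polys K" "poly q \<alpha> \<noteq> 0" "\<forall>j\<in>J. \<exists>b\<in>polys K. poly q \<alpha> * f j = poly b \<alpha>"
    using insert by blast
  have "f j \<in> adjoin K \<alpha>" using insert by blast
  from adjoinE[OF this K] obtain a s where as: "a \<in> polys K" "s \<in> polys K" "poly s \<alpha> \<noteq> 0"
    "f j = poly a \<alpha> / poly s \<alpha>" .
  have "\<exists>b\<in>polys K. poly (q * s) \<alpha> * f i = poly b \<alpha>" if i: "i \<in> insert j J" for i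
  proof (cases "i = j")
    case True
    thus ?thesis using as q by (intro bexI[of _ "q * a"] polys_mult[OF K]) auto
  next
    case False
    then obtain b where "b \<in> polys K" "poly q \<alpha> * f i = poly b \<alpha>" using q(3) i by blast
    thus ?thesis using as by (intro bexI[of _ "s * b"] polys_mult[OF K]) (auto simp: mult_ac)
  qed
  moreover have "q * s \<in> polys K" by (intro polys_mult[OF K] q as)
  moreover have "poly (q * s) \<alpha> \<noteq> 0" using q as by simp
  ultimately show ?case by blast
qed

text \<open>After scaling by a common denominator the coefficients are polynomials in \<alpha>. The
  cofactor is read off from the top coefficients, and remains a quotient
  \<open>s / t\<close>.\<close>

lemma clear_denominators:
  assumes K: "is_subfield K" and L: "is_subfield (adjoin K \<alpha>)"
    and S: "has_darboux (adjoin K \<alpha>) Q R" and R: "R \<in> adjoin K \<alpha>"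
  obtains N g b s t where "N \<ge> 1" "\<And>j. b j \<in> polys K" "\<And>j. j > N \<Longrightarrow> b j = 0"
    "darboux_seq d Q R N g (\<lambda>j. poly (b j) \<alpha>)"
    "s \<in> polys K" "t \<in> polys K" "poly t \<alpha> \<noteq> 0" "g = poly s \<alpha> / poly t \<alpha>"
proof -
  obtain N g f where N: "N \<ge> 1" and f: "\<And>j. f j \<in> adjoin K \<alpha>" and seq: "darboux_seq d Q R N g f"
    using S unfolding has_darboux_def by blast
  obtain q where q: "q \<in> polys K" "poly q \<alpha> \<noteq> 0"
    "\<forall>j\<in>{..N}. \<exists>b\<in>polys K. poly q \<alpha> * f j = poly b \<alpha>"
    using common_denominator[OF K, of "{..N}" f] f by blast
  then obtain b0 where b0: "\<And>j. j \<le> N \<Longrightarrow> b0 j \<in> polys K" "\<And>j. j \<le> N \<Longrightarrow> poly q \<alpha> * f j = poly (b0 j) \<alpha>"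
    by (metis atMost_iff)
  define b where "b j = (if j \<le> N then b0 j else 0)" for j
  define g' where "g' = g + d (poly q \<alpha>) / poly q \<alpha>"
  have "f j = 0" if "j > N" for j using seq that by (simp add: darboux_seq_def)
  hence eq: "(\<lambda>j. poly q \<alpha> * f j) = (\<lambda>j. poly (b j) \<alpha>)"
    using b0(2) by (auto simp: b_def)
  have seq': "darboux_seq d Q R N g' (\<lambda>j. poly (b j) \<alpha>)"
    using darboux_seq_scale[OF seq q(2)] unfolding eq g'_def .
  have bK: "b j \<in> polys K" for j using b0 polys_0[OF K] by (simp add: b_def)
  have bL: "poly (b j) \<alpha> \<in> adjoin K \<alpha>" for j
    by (intro poly_in_K[OF L] in_adjoin[OF K]) (use bK subset_adjoin[OF K] in \<open>auto simp: polys_def\<close>)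
  have "g' \<in> adjoin K \<alpha>" unfolding darboux_seq_cofactor[OF seq' N]
    by (intro K_intros[OF L] bL R)
  from adjoinE[OF this K] obtain s t where st: "s \<in> polys K" "t \<in> polys K" "poly t \<alpha> \<noteq> 0"
    "g' = poly s \<alpha> / poly t \<alpha>" .
  show ?thesis by (rule that[OF N bK _ seq' st]) (simp add: b_def)
qed

text \<open>The coefficients of the highest power of \<open>\<alpha>\<close> again form a Darboux sequence, since
  \<open>d \<alpha> = h0 + h1 * \<alpha>\<close> does not raise the degree in \<open>\<alpha>\<close>.\<close>

lemma has_darboux_transcendental:
  assumes K: "is_subfield K" and tr: "\<not> algebraic_elem K \<alpha>"
    and da: "d \<alpha> = h0 + h1 * \<alpha>" and h: "h0 \<in> K" "h1 \<in> K" and QR: "Q \<in> K" "R \<in> K"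
    and S: "has_darboux (adjoin K \<alpha>) Q R"
  shows "has_darboux K Q R"
proof -
  \<comment> \<open>Transcendence turns identities between values at \<alpha> into identities of
    polynomials, so that degrees in \<alpha> can be compared.\<close>
  have inj: "p = q" if "p \<in> polys K" "q \<in> polys K" "poly p \<alpha> = poly q \<alpha>" for p q
  proof -
    have "p - q \<in> polys K" "poly (p - q) \<alpha> = 0" using that polys_diff[OF K] by auto
    hence "p - q = 0" using tr unfolding algebraic_elem_def by blast
    thus ?thesis by simp
  qed
  have KL: "x \<in> adjoin K \<alpha>" if "x \<in> K" for x using subset_adjoin[OF K] that by blast
  have L: "is_subfield (adjoin K \<alpha>)"
  proof (rule is_subfield_adjoin[OF K])
    show "d \<alpha> \<in> adjoin K \<alpha>" unfolding da using h
      by (intro adjoinI[of "[:h0, h1:]" _ 1]) (auto intro!: polys_intros[OF K] K_intros[OF K])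
  qed
  obtain N g b s t where N: "N \<ge> 1" and b: "\<And>j. b j \<in> polys K" and b0: "\<And>j. j > N \<Longrightarrow> b j = 0"
    and seq: "darboux_seq d Q R N g (\<lambda>j. poly (b j) \<alpha>)"
    and st: "s \<in> polys K" "t \<in> polys K" "poly t \<alpha> \<noteq> 0" "g = poly s \<alpha> / poly t \<alpha>"
    by (rule clear_denominators[OF K L S KL[OF QR(2)]]) (rule that)
  define D where "D p = dp p + pderiv p * [:h0, h1:]" for p
  have D: "d (poly p \<alpha>) = poly (D p) \<alpha>" for p
    by (simp add: D_def d_poly da algebra_simps)
  have DK: "D p \<in> polys K" if "p \<in> polys K" for p
    unfolding D_def by (intro polys_intros[OF K] that h)
  define X where "X j = D (b j) + smult (of_nat (Suc j) * Q) (b (Suc j)) + smult (of_nat j * R) (b j)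
     + (case j of 0 \<Rightarrow> 0 | Suc i \<Rightarrow> smult (of_nat N - of_nat i) (b i))" for j
  have XK: "X j \<in> polys K" for j
    unfolding X_def by (cases j) (auto intro!: polys_intros[OF K] K_intros[OF K] DK b QR simp del: of_nat_Suc)
  have eq: "t * X j = s * b j" for j
  proof (rule inj)
    show "t * X j \<in> polys K" "s * b j \<in> polys K" by (intro polys_mult[OF K] st XK b)+
    have "poly (X j) \<alpha> = g * poly (b j) \<alpha>"
      using darboux_seq_eq[OF seq, of j] unfolding X_def by (cases j) (simp_all add: D)
    thus "poly (t * X j) \<alpha> = poly (s * b j) \<alpha>" using st by simp
  qed
  define M where "M = Max ((degree \<circ> b) ` {..N})"
  have fin: "finite ((degree \<circ> b) ` {..N})" by simp
  have M: "degree (b j) \<le> M" for j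
  proof (cases "j \<le> N")
    case True
    thus ?thesis unfolding M_def by (intro Max_ge) auto
  qed (use b0 in auto)
  have bN: "b N \<noteq> 0" using seq by (auto simp: darboux_seq_def)
  have "M \<in> (degree \<circ> b) ` {..N}" unfolding M_def by (intro Max_in) auto
  then obtain j1 where j1: "degree (b j1) = M" by auto
  have "\<exists>j. coeff (b j) M \<noteq> 0"
  proof (cases "b j1 = 0")
    case True
    hence "degree (b N) = M" using j1 M[of N] by simp
    thus ?thesis using bN by (metis leading_coeff_neq_0)
  qed (use j1 in \<open>metis leading_coeff_neq_0\<close>)
  then obtain j0 where j0: "coeff (b j0) M \<noteq> 0" by blast
  define l where "l = degree t"
  have t0: "t \<noteq> 0" using st by auto
  have degD: "degree (D (b j)) \<le> M" and coeffD: "coeff (D (b j)) M = d (coeff (b j) M) + of_nat M * h1 * coeff (b j) M" for j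
  proof -
    have z: "coeff (b j) k = 0" if "k > M" for k using M[of j] that by (simp add: coeff_eq_0)
    show "degree (D (b j)) \<le> M"
      by (rule degree_le)
        (auto simp: D_def z coeff_pderiv coeff_pCons split: nat.splits)
    show "coeff (D (b j)) M = d (coeff (b j) M) + of_nat M * h1 * coeff (b j) M"
      by (cases M) (auto simp: D_def z coeff_pderiv coeff_pCons algebra_simps)
  qed
  have degX: "degree (X j) \<le> M" for j
    unfolding X_def using degD M
    by (cases j) (auto intro!: degree_add_le simp del: of_nat_Suc intro: order.trans[OF degree_smult_le])
  \<comment> \<open>At \<open>j0\<close> the bound \<open>M\<close> is attained, so
    \<open>t * X j0 = s * b j0\<close> compares the degrees of \<open>s\<close> and
    \<open>t\<close>.\<close>
  have "degree s \<le> l"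
  proof (cases "s = 0")
    case False
    have "b j0 \<noteq> 0" using j0 by auto
    hence "degree (s * b j0) = degree s + M"
      using False M[of j0] j0 by (simp add: degree_mult_eq le_antisym le_degree)
    moreover have "degree (t * X j0) \<le> l + M"
      using degree_mult_le[of t "X j0"] degX[of j0] by (simp add: l_def)
    ultimately show ?thesis using eq by simp
  qed auto
  hence lead: "coeff t l * coeff (X j) M = coeff s l * coeff (b j) M" for j
    using arg_cong[OF eq[of j], of "\<lambda>p. coeff p (l + M)"] M[of j] degX[of j]
    by (simp add: coeff_mult_bounded l_def)
  have tl: "coeff t l \<noteq> 0" using t0 by (simp add: l_def)
  define h' where "h' j = coeff (b j) M" for j
  \<comment> \<open>The derivative of \<open>\<alpha>^M\<close> contributes \<open>M h1\<close> at
    degree \<open>M\<close>; this term is moved into the cofactor.\<close>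
  define g' where "g' = coeff s l / coeff t l - of_nat M * h1"
  have "darboux_seq d Q R N g' h'"
  proof (rule darboux_seq_top)
    show "h' j0 \<noteq> 0" "\<forall>j>N. h' j = 0" using j0 b0 by (auto simp: h'_def)
    fix j
    have "coeff (X j) M = coeff s l / coeff t l * h' j"
      using lead[of j] tl by (simp add: h'_def field_simps)
    thus "d (h' j) + of_nat (Suc j) * Q * h' (Suc j) + of_nat j * R * h' j
          + (case j of 0 \<Rightarrow> 0 | Suc i \<Rightarrow> (of_nat N - of_nat i) * h' i) = g' * h' j"
      by (cases j) (auto simp: X_def coeffD g'_def h'_def algebra_simps)
  qed auto
  moreover have "h' j \<in> K" for j using b by (auto simp: h'_def polys_def)
  ultimately show ?thesis using N unfolding has_darboux_def by blast
qed

text \<open>The linear equation for \<alpha> covers integrals (\<open>h1 = 0\<close>) and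
  exponentials of integrals (\<open>h0 = 0\<close>).\<close>

lemma has_darboux_adjoin:
  assumes K: "is_subfield K" and "algebraic_elem K \<alpha> \<or> (\<exists>h0\<in>K. \<exists>h1\<in>K. d \<alpha> = h0 + h1 * \<alpha>)"
    and "Q \<in> K" "R \<in> K" "has_darboux (adjoin K \<alpha>) Q R"
  shows "has_darboux K Q R"
  using has_darboux_algebraic[OF K] has_darboux_transcendental[OF K] assms by blast

lemma is_subfield_adjoin':
  assumes K: "is_subfield K" and "algebraic_elem K \<alpha> \<or> (\<exists>h0\<in>K. \<exists>h1\<in>K. d \<alpha> = h0 + h1 * \<alpha>)"
  shows "is_subfield (adjoin K \<alpha>)"
  using assms(2)
proof
  assume "\<exists>h0\<in>K. \<exists>h1\<in>K. d \<alpha> = h0 + h1 * \<alpha>"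
  then obtain h0 h1 where h: "h0 \<in> K" "h1 \<in> K" "d \<alpha> = h0 + h1 * \<alpha>" by blast
  show ?thesis
  proof (rule is_subfield_adjoin[OF K])
    show "d \<alpha> \<in> adjoin K \<alpha>" unfolding h(3) using h(1,2)
      by (intro adjoinI[of "[:h0, h1:]" _ 1]) (auto intro!: polys_intros[OF K] K_intros[OF K])
  qed
qed (use is_subfield_adjoin[OF K d_algebraic_elem[OF K]] in blast)

text \<open>The difference of \<open>Q + R X - X^2\<close> and \<open>Q + R W - W^2\<close> is
  \<open>(X - W) (R - W - X)\<close>, which gives degree 1 and \<open>g = R - W\<close>.\<close>

lemma has_darboux_riccati:
  assumes K: "is_subfield K" and "W \<in> K" "R \<in> K" and W: "d W = Q + R * W - W\<^sup>2"
  shows "has_darboux K Q R"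
proof -
  define f where "f j = (if j = 0 then - W else if j = 1 then 1 else 0)" for j :: nat
  have "darboux_seq d Q R 1 (R - W) f"
    unfolding darboux_seq_def
  proof (intro conjI allI impI)
    fix j show "d (f j) + of_nat (Suc j) * Q * f (Suc j) + of_nat j * R * f j
          + (case j of 0 \<Rightarrow> 0 | Suc i \<Rightarrow> (of_nat 1 - of_nat i) * f i) = (R - W) * f j"
    proof (cases j)
      case (Suc i)
      thus ?thesis by (cases i) (auto simp: f_def algebra_simps)
    qed (simp add: f_def d_minus W power2_eq_square algebra_simps)
  qed (auto simp: f_def)
  moreover have "f j \<in> K" for j using assms by (auto simp: f_def intro!: K_intros[OF K])
  ultimately show ?thesis unfolding has_darboux_def by blast
qed

end

section \<open>Darboux polynomials over a rational function field\<close>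

locale const_derivation = derivation d for d :: "'a :: field_char_0 \<Rightarrow> 'a" +
  fixes \<kappa> :: "complex \<Rightarrow> 'a"
  assumes \<kappa>_add: "\<kappa> (x + y) = \<kappa> x + \<kappa> y" and \<kappa>_mult: "\<kappa> (x * y) = \<kappa> x * \<kappa> y"
    and \<kappa>_1 [simp]: "\<kappa> 1 = 1" and d_\<kappa> [simp]: "d (\<kappa> x) = 0"
begin

lemma \<kappa>_0 [simp]: "\<kappa> 0 = 0" using \<kappa>_add[of 0 0] by simp

lemma \<kappa>_minus: "\<kappa> (- x) = - \<kappa> x"
  using \<kappa>_add[of x "- x"] by (simp add: eq_neg_iff_add_eq_0 add.commute)

lemma \<kappa>_inverse: "\<kappa> (inverse x) = inverse (\<kappa> x)"
proof (cases "x = 0")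
  case False
  hence "\<kappa> x * \<kappa> (inverse x) = 1" using \<kappa>_mult[of x "inverse x"] by simp
  thus ?thesis by (metis inverse_unique)
qed simp

lemma \<kappa>_eq_0_iff [simp]: "\<kappa> x = 0 \<longleftrightarrow> x = 0"
proof
  assume "\<kappa> x = 0"
  thus "x = 0" using \<kappa>_mult[of x "inverse x"] by (cases "x = 0") auto
qed simp

lemma \<kappa>_of_nat [simp]: "\<kappa> (of_nat n) = of_nat n"
  by (induction n) (auto simp: \<kappa>_add)

definition ev :: "'a \<Rightarrow> complex poly \<Rightarrow> 'a" where
  "ev v p = poly (map_poly \<kappa> p) v"

lemma ev_0 [simp]: "ev v 0 = 0" by (simp add: ev_def)

lemma ev_pCons [simp]: "ev v (pCons a p) = \<kappa> a + v * ev v p"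
  by (cases "a = 0 \<and> p = 0") (auto simp: ev_def map_poly_pCons)

lemma ev_1 [simp]: "ev v 1 = 1" by (simp add: one_pCons)

lemma ev_add: "ev v (p + q) = ev v p + ev v q"
  by (induction p q rule: poly_induct2) (auto simp: \<kappa>_add algebra_simps)

lemma ev_smult: "ev v (smult c q) = \<kappa> c * ev v q"
  by (induction q) (auto simp: \<kappa>_mult algebra_simps)

lemma ev_mult: "ev v (p * q) = ev v p * ev v q"
  by (induction p) (auto simp: ev_add ev_smult algebra_simps)

lemma ev_minus: "ev v (- q) = - ev v q"
  using ev_smult[of v "-1" q] \<kappa>_minus[of 1] by simp

lemma ev_of_nat [simp]: "ev v (of_nat n) = of_nat n"
  by (induction n) (auto simp: ev_add)

lemma is_subfield_range_\<kappa>: "is_subfield (range \<kappa>)"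
  unfolding is_subfield_def
proof (intro conjI ballI)
  show "1 \<in> range \<kappa>" by (metis \<kappa>_1 rangeI)
  fix x assume "x \<in> range \<kappa>"
  then obtain a where a: "x = \<kappa> a" by blast
  show "- x \<in> range \<kappa>" "inverse x \<in> range \<kappa>" "d x \<in> range \<kappa>" unfolding a
    by (metis \<kappa>_minus \<kappa>_inverse d_\<kappa> \<kappa>_0 rangeI)+
  fix y assume "y \<in> range \<kappa>"
  then obtain b where b: "y = \<kappa> b" by blast
  show "x + y \<in> range \<kappa>" "x * y \<in> range \<kappa>" unfolding a b
    by (metis \<kappa>_add \<kappa>_mult rangeI)+
qed

lemma d_ev: "d (ev v p) = ev v (pderiv p) * d v"
  by (induction p) (auto simp: pderiv_pCons d_add d_mult ev_add algebra_simps)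

lemma poly_polys_range: "q \<in> polys (range \<kappa>) \<Longrightarrow> \<exists>p. poly q v = ev v p"
proof (induction q)
  case 0
  show ?case by (rule exI[of _ 0]) simp
next
  case (pCons a q)
  have c: "coeff (pCons a q) i \<in> range \<kappa>" for i using pCons.prems by (auto simp: polys_def)
  obtain z where z: "a = \<kappa> z" using c[of 0] by auto
  have "q \<in> polys (range \<kappa>)" using c[of "Suc i" for i] by (simp add: polys_def)
  then obtain p where "poly q v = ev v p" using pCons.IH by blast
  thus ?case by (intro exI[of _ "pCons z p"]) (simp add: z)
qed

text \<open>An element with \<open>d v \<noteq> 0\<close> is transcendental over the constants:
  differentiating a polynomial relation lowers its degree.\<close>

lemma ev_eq_0_iff:
  assumes "d v \<noteq> 0"
  shows "ev v p = 0 \<longleftrightarrow> p = 0"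
proof
  show "ev v p = 0 \<Longrightarrow> p = 0"
  proof (induction "degree p" arbitrary: p rule: less_induct)
    case less
    have "ev v (pderiv p) * d v = 0" using d_ev[of v p] less.prems by simp
    hence 0: "ev v (pderiv p) = 0" using assms by simp
    show ?case
    proof (cases "degree p = 0")
      case True
      then obtain c where "p = [:c:]" by (rule degree_eq_zeroE)
      thus ?thesis using less.prems by simp
    next
      case False
      hence "pderiv p = 0" using 0 by (intro less.hyps) (auto simp: degree_pderiv)
      thus ?thesis using False by (simp add: pderiv_eq_0_iff)
    qed
  qed
qed simp

lemma ev_in_adjoin: "ev v p \<in> adjoin (range \<kappa>) v"
  by (rule adjoinI[OF _ polys_1[OF is_subfield_range_\<kappa>], of "map_poly \<kappa> p"])
    (auto simp: ev_def polys_def coeff_map_poly)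

text \<open>Cancelling common roots of the coefficients makes the cofactor a polynomial.\<close>

lemma primitive_darboux_seq:
  assumes "t \<noteq> 0" "b N \<noteq> 0" "\<forall>j>N. b j = 0"
    and "\<And>j. t * (p * pderiv (b j) + of_nat (Suc j) * Q * b (Suc j) + of_nat j * R * b j
       + (case j of 0 \<Rightarrow> 0 | Suc i \<Rightarrow> (of_nat N - of_nat i) * b i)) = s * b j"
  shows "\<exists>G b. darboux_seq (\<lambda>q. p * pderiv q) Q R N G b \<and> (\<forall>z::complex. \<exists>j. poly (b j) z \<noteq> 0)"
  using assms
\<comment> \<open>Dividing all \<open>b j\<close> by \<open>v - z\<close> lowers the degree of
  \<open>b N\<close> by one but raises that of the denominator \<open>t\<close> by one; the weight 2
  makes the measure decrease.\<close>
proof (induction "degree t + 2 * degree (b N)" arbitrary: t s b rule: less_induct)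
  case less
  define X where "X b j = p * pderiv (b j) + of_nat (Suc j) * Q * b (Suc j) + of_nat j * R * b j
       + (case j of 0 \<Rightarrow> 0 | Suc i \<Rightarrow> (of_nat N - of_nat i) * b i)" for b j
  have eq: "t * X b j = s * b j" for j using less.prems(4) by (simp add: X_def)
  show ?case
  proof (cases "\<exists>z. \<forall>j. poly (b j) z = 0")
    case True
    then obtain z where z: "\<And>j. poly (b j) z = 0" by blast
    have "\<exists>c. b j = [:-z, 1:] * c" for j using z[of j] unfolding poly_eq_0_iff_dvd dvd_def by blast
    then obtain c where c: "\<And>j. b j = [:-z, 1:] * c j" by metis
    have c0: "c N \<noteq> 0" "\<forall>j>N. c j = 0"
      using less.prems(2,3) unfolding c mult_eq_0_iff by auto
    have deg: "degree (b N) = Suc (degree (c N))" using c0(1) unfolding c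
      by (subst degree_mult_eq) auto
    have XX: "X b j = p * c j + [:-z, 1:] * X c j" for j
      unfolding X_def c pderiv_mult
      by (cases j) (simp_all add: pderiv_pCons algebra_simps del: mult_pCons_left mult_pCons_right)
    have "t * [:-z, 1:] * X c j = (s * [:-z, 1:] - t * p) * c j" for j
      using eq[of j] unfolding XX c by (simp only: algebra_simps)
    moreover have "degree (t * [:-z, 1:]) = Suc (degree t)" using less.prems(1)
      by (subst degree_mult_eq) auto
    hence "degree (t * [:-z, 1:]) + 2 * degree (c N) < degree t + 2 * degree (b N)"
      using deg by simp
    moreover have "t * [:-z, 1:] \<noteq> 0" using less.prems(1) by (simp del: mult_pCons_right mult_pCons_left)
    ultimately show ?thesis
      using less.hyps[of "t * [:-z, 1:]" c "s * [:-z, 1:] - t * p"] c0 unfolding X_def by blast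
  next
    case False
    hence nz: "\<exists>j. poly (b j) z \<noteq> 0" for z by blast
    show ?thesis
    proof (cases "degree t = 0")
      case True
      then obtain k where k: "t = [:k:]" by (rule degree_eq_zeroE)
      have k0: "k \<noteq> 0" using k less.prems(1) by simp
      have "X b j = smult (inverse k) s * b j" for j
        using arg_cong[OF eq[of j], of "smult (inverse k)"] k0 by (simp add: k)
      hence "darboux_seq (\<lambda>q. p * pderiv q) Q R N (smult (inverse k) s) b"
        using less.prems(2,3) unfolding darboux_seq_def X_def by blast
      thus ?thesis using nz by blast
    next
      case False
      then obtain z where z: "poly t z = 0"
        using Fundamental_Theorem_Algebra.fundamental_theorem_of_algebra[of t] by (auto simp: constant_degree)
      \<comment> \<open>Where the \<open>b j\<close> have no common zero, a zero of \<open>t\<close>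
        is also one of \<open>s\<close>, and the factor cancels. In the end \<open>t\<close> is
        constant.\<close>
      obtain j where "poly (b j) z \<noteq> 0" using nz by blast
      hence "poly s z = 0" using arg_cong[OF eq[of j], of "\<lambda>q. poly q z"] z by simp
      then obtain s' t' where st: "s = [:-z, 1:] * s'" "t = [:-z, 1:] * t'"
        using z unfolding poly_eq_0_iff_dvd dvd_def by blast
      have t0: "t' \<noteq> 0" using less.prems(1) st by auto
      have "degree t = Suc (degree t')" unfolding st using t0 by (subst degree_mult_eq) auto
      moreover have "[:-z, 1:] * (t' * X b j) = [:-z, 1:] * (s' * b j)" for j
        using eq[of j] unfolding st by (simp only: mult.assoc)
      hence "t' * X b j = s' * b j" for j
        by (metis mult_left_cancel pCons_eq_0_iff zero_neq_one one_pCons)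
      ultimately show ?thesis using less.hyps[of t' b s'] less.prems t0 unfolding X_def by simp
    qed
  qed
qed

lemma has_darboux_poly:
  assumes dv: "d v = ev v p" "d v \<noteq> 0"
    and S: "has_darboux (adjoin (range \<kappa>) v) (ev v Q) (ev v R)"
  shows "\<exists>N\<ge>1. \<exists>G b. darboux_seq (\<lambda>q. p * pderiv q) Q R N G b \<and> (\<forall>z::complex. \<exists>j. poly (b j) z \<noteq> 0)"
proof -
  have L: "is_subfield (adjoin (range \<kappa>) v)"
    by (rule is_subfield_adjoin[OF is_subfield_range_\<kappa>]) (simp add: dv ev_in_adjoin)
  obtain N g b' s' t' where N: "N \<ge> 1" and b': "\<And>j. b' j \<in> polys (range \<kappa>)"
    and b'0: "\<And>j. j > N \<Longrightarrow> b' j = 0"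
    and seq: "darboux_seq d (ev v Q) (ev v R) N g (\<lambda>j. poly (b' j) v)"
    and st': "s' \<in> polys (range \<kappa>)" "t' \<in> polys (range \<kappa>)" "poly t' v \<noteq> 0" "g = poly s' v / poly t' v"
    by (rule clear_denominators[OF is_subfield_range_\<kappa> L S ev_in_adjoin]) (rule that)
  obtain s t where st: "poly s' v = ev v s" "poly t' v = ev v t"
    using poly_polys_range st'(1,2) by blast
  have "\<forall>j. \<exists>p. poly (b' j) v = ev v p" using poly_polys_range b' by blast
  then obtain b0 where b0: "\<And>j. poly (b' j) v = ev v (b0 j)" by metis
  define b where "b j = (if j \<le> N then b0 j else 0)" for j
  have b: "poly (b' j) v = ev v (b j)" for j using b0[of j] b'0[of j] by (auto simp: b_def)
  have inj: "x = y" if "ev v x = ev v y" for x y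
    using ev_eq_0_iff[OF dv(2), of "x - y"] that ev_add[of v x "- y"] by (simp add: ev_minus)
  have "t \<noteq> 0" using st st' by auto
  moreover have "b N \<noteq> 0" using seq b unfolding darboux_seq_def by auto
  moreover have "\<forall>j>N. b j = 0" by (simp add: b_def)
  moreover have "t * (p * pderiv (b j) + of_nat (Suc j) * Q * b (Suc j) + of_nat j * R * b j
       + (case j of 0 \<Rightarrow> 0 | Suc i \<Rightarrow> (of_nat N - of_nat i) * b i)) = s * b j" for j
  proof (rule inj)
    have neg: "ev v (x - y) = ev v x - ev v y" for x y using ev_add[of v x "- y"] by (simp add: ev_minus)
    have "d (ev v (b j)) + of_nat (Suc j) * ev v Q * ev v (b (Suc j)) + of_nat j * ev v R * ev v (b j)
          + (case j of 0 \<Rightarrow> 0 | Suc i \<Rightarrow> (of_nat N - of_nat i) * ev v (b i)) = g * ev v (b j)"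
      using seq unfolding darboux_seq_def b by blast
    hence "ev v (p * pderiv (b j) + of_nat (Suc j) * Q * b (Suc j) + of_nat j * R * b j
       + (case j of 0 \<Rightarrow> 0 | Suc i \<Rightarrow> (of_nat N - of_nat i) * b i)) = g * ev v (b j)"
      by (cases j) (simp_all add: ev_add ev_mult neg d_ev dv(1) mult.commute del: of_nat_Suc)
    thus "ev v (t * (p * pderiv (b j) + of_nat (Suc j) * Q * b (Suc j) + of_nat j * R * b j
       + (case j of 0 \<Rightarrow> 0 | Suc i \<Rightarrow> (of_nat N - of_nat i) * b i))) = ev v (s * b j)"
      using st st' by (simp add: ev_mult)
  qed
  ultimately show ?thesis using primitive_darboux_seq[of t b N p Q R s] N by blast
qed

end

section \<open>Local exponents of the cofactor\<close>

text \<open>At a zero of \<open>H\<close> other than \<open>\<rho>1\<close> and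
  \<open>\<rho>2\<close> the left side would vanish to lower order than the right side. So all zeros
  are \<open>\<rho>1\<close> or \<open>\<rho>2\<close>, and removing one of them reduces \<gamma> by
  the other exponent.\<close>

lemma constant_darboux_poly:
  fixes H :: "complex poly"
  assumes "H \<noteq> 0" "degree H = N"
    "[:- \<rho>1, 1:] * [:- \<rho>2, 1:] * pderiv H = H * [:- \<gamma>, of_nat N:]"
  shows "\<exists>i\<le>N. \<gamma> = of_nat i * \<rho>1 + of_nat (N - i) * \<rho>2"
  using assms
proof (induction N arbitrary: H \<gamma>)
  case 0
  then obtain c where c: "H = [:c:]" by (auto elim: degree_eq_zeroE)
  thus ?case using 0 by simp
next
  case (Suc N)
  have dH: "pderiv H \<noteq> 0" using Suc.prems by (simp add: pderiv_eq_0_iff)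
  obtain y where y: "poly H y = 0"
    using Fundamental_Theorem_Algebra.fundamental_theorem_of_algebra[of H] Suc.prems
    by (auto simp: constant_degree)
  have step: ?case
    if \<rho>: "\<rho> = \<rho>1 \<and> \<rho>' = \<rho>2 \<or> \<rho> = \<rho>2 \<and> \<rho>' = \<rho>1" and z: "poly H \<rho> = 0" for \<rho> \<rho>'
  proof -
    obtain K where K: "H = [:- \<rho>, 1:] * K" using z unfolding poly_eq_0_iff_dvd dvd_def by blast
    have K0: "K \<noteq> 0" using Suc.prems K by auto
    have "degree H = Suc (degree K)" unfolding K using K0 by (subst degree_mult_eq) auto
    hence dK: "degree K = N" using Suc.prems by simp
    have quad: "[:- \<rho>1, 1:] * [:- \<rho>2, 1:] = [:- \<rho>, 1:] * [:- \<rho>', 1:]"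
      using \<rho> by (metis mult.commute)
    have pd: "pderiv [:- \<rho>, 1:] = 1" by (simp add: pderiv_pCons one_pCons)
    have "[:- \<rho>, 1:] * ([:- \<rho>', 1:] * (K + [:- \<rho>, 1:] * pderiv K)) = [:- \<rho>, 1:] * (K * [:- \<gamma>, of_nat (Suc N):])"
      using Suc.prems(3) unfolding quad K pderiv_mult pd
      by (simp add: algebra_simps del: mult_pCons_left mult_pCons_right of_nat_Suc)
    hence "[:- \<rho>', 1:] * (K + [:- \<rho>, 1:] * pderiv K) = K * [:- \<gamma>, of_nat (Suc N):]"
      by (metis mult_left_cancel pCons_eq_0_iff zero_neq_one one_pCons)
    hence "[:- \<rho>, 1:] * [:- \<rho>', 1:] * pderiv K = K * [:- \<gamma>, of_nat (Suc N):] - K * [:- \<rho>', 1:]"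
      by (simp add: algebra_simps del: mult_pCons_left mult_pCons_right of_nat_Suc)
    also have "\<dots> = K * [:- (\<gamma> - \<rho>'), of_nat N:]"
      unfolding right_diff_distrib[symmetric] by simp
    finally obtain i where i: "i \<le> N" "\<gamma> - \<rho>' = of_nat i * \<rho>1 + of_nat (N - i) * \<rho>2"
      using Suc.IH[OF K0 dK, of "\<gamma> - \<rho>'"] quad by auto
    show ?case
    proof (cases "\<rho>' = \<rho>1")
      case True
      thus ?thesis using i by (intro exI[of _ "Suc i"]) (auto simp: algebra_simps)
    next
      case False
      hence "\<rho>' = \<rho>2" using \<rho> by auto
      thus ?thesis using i by (intro exI[of _ i]) (auto simp: algebra_simps Suc_diff_le)
    qed
  qed
  have "y = \<rho>1 \<or> y = \<rho>2"
  proof (rule ccontr)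
    assume n: "\<not> ?thesis"
    define q where "q = [:- \<rho>1, 1:] * [:- \<rho>2, 1:]"
    have q0: "q \<noteq> 0" unfolding q_def by (metis mult_eq_0_iff pCons_eq_0_iff zero_neq_one)
    have "poly q y \<noteq> 0" using n by (simp add: q_def del: mult_pCons_left mult_pCons_right)
    hence oq: "order y q = 0" by (simp add: order_0I)
    have o: "order y H = Suc (order y (pderiv H))" using order_pderiv[OF Suc.prems(1) y] .
    have r0: "H * [:- \<gamma>, of_nat (Suc N):] \<noteq> 0" using Suc.prems(1) by (metis mult_eq_0_iff of_nat_eq_0_iff pCons_eq_0_iff nat.distinct(1))
    have "order y (q * pderiv H) = order y (pderiv H)" using order_mult[of q "pderiv H" y] q0 dH oq by auto
    moreover have "order y (H * [:- \<gamma>, of_nat (Suc N):]) \<ge> order y H" using order_mult[OF r0] by simp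
    ultimately show False using Suc.prems(3) o unfolding q_def by simp
  qed
  thus ?case using step[of \<rho>1 \<rho>2] step[of \<rho>2 \<rho>1] y by auto
qed

text \<open>The exponents are the roots of \<open>X^2 - R X - Q\<close>; over the constants a
  Darboux polynomial is a constant times a product of the two linear factors.\<close>

lemma constant_darboux_seq:
  fixes h :: "nat \<Rightarrow> complex"
  assumes "darboux_seq (\<lambda>_. 0) Q R N \<gamma> h" and \<rho>: "\<rho>1 + \<rho>2 = R" "\<rho>1 * \<rho>2 = - Q"
  shows "\<exists>i\<le>N. \<gamma> = of_nat i * \<rho>1 + of_nat (N - i) * \<rho>2"
proof -
  have Z: "derivation (\<lambda>_::complex. 0)" by unfold_locales auto
  obtain H where H: "coeff H = h" "degree H = N"
    "derivation.darboux_op (\<lambda>_. 0) Q R H = H * [:\<gamma>, - of_nat N:]"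
    using derivation.darboux_seq_imp_poly[OF Z assms(1)] .
  have "h N \<noteq> 0" using assms(1) unfolding darboux_seq_def by blast
  hence "H \<noteq> 0" using H(1) by auto
  have "derivation.dp (\<lambda>_. 0) H = 0" by (rule poly_eqI) (simp add: derivation.coeff_dp[OF Z])
  hence eq: "[:Q, R, -1:] * pderiv H = H * [:\<gamma>, - of_nat N:]"
    using H(3) by (simp add: derivation.darboux_op_def[OF Z])
  have "Q = - (\<rho>1 * \<rho>2)" "R = \<rho>1 + \<rho>2" using \<rho> by simp_all
  hence 1: "[:Q, R, -1:] = - ([:- \<rho>1, 1:] * [:- \<rho>2, 1:])" by (simp add: algebra_simps)
  have 2: "[:\<gamma>, - of_nat N:] = - [:- \<gamma>, of_nat N:]" by simp
  have "[:- \<rho>1, 1:] * [:- \<rho>2, 1:] * pderiv H = H * [:- \<gamma>, of_nat N:]"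
    using eq unfolding 1 2 by (simp only: minus_mult_left[symmetric] minus_mult_right[symmetric] neg_equal_iff_equal)
  from constant_darboux_poly[OF \<open>H \<noteq> 0\<close> H(2) this] show ?thesis .
qed

section \<open>Values of the cofactor at finite points and at infinity\<close>

locale poly_darboux =
  fixes p Q R :: "complex poly" and N :: nat and G :: "complex poly" and b :: "nat \<Rightarrow> complex poly"
  assumes seq: "darboux_seq (\<lambda>q. p * pderiv q) Q R N G b"
    and primitive: "\<And>z. \<exists>j. poly (b j) z \<noteq> 0"
begin

lemma b_eq: "p * pderiv (b j) + of_nat (Suc j) * Q * b (Suc j) + of_nat j * R * b j
          + (case j of 0 \<Rightarrow> 0 | Suc i \<Rightarrow> (of_nat N - of_nat i) * b i) = G * b j"
  using seq unfolding darboux_seq_def by blast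

lemma b_eq': "p * pderiv (b j) + smult (of_nat (Suc j)) (Q * b (Suc j)) + smult (of_nat j) (R * b j)
          + (case j of 0 \<Rightarrow> 0 | Suc i \<Rightarrow> smult (of_nat N - of_nat i) (b i)) = G * b j"
  using b_eq[of j] by (cases j) (simp_all add: of_nat_poly smult_diff_left del: of_nat_Suc)

lemma b_N: "b N \<noteq> 0" and b_gt: "j > N \<Longrightarrow> b j = 0"
  using seq unfolding darboux_seq_def by auto

text \<open>Where \<open>p\<close> vanishes the derivative drops out, and evaluation at
  \<open>z\<close> leaves a Darboux polynomial over the constants. It is nonzero because the
  \<open>b j\<close> have no common zero.\<close>

lemma finite_point:
  assumes "poly p z = 0" and "\<rho>1 + \<rho>2 = poly R z" "\<rho>1 * \<rho>2 = - poly Q z"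
  shows "\<exists>i\<le>N. poly G z = of_nat i * \<rho>1 + of_nat (N - i) * \<rho>2"
proof -
  obtain j0 where j0: "poly (b j0) z \<noteq> 0" using primitive by blast
  have "darboux_seq (\<lambda>_. 0) (poly Q z) (poly R z) N (poly G z) (\<lambda>j. poly (b j) z)"
  proof (rule darboux_seq_top)
    fix j
    show "0 + of_nat (Suc j) * poly Q z * poly (b (Suc j)) z + of_nat j * poly R z * poly (b j) z
          + (case j of 0 \<Rightarrow> 0 | Suc i \<Rightarrow> (of_nat N - of_nat i) * poly (b i) z) = poly G z * poly (b j) z"
      using arg_cong[OF b_eq[of j], of "\<lambda>q. poly q z"] assms(1)
      by (cases j) (simp_all add: poly_of_nat)
  qed (use j0 b_gt in auto)
  from constant_darboux_seq[OF this assms(2,3)] show ?thesis .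
qed

text \<open>
  At infinity the variable \<open>X\<close> has weight \<open>w\<close>: \<open>X = v^w Z\<close> turns the leading coefficients of the
  equation into constants.
\<close>

lemma infinite_point:
  fixes w :: nat
  defines "B \<equiv> \<lambda>j. monom 1 (w * j) * b j"
  assumes deg: "degree p \<le> Suc w" "degree Q \<le> 2 * w" "degree R \<le> w"
  shows "\<exists>M. w * N \<le> M \<and> degree G \<le> w \<and> (\<forall>j. degree (B j) \<le> M) \<and>
    darboux_seq (\<lambda>_. 0) (coeff Q (2 * w)) (coeff R w - of_nat w * coeff p (Suc w)) N
      (coeff G w - of_nat M * coeff p (Suc w)) (\<lambda>j. coeff (B j) M)"
proof -
  define M where "M = Max ((degree \<circ> B) ` {..N})"
  have M: "degree (B j) \<le> M" for j
  proof (cases "j \<le> N")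
    case True
    thus ?thesis unfolding M_def by (intro Max_ge) auto
  qed (use b_gt in \<open>auto simp: B_def\<close>)
  have degB: "degree (B j) = w * j + degree (b j)" if "b j \<noteq> 0" for j
    unfolding B_def using that by (subst degree_mult_eq) (auto simp: degree_monom_eq monom_eq_0_iff)
  have wN: "w * N \<le> M" using M[of N] degB[OF b_N] by simp
  have BN: "B N \<noteq> 0" unfolding B_def using b_N by (auto simp: monom_eq_0_iff)
  have "M \<in> (degree \<circ> B) ` {..N}" unfolding M_def by (intro Max_in) auto
  then obtain j1 where j1: "degree (B j1) = M" by auto
  have "\<exists>j. coeff (B j) M \<noteq> 0"
  proof (cases "B j1 = 0")
    case True
    hence "degree (B N) = M" using j1 M[of N] by simp
    thus ?thesis using BN by (metis leading_coeff_neq_0)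
  qed (use j1 in \<open>metis leading_coeff_neq_0\<close>)
  then obtain j0 where j0: "coeff (B j0) M \<noteq> 0" by blast
  \<comment> \<open>This is \<open>v^(w j + 1)\<close> times the derivative of \<open>b j\<close>,
    expressed through \<open>B j\<close>. At degree \<open>M\<close> it multiplies the coefficient
    by \<open>M - w j\<close>: the part \<open>- w j\<close> becomes the correction of
    \<open>R\<close>, the part \<open>M\<close> that of the cofactor.\<close>
  define Y where "Y j = monom 1 1 * pderiv (B j) - smult (of_nat (w * j)) (B j)" for j
  have Yb: "Y j = monom 1 (Suc (w * j)) * pderiv (b j)" for j
  proof -
    have "monom 1 1 * pderiv (monom 1 (w * j)) = smult (of_nat (w * j)) (monom (1 :: complex) (w * j))"
      by (cases "w * j") (auto simp: pderiv_monom mult_monom smult_monom)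
    thus ?thesis unfolding Y_def B_def pderiv_mult
      by (simp add: algebra_simps mult_monom)
  qed
  have degY: "degree (Y j) \<le> M" and coeffY: "coeff (Y j) M = (of_nat M - of_nat (w * j)) * coeff (B j) M" for j
  proof -
    have z: "coeff (B j) k = 0" if "k > M" for k using M[of j] that by (simp add: coeff_eq_0)
    have X1: "coeff (monom 1 (Suc 0) * q) n = (if n = 0 then 0 else coeff q (n - 1))" for n and q :: "complex poly"
      by (simp add: coeff_monom_mult)
    show "degree (Y j) \<le> M"
      by (rule degree_le) (auto simp: Y_def z coeff_pderiv X1)
    show "coeff (Y j) M = (of_nat M - of_nat (w * j)) * coeff (B j) M"
      by (cases M) (simp_all add: Y_def z coeff_pderiv X1 left_diff_distrib)
  qed
  define P1 where "P1 j = p * (monom 1 w * Y j)" for j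
  define P2 where "P2 j = Q * (monom 1 1 * B (Suc j))" for j
  define P3 where "P3 j = R * (monom 1 (Suc w) * B j)" for j
  define P4 where "P4 j = monom 1 (2 * w + 1) * B j" for j
  define P5 where "P5 j = G * (monom 1 (Suc w) * B j)" for j
  have main: "P1 j + smult (of_nat (Suc j)) (P2 j) + smult (of_nat j) (P3 j)
     + (case j of 0 \<Rightarrow> 0 | Suc i \<Rightarrow> smult (of_nat N - of_nat i) (P4 i)) = P5 j" for j
  proof -
    define m where "m = (monom 1 (w * j + w + 1) :: complex poly)"
    have m: "m = monom 1 w * monom 1 (Suc (w * j))" "m = monom 1 1 * monom 1 (w * Suc j)"
      "m = monom 1 (Suc w) * monom 1 (w * j)"
      by (simp_all add: m_def mult_monom add_ac)
    have 1: "P1 j = m * (p * pderiv (b j))"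
      unfolding P1_def Yb m(1) by (simp only: mult_ac)
    have 2: "P2 j = m * (Q * b (Suc j))"
      unfolding P2_def B_def m(2) by (simp only: mult_ac)
    have 3: "P3 j = m * (R * b j)"
      unfolding P3_def B_def m(3) by (simp only: mult_ac)
    have 4: "P4 i = m * b i" if "j = Suc i" for i
    proof -
      have "m = monom 1 (2 * w + 1) * monom 1 (w * i)" by (simp add: m_def mult_monom that mult_2 add_ac)
      thus ?thesis unfolding P4_def B_def by (simp only: mult_ac)
    qed
    have 5: "P5 j = m * (G * b j)"
      unfolding P5_def B_def m(3) by (simp only: mult_ac)
    show ?thesis
    proof (cases j)
      case 0
      show ?thesis using arg_cong[OF b_eq'[of j], of "\<lambda>q. m * q"] unfolding 1 2 3 5
        by (simp add: 0 distrib_left del: of_nat_Suc)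
    next
      case (Suc i)
      show ?thesis using arg_cong[OF b_eq'[of j], of "\<lambda>q. m * q"] unfolding 1 2 3 5
        by (simp add: Suc 4[OF Suc] distrib_left del: of_nat_Suc)
    qed
  qed
  have dm: "degree (monom 1 k * q) \<le> k + n" if "degree q \<le> n" for k n and q :: "complex poly"
    by (intro order.trans[OF degree_mult_le] add_mono degree_monom_le that)
  have cm: "coeff (monom 1 k * q) (k + n) = coeff q n" for k n and q :: "complex poly"
    by (simp add: coeff_monom_mult)
  \<comment> \<open>After multiplication by \<open>v^(w j + w + 1)\<close> every term of the
    equation has degree at most \<open>T\<close>; the coefficients at \<open>T\<close> form the
    constant equation.\<close>
  define T where "T = 2 * w + 1 + M"
  have T: "T = Suc w + (w + M)" "T = 2 * w + (1 + M)" "T = w + (Suc w + M)"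
    by (simp_all add: T_def)
  have d1: "degree (P1 j) \<le> T" for j
    unfolding P1_def using degree_mult_le[of p "monom 1 w * Y j"] deg(1) dm[OF degY, of w j] by (simp add: T_def)
  have d2: "degree (P2 j) \<le> T" for j
    unfolding P2_def using degree_mult_le[of Q "monom 1 1 * B (Suc j)"] deg(2) dm[OF M, of 1 "Suc j"] by (simp add: T_def)
  have d3: "degree (P3 j) \<le> T" for j
    unfolding P3_def using degree_mult_le[of R "monom 1 (Suc w) * B j"] deg(3) dm[OF M, of "Suc w" j] by (simp add: T_def)
  have d4: "degree (P4 j) \<le> T" for j
    unfolding P4_def using dm[OF M, of "2 * w + 1" j] by (simp add: T_def)
  have d5: "degree (P5 j) \<le> T" for j
    unfolding main[symmetric] using d1 d2 d3 d4
    by (cases j) (auto intro!: degree_add_le intro: order.trans[OF degree_smult_le] simp del: of_nat_Suc)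
  \<comment> \<open>Where \<open>B j0\<close> attains the degree \<open>M\<close>, the degree bound
    on the left side of the equation limits \<open>G\<close>.\<close>
  have "degree G + (Suc w + M) \<le> T" if "G \<noteq> 0"
  proof -
    have "coeff (P5 j0) (degree G + (Suc w + M)) = coeff G (degree G) * coeff (B j0) M"
      unfolding P5_def by (subst coeff_mult_bounded) (use dm[OF M, of "Suc w" j0] cm[of "Suc w" "B j0" M] in auto)
    hence "coeff (P5 j0) (degree G + (Suc w + M)) \<noteq> 0" using that j0 by simp
    thus ?thesis using d5[of j0] le_degree order.trans by blast
  qed
  hence dG: "degree G \<le> w" by (cases "G = 0") (auto simp: T_def)
  have c1: "coeff (P1 j) T = coeff p (Suc w) * (of_nat M - of_nat (w * j)) * coeff (B j) M" for j
    unfolding P1_def T(1) coeff_mult_bounded[OF deg(1) dm[OF degY]] cm coeffY by (simp only: mult.assoc)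
  have c2: "coeff (P2 j) T = coeff Q (2 * w) * coeff (B (Suc j)) M" for j
    unfolding P2_def T(2) coeff_mult_bounded[OF deg(2) dm[OF M]] cm ..
  have c3: "coeff (P3 j) T = coeff R w * coeff (B j) M" for j
    unfolding P3_def T(3) coeff_mult_bounded[OF deg(3) dm[OF M]] cm ..
  have c4: "coeff (P4 j) T = coeff (B j) M" for j
    unfolding P4_def T_def by (rule cm)
  have c5: "coeff (P5 j) T = coeff G w * coeff (B j) M" for j
    unfolding P5_def T(3) coeff_mult_bounded[OF dG dm[OF M]] cm ..
  have "darboux_seq (\<lambda>_. 0) (coeff Q (2 * w)) (coeff R w - of_nat w * coeff p (Suc w)) N
      (coeff G w - of_nat M * coeff p (Suc w)) (\<lambda>j. coeff (B j) M)"
  proof (rule darboux_seq_top)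
    fix j
    show "0 + of_nat (Suc j) * coeff Q (2 * w) * coeff (B (Suc j)) M
          + of_nat j * (coeff R w - of_nat w * coeff p (Suc w)) * coeff (B j) M
          + (case j of 0 \<Rightarrow> 0 | Suc i \<Rightarrow> (of_nat N - of_nat i) * coeff (B i) M)
         = (coeff G w - of_nat M * coeff p (Suc w)) * coeff (B j) M"
      using arg_cong[OF main[of j], of "\<lambda>q. coeff q T"]
      by (cases j) (simp_all add: c1 c2 c3 c4 c5 algebra_simps)
  qed (use j0 b_gt in \<open>auto simp: B_def\<close>)
  thus ?thesis using wN dG M by blast
qed

end

section \<open>Integer relations between the exponents of the model equations\<close>

lemma degree_le_1_cases:
  assumes "degree p \<le> 1" obtains a b where "p = [:a, b:]"
proof
  show "p = [:coeff p 0, coeff p 1:]"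
  proof (rule poly_eqI)
    fix n show "coeff p n = coeff [:coeff p 0, coeff p 1:] n"
      using assms by (auto simp: coeff_pCons coeff_eq_0 split: nat.splits)
  qed
qed

text \<open>\<open>B\<close> and \<kappa> will be \<open>b e\<close> and \<open>a e\<close>. The
  exponents are \<mu> and -\<mu> at \<open>v = 1\<close> and \<open>v = -1\<close>, and
  \<open>(1 + \<eta>) / 2\<close>, \<open>(1 - \<eta>) / 2\<close> at infinity. The cofactor is
  linear, so its two finite values determine the slope \<open>g1\<close>, which the point at
  infinity determines as well. The integer \<open>2 M - N\<close> is positive because
  \<open>M \<ge> N \<ge> 1\<close>.\<close>

lemma legendre_darboux:
  assumes "poly_darboux [:1, 0, -1:] [:B - \<kappa>, 0, \<kappa>:] 0 N G b" and N: "N \<ge> 1"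
    and \<mu>: "\<mu>\<^sup>2 = B" and \<eta>: "\<eta>\<^sup>2 = 1 + 4 * \<kappa>"
  shows "\<exists>n>0. \<exists>z z' :: int. of_nat n + of_int z * \<mu> = of_int z' * \<eta>"
proof -
  interpret poly_darboux "[:1, 0, -1:]" "[:B - \<kappa>, 0, \<kappa>:]" 0 N G b by fact
  define h where "h = (\<lambda>M j. coeff (monom 1 (1 * j) * b j) M)"
  have "\<exists>M. 1 * N \<le> M \<and> degree G \<le> 1 \<and>
    darboux_seq (\<lambda>_. 0) \<kappa> 1 N (coeff G 1 + of_nat M) (h M)"
  proof -
    have "degree [:1, 0, -1 :: complex:] \<le> Suc 1" "degree [:B - \<kappa>, 0, \<kappa>:] \<le> 2 * 1" "degree (0 :: complex poly) \<le> 1"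
      by auto
    from infinite_point[OF this] show ?thesis unfolding h_def by (auto simp: numeral_2_eq_2)
  qed
  then obtain M where M: "N \<le> M" "degree G \<le> 1"
    and inf: "darboux_seq (\<lambda>_. 0) \<kappa> 1 N (coeff G 1 + of_nat M) (h M)" by auto
  obtain g0 g1 where G: "G = [:g0, g1:]" using degree_le_1_cases[OF M(2)] .
  have s1: "(1 + \<eta>) / 2 + (1 - \<eta>) / 2 = 1" by (simp add: field_simps)
  have s2: "(1 + \<eta>) / 2 * ((1 - \<eta>) / 2) = - \<kappa>"
    using \<eta> by (simp add: field_simps power2_eq_square)
  have "coeff G 1 = g1" by (simp add: G)
  then obtain i where i: "i \<le> N"
    "g1 + of_nat M = of_nat i * ((1 + \<eta>) / 2) + of_nat (N - i) * ((1 - \<eta>) / 2)"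
    using constant_darboux_seq[OF inf s1 s2] by auto
  have "\<mu> * (- \<mu>) = - B" using \<mu> by (simp add: power2_eq_square)
  then obtain i1 i2 where
    1: "i1 \<le> N" "g0 + g1 = of_nat i1 * \<mu> + of_nat (N - i1) * (- \<mu>)" and
    2: "i2 \<le> N" "g0 - g1 = of_nat i2 * \<mu> + of_nat (N - i2) * (- \<mu>)"
    using finite_point[of 1 \<mu> "- \<mu>"] finite_point[of "-1" \<mu> "- \<mu>"] by (auto simp: G)
  define n where "n = 2 * M - N"
  have n: "n > 0" "of_nat n = 2 * of_nat M - (of_nat N :: complex)"
    using M(1) N by (auto simp: n_def of_nat_diff)
  have e1: "2 * g1 = 2 * (of_nat i1 - of_nat i2) * \<mu>"
  proof -
    have "2 * g1 = (g0 + g1) - (g0 - g1)" by simp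
    also have "\<dots> = 2 * (of_nat i1 - of_nat i2) * \<mu>"
      unfolding 1 2 using 1(1) 2(1) by (simp add: of_nat_diff algebra_simps)
    finally show ?thesis .
  qed
  have e2: "2 * (g1 + of_nat M) = of_nat N + (2 * of_nat i - of_nat N) * \<eta>"
    unfolding i(2) using i(1) by (simp add: of_nat_diff field_simps)
  have "of_nat n + of_int (2 * (int i1 - int i2)) * \<mu> = (2 * of_nat M - of_nat N) + 2 * g1"
    unfolding e1 n(2) by simp
  also have "\<dots> = 2 * (g1 + of_nat M) - of_nat N" by simp
  also have "\<dots> = of_int (2 * int i - int N) * \<eta>" unfolding e2 by simp
  finally have "of_nat n + of_int (2 * (int i1 - int i2)) * \<mu> = of_int (2 * int i - int N) * \<eta>" .
  thus ?thesis using n(1) by blast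
qed

text \<open>\<open>B\<close> and \<kappa> will be \<open>b e\<close> and \<open>a e\<close>. At each
  root of the cubic \<open>Q\<close> vanishes, so one exponent is \<open>0\<close> and the other
  half the derivative of the cubic. At infinity the weight is 2 and the exponents are
  \<open>-1 + \<eta>\<close> and \<open>-1 - \<eta>\<close>. The cofactor is at most quadratic,
  hence determined by its values at the three distinct roots.\<close>

lemma lame_darboux:
  defines "p \<equiv> (\<lambda>e1 e2 e3 :: complex. smult 4 ([:-e1, 1:] * [:-e2, 1:] * [:-e3, 1:]))"
  assumes "poly_darboux (p e1 e2 e3) (p e1 e2 e3 * [:B, \<kappa>:]) (smult (1/2) (pderiv (p e1 e2 e3))) N G b"
    and N: "N \<ge> 1" and dist: "e1 \<noteq> e2" "e1 \<noteq> e3" "e2 \<noteq> e3" and \<eta>: "\<eta>\<^sup>2 = 1 + 4 * \<kappa>"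
  shows "\<exists>n>0. \<exists>z :: int. of_nat n = of_int z * \<eta>"
proof -
  define P where "P = p e1 e2 e3"
  interpret poly_darboux P "P * [:B, \<kappa>:]" "smult (1/2) (pderiv P)" N G b
    using assms(2) by (simp add: P_def)
  have P: "P = [:- 4 * e1 * e2 * e3, 4 * (e1 * e2 + e1 * e3 + e2 * e3), - 4 * (e1 + e2 + e3), 4:]"
    by (simp add: P_def p_def algebra_simps)
  define h where "h = (\<lambda>M j. coeff (monom 1 (2 * j) * b j) M)"
  have pd: "pderiv P = [:4 * (e1 * e2 + e1 * e3 + e2 * e3), - 8 * (e1 + e2 + e3), 12:]"
    by (simp add: P pderiv_pCons algebra_simps)
  have dP: "degree P \<le> Suc 2" "degree (smult (1/2) (pderiv P)) \<le> 2" by (simp_all add: P pderiv_pCons)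
  have dQ: "degree (P * [:B, \<kappa>:]) \<le> 2 * 2"
    by (rule order.trans[OF degree_mult_le]) (simp add: P)
  have cQ: "coeff (P * [:B, \<kappa>:]) (2 * 2) = 4 * \<kappa>"
    by (simp add: P coeff_pCons eval_nat_numeral)
  have cR: "coeff (smult (1/2) (pderiv P)) 2 = 6" "coeff P (Suc 2) = 4"
    by (simp add: pd numeral_2_eq_2) (simp add: P numeral_2_eq_2)
  obtain M where M: "2 * N \<le> M" "degree G \<le> 2"
    and inf: "darboux_seq (\<lambda>_. 0) (4 * \<kappa>) (6 - of_nat 2 * 4) N (coeff G 2 - of_nat M * 4) (h M)"
    using infinite_point[of 2] dP dQ unfolding cQ cR h_def by blast
  have "(- 1 + \<eta>) + (- 1 - \<eta>) = 6 - of_nat 2 * 4" by simp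
  moreover have "(- 1 + \<eta>) * (- 1 - \<eta>) = - (4 * \<kappa>)"
    using \<eta> by (simp add: algebra_simps power2_eq_square)
  ultimately obtain i where i: "i \<le> N"
    "coeff G 2 - of_nat M * 4 = of_nat i * (- 1 + \<eta>) + of_nat (N - i) * (- 1 - \<eta>)"
    using constant_darboux_seq[OF inf] by blast
  have fin: "\<exists>i\<le>N. poly G e = of_nat i * (poly (pderiv P) e / 2)" if "poly P e = 0" for e
    using finite_point[OF that, of "poly (pderiv P) e / 2" 0] that by auto
  have root: "poly P e1 = 0" "poly P e2 = 0" "poly P e3 = 0"
    by (simp_all add: P_def p_def del: mult_pCons_left mult_pCons_right)
  obtain n1 n2 n3 where n1: "n1 \<le> N" "poly G e1 = of_nat n1 * (poly (pderiv P) e1 / 2)"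
    and n2: "n2 \<le> N" "poly G e2 = of_nat n2 * (poly (pderiv P) e2 / 2)"
    and n3: "n3 \<le> N" "poly G e3 = of_nat n3 * (poly (pderiv P) e3 / 2)"
    using fin[OF root(1)] fin[OF root(2)] fin[OF root(3)] by blast
  \<comment> \<open>Lagrange interpolation of \<open>G\<close>: half of \<open>pderiv P\<close> at
    \<open>e1\<close> is \<open>2 (e1 - e2) (e1 - e3)\<close>, and likewise at \<open>e2\<close> and
    \<open>e3\<close>.\<close>
  define L where "L = smult (2 * of_nat n1) ([:-e2, 1:] * [:-e3, 1:])
    + smult (2 * of_nat n2) ([:-e1, 1:] * [:-e3, 1:]) + smult (2 * of_nat n3) ([:-e1, 1:] * [:-e2, 1:])"
  have pd': "poly (pderiv P) x = 4 * ((x - e2) * (x - e3) + (x - e1) * (x - e3) + (x - e1) * (x - e2))" for x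
    by (simp add: pd algebra_simps)
  have "poly (G - L) e1 = 0" "poly (G - L) e2 = 0" "poly (G - L) e3 = 0"
    unfolding poly_diff n1 n2 n3 pd'
    by (simp_all add: L_def mult_ac del: mult_pCons_left mult_pCons_right)
  moreover have "degree (G - L) < 3"
  proof -
    have "degree L \<le> 2" unfolding L_def
      by (intro degree_add_le order.trans[OF degree_smult_le] order.trans[OF degree_mult_le]) auto
    hence "degree (G - L) \<le> 2" using M(2) by (intro degree_diff_le)
    thus ?thesis by simp
  qed
  ultimately have "G = L"
  proof -
    assume r: "poly (G - L) e1 = 0" "poly (G - L) e2 = 0" "poly (G - L) e3 = 0" and d: "degree (G - L) < 3"
    show ?thesis
    proof (rule ccontr)
      assume "G \<noteq> L"
      hence nz: "G - L \<noteq> 0" by simp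
      have "{e1, e2, e3} \<subseteq> {x. poly (G - L) x = 0}" using r by auto
      hence "card {e1, e2, e3} \<le> card {x. poly (G - L) x = 0}"
        using poly_roots_finite[OF nz] by (intro card_mono)
      also have "\<dots> \<le> degree (G - L)" by (rule card_poly_roots_bound[OF nz])
      finally show False using d dist by simp
    qed
  qed
  hence "coeff G 2 = 2 * (of_nat n1 + of_nat n2 + of_nat n3)"
    by (simp add: L_def numeral_2_eq_2 algebra_simps)
  \<comment> \<open>Positive because weight 2 gives \<open>M \<ge> 2 N\<close>, while
    \<open>N + 2 (n1 + n2 + n3) \<le> 7 N\<close>.\<close>
  define n where "n = 4 * M - N - 2 * (n1 + n2 + n3)"
  have "n1 + n2 + n3 \<le> 3 * N" using n1(1) n2(1) n3(1) by simp
  hence le: "N + 2 * (n1 + n2 + n3) < 4 * M" using M(1) N by simp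
  have n: "n > 0" using le by (simp add: n_def)
  have "of_nat n = 4 * of_nat M - of_nat N - 2 * (of_nat n1 + of_nat n2 + (of_nat n3 :: complex))"
  proof -
    have "n + N + 2 * (n1 + n2 + n3) = 4 * M" using le by (simp add: n_def)
    hence "of_nat n + of_nat N + 2 * (of_nat n1 + of_nat n2 + of_nat n3) = (4 * of_nat M :: complex)"
      by (metis of_nat_add of_nat_mult of_nat_numeral)
    thus ?thesis by (simp add: algebra_simps)
  qed
  also have "\<dots> = - (coeff G 2 - of_nat M * 4) - of_nat N" using \<open>coeff G 2 = _\<close> by simp
  also have "\<dots> = of_int (int N - 2 * int i) * \<eta>"
    unfolding i(2) using i(1) by (simp add: of_nat_diff algebra_simps)
  finally show ?thesis using n by blast
qed

text \<open>The top order at infinity, with exponents \<open>- 2 \<alpha>\<close> and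
  \<open>0\<close>, determines only the slope \<open>g1\<close>. The constant term
  \<open>g0\<close>, which is the value of the cofactor at the singular point \<open>0\<close>,
  appears in the next order. So both the coefficients \<open>h\<close> at degree \<open>M\<close>
  and \<open>k\<close> at degree \<open>M - 1\<close> enter, and the equation of index
  \<open>i\<close> is the one from which \<open>k i\<close> drops out.\<close>

lemma confluent_darboux:
  assumes "poly_darboux [:0, 1:] [:\<kappa>, \<beta>:] [:c, - 2 * \<alpha>:] N G b" and N: "N \<ge> 1"
    and \<alpha>: "\<alpha> \<noteq> 0" and \<rho>: "\<rho>1 + \<rho>2 = c" "\<rho>1 * \<rho>2 = - \<kappa>"
  shows "\<exists>M\<ge>N. \<exists>i\<le>N. \<exists>j\<le>N. of_nat j * \<rho>1 + of_nat (N - j) * \<rho>2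
    = of_nat M + (c - 1) * of_nat i + \<beta> / (2 * \<alpha>) * (of_nat N - 2 * of_nat i)"
proof -
  interpret poly_darboux "[:0, 1:]" "[:\<kappa>, \<beta>:]" "[:c, - 2 * \<alpha>:]" N G b by fact
  define B where "B = (\<lambda>j. monom 1 (1 * j) * b j)"
  have "\<exists>M. 1 * N \<le> M \<and> degree G \<le> 1 \<and> (\<forall>j. degree (B j) \<le> M) \<and>
    darboux_seq (\<lambda>_. 0) 0 (- 2 * \<alpha>) N (coeff G 1) (\<lambda>j. coeff (B j) M)"
    using infinite_point[of 1] unfolding B_def by (simp add: numeral_2_eq_2)
  then obtain M where M: "N \<le> M" "degree G \<le> 1" "\<And>j. degree (B j) \<le> M"
    and inf: "darboux_seq (\<lambda>_. 0) 0 (- 2 * \<alpha>) N (coeff G 1) (\<lambda>j. coeff (B j) M)" by auto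
  obtain g0 g1 where G: "G = [:g0, g1:]" using degree_le_1_cases[OF M(2)] .
  obtain j where j: "j \<le> N" "g0 = of_nat j * \<rho>1 + of_nat (N - j) * \<rho>2"
    using finite_point[of 0 \<rho>1 \<rho>2] \<rho> by (auto simp: G)
  obtain i where i: "i \<le> N" "g1 = - 2 * \<alpha> * of_nat i"
    using constant_darboux_seq[OF inf, of "- 2 * \<alpha>" 0] by (auto simp: G mult.commute)
  define h where "h j = coeff (B j) M" for j
  define k where "k j = coeff (B j) (M - 1)" for j
  obtain M' where M': "M = Suc M'" using M(1) N by (cases M) auto
  have h1: "(of_nat i - of_nat j) * (2 * \<alpha>) * h j
      + (case j of 0 \<Rightarrow> 0 | Suc l \<Rightarrow> (of_nat N - of_nat l) * h l) = 0" for j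
  proof -
    have "0 + of_nat (Suc j) * 0 * h (Suc j) + of_nat j * (- 2 * \<alpha>) * h j
          + (case j of 0 \<Rightarrow> 0 | Suc l \<Rightarrow> (of_nat N - of_nat l) * h l) = g1 * h j"
      using inf unfolding darboux_seq_def h_def G by simp
    thus ?thesis unfolding i(2) by (simp add: algebra_simps)
  qed
  have h2: "(of_nat M - of_nat j) * h j + of_nat (Suc j) * \<beta> * h (Suc j) + of_nat j * c * h j - g0 * h j
      + ((of_nat i - of_nat j) * (2 * \<alpha>) * k j
      + (case j of 0 \<Rightarrow> 0 | Suc l \<Rightarrow> (of_nat N - of_nat l) * k l)) = 0" for j
  proof -
    define m where "m = (monom 1 (Suc j) :: complex poly)"
    have z: "coeff (B j) l = 0" if "l > M" for j l using M(3)[of j] that by (simp add: coeff_eq_0)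
    have X: "monom 1 1 * pderiv (monom 1 j) = smult (of_nat j) (monom (1 :: complex) j)"
      by (cases j) (auto simp: pderiv_monom mult_monom smult_monom)
    have 1: "m * ([:0, 1:] * pderiv (b j)) = monom 1 1 * (monom 1 1 * pderiv (B j) - smult (of_nat j) (B j))"
    proof -
      have "monom 1 1 * pderiv (B j) - smult (of_nat j) (B j) = monom 1 (Suc j) * pderiv (b j)"
      proof -
        have "monom 1 1 * pderiv (B j) = (monom 1 1 * pderiv (monom 1 j)) * b j + monom 1 1 * monom 1 j * pderiv (b j)"
          unfolding B_def pderiv_mult by (simp add: distrib_left mult_ac)
        thus ?thesis unfolding X by (simp add: B_def mult_monom)
      qed
      moreover have "[:0, 1:] = monom (1 :: complex) 1" by (simp add: monom_altdef)
      ultimately show ?thesis unfolding m_def by (simp only: mult_ac)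
    qed
    have 2: "m * ([:\<kappa>, \<beta>:] * b (Suc j)) = [:\<kappa>, \<beta>:] * B (Suc j)"
      unfolding m_def B_def mult_1 by (simp only: mult_ac)
    have mm: "m = monom 1 1 * monom 1 j" by (simp add: m_def mult_monom)
    have 3: "m * ([:c, - 2 * \<alpha>:] * b j) = monom 1 1 * ([:c, - 2 * \<alpha>:] * B j)"
      unfolding mm B_def mult_1 by (simp only: mult_ac)
    have 4: "m * b l = monom 1 2 * B l" if "j = Suc l" for l
    proof -
      have "m = monom 1 2 * monom 1 l" by (simp add: m_def mult_monom that)
      thus ?thesis unfolding B_def by (simp only: mult_ac mult_1)
    qed
    have 5: "m * (G * b j) = monom 1 1 * (G * B j)"
      unfolding mm B_def mult_1 by (simp only: mult_ac)
    have c1: "coeff (monom 1 1 * q) (Suc n) = coeff q n" for n and q :: "complex poly"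
      by (simp add: coeff_monom_mult)
    have c2: "coeff (monom 1 2 * q) (Suc M) = coeff q (M - 1)" for q :: "complex poly"
      by (simp add: coeff_monom_mult M')
    have "m * ([:0, 1:] * pderiv (b j)) + smult (of_nat (Suc j)) (m * ([:\<kappa>, \<beta>:] * b (Suc j)))
       + smult (of_nat j) (m * ([:c, - 2 * \<alpha>:] * b j))
          + (case j of 0 \<Rightarrow> 0 | Suc l \<Rightarrow> smult (of_nat N - of_nat l) (m * b l)) = m * (G * b j)"
      using arg_cong[OF b_eq'[of j], of "\<lambda>q. m * q"]
      by (cases j) (simp_all only: distrib_left mult_smult_right nat.case mult_zero_right)
    hence "coeff (monom 1 1 * (monom 1 1 * pderiv (B j) - smult (of_nat j) (B j))) (Suc M)
        + of_nat (Suc j) * coeff ([:\<kappa>, \<beta>:] * B (Suc j)) (Suc M)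
        + of_nat j * coeff (monom 1 1 * ([:c, - 2 * \<alpha>:] * B j)) (Suc M)
        + (case j of 0 \<Rightarrow> 0 | Suc l \<Rightarrow> (of_nat N - of_nat l) * coeff (monom 1 2 * B l) (Suc M))
        = coeff (monom 1 1 * (G * B j)) (Suc M)"
      unfolding 1 2 3 5 using 4
      by (cases j) (auto dest!: arg_cong[of _ _ "\<lambda>q. coeff q (Suc M)"] simp del: of_nat_Suc mult_pCons_left)
    hence "(of_nat M * h j - of_nat j * h j) + of_nat (Suc j) * (\<beta> * h (Suc j))
        + of_nat j * (c * h j - 2 * \<alpha> * k j)
        + (case j of 0 \<Rightarrow> 0 | Suc l \<Rightarrow> (of_nat N - of_nat l) * k l)
        = g0 * h j + g1 * k j"
      unfolding c1 c2 G by (cases j) (simp_all add: c1[unfolded One_nat_def] M' coeff_pderiv h_def k_def z)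
    thus ?thesis unfolding i(2) by (simp add: algebra_simps)
  qed
  \<comment> \<open>In the recurrence \<open>h1\<close> the factor \<open>i - j\<close> forces
    \<open>h\<close> to vanish below \<open>i\<close>; and \<open>h i = 0\<close> would make all of
    \<open>h\<close> vanish.\<close>
  have h0: "h l = 0" if "l < i" for l
    using that
  proof (induction l)
    case 0
    thus ?case using h1[of 0] \<alpha> by simp
  next
    case (Suc l)
    have "of_nat i - of_nat (Suc l) \<noteq> (0 :: complex)" using Suc.prems by (metis of_nat_eq_iff less_irrefl right_minus_eq)
    thus ?case using h1[of "Suc l"] \<alpha> Suc by simp
  qed
  have hi: "h i \<noteq> 0"
  proof
    assume z: "h i = 0"
    have "h l = 0" for l
    proof (induction l)
      case 0
      show ?case using h0[of 0] z by (cases i) auto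
    next
      case (Suc l)
      show ?case
      proof (cases "Suc l = i")
        case False
        hence "of_nat i - of_nat (Suc l) \<noteq> (0 :: complex)" by (metis of_nat_eq_iff right_minus_eq)
        thus ?thesis using h1[of "Suc l"] \<alpha> Suc by simp
      qed (use z in auto)
    qed
    moreover have "h N \<noteq> 0" using inf unfolding darboux_seq_def h_def by blast
    ultimately show False by blast
  qed
  have k0: "k l = 0" if "Suc l < i" for l
    using that
  proof (induction l)
    case 0
    thus ?case using h2[of 0] \<alpha> h0[of 0] h0[of 1] by simp
  next
    case (Suc l)
    have "of_nat i - of_nat (Suc l) \<noteq> (0 :: complex)" using Suc.prems by (metis of_nat_eq_iff Suc_lessD less_irrefl right_minus_eq)
    moreover have "h (Suc l) = 0" "h (Suc (Suc l)) = 0" using h0 Suc.prems by auto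
    ultimately show ?case using h2[of "Suc l"] \<alpha> Suc by simp
  qed
  define x where "x = \<beta> / (2 * \<alpha>)"
  have \<beta>: "\<beta> = 2 * \<alpha> * x" using \<alpha> by (simp add: x_def)
  have hS: "2 * \<alpha> * h (Suc i) = (of_nat N - of_nat i) * h i"
    using h1[of "Suc i"] by (simp add: algebra_simps)
  have hS': "of_nat (Suc i) * \<beta> * h (Suc i) = (of_nat i + 1) * x * ((of_nat N - of_nat i) * h i)"
    unfolding hS[symmetric] \<beta> by (simp add: algebra_simps)
  \<comment> \<open>In \<open>h2\<close> for index \<open>i\<close> only \<open>h (i + 1)\<close>
    and \<open>k (i - 1)\<close> remain besides \<open>h i\<close>, and both are multiples of
    \<open>h i\<close>; dividing by it gives \<open>g0\<close>.\<close>
  have "g0 = of_nat M + (c - 1) * of_nat i + x * (of_nat N - 2 * of_nat i)"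
  proof (cases i)
    case 0
    have "h i * g0 = h i * (of_nat M + x * of_nat N)"
      using h2[of i] hS' by (simp add: 0 algebra_simps)
    hence "g0 = of_nat M + x * of_nat N" using hi by simp
    thus ?thesis by (simp add: 0)
  next
    case (Suc l)
    have "k (l - 1) = 0" if "l \<noteq> 0" using k0[of "l - 1"] that Suc by simp
    hence "of_nat i * \<beta> * h i + 2 * \<alpha> * k l = 0"
      using h2[of l] h0[of l] Suc by (cases l) (simp_all add: algebra_simps)
    hence "2 * \<alpha> * (of_nat i * x * h i + k l) = 0" by (simp add: \<beta> algebra_simps)
    hence k: "k l = - of_nat i * x * h i" using \<alpha> by (simp add: eq_neg_iff_add_eq_0 add.commute)
    have "(of_nat M - of_nat i) * h i + of_nat (Suc i) * \<beta> * h (Suc i) + of_nat i * c * h i - g0 * h i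
      + (of_nat N - of_nat l) * k l = 0"
      using h2[of i] by (simp add: Suc)
    hence "h i * g0 = h i * (of_nat M + (c - 1) * of_nat i + x * (of_nat N - 2 * of_nat i))"
      unfolding k hS' by (simp add: Suc algebra_simps)
    thus ?thesis using hi by simp
  qed
  hence "g0 = of_nat M + (c - 1) * of_nat i + \<beta> / (2 * \<alpha>) * (of_nat N - 2 * of_nat i)"
    by (simp add: x_def)
  hence "of_nat j * \<rho>1 + of_nat (N - j) * \<rho>2
    = of_nat M + (c - 1) * of_nat i + \<beta> / (2 * \<alpha>) * (of_nat N - 2 * of_nat i)" unfolding j(2) .
  with M(1) i(1) j(1) show ?thesis by (intro exI[of _ M] exI[of _ i] exI[of _ j] conjI)
qed

section \<open>Generic energies\<close>

text \<open>The exponent of 2 is even in a nonzero square and odd in twice such a square.\<close>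

lemma square_ne_twice_square:
  fixes n :: nat and z :: int
  assumes "n > 0"
  shows "(int n)\<^sup>2 \<noteq> 2 * z\<^sup>2"
proof
  assume eq: "(int n)\<^sup>2 = 2 * z\<^sup>2"
  hence z: "z \<noteq> 0" using assms by auto
  have "2 * multiplicity 2 (int n) = multiplicity 2 ((int n)\<^sup>2)"
    using assms by (subst prime_elem_multiplicity_power_distrib) auto
  also have "\<dots> = 1 + 2 * multiplicity 2 z"
    unfolding eq using z
    by (subst prime_elem_multiplicity_mult_distrib) (auto simp: prime_elem_multiplicity_power_distrib)
  finally show False by presburger
qed

lemma square_ne:
  fixes n :: nat and z :: int and c :: complex
  assumes "n > 0" "c \<in> {2, -1, -2}"
  shows "(of_nat n)\<^sup>2 \<noteq> (of_int z)\<^sup>2 * c"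
proof
  assume "(of_nat n)\<^sup>2 = (of_int z)\<^sup>2 * c"
  moreover obtain k :: int where k: "c = of_int k" "k \<in> {2, -1, -2}"
  proof -
    have "c = of_int 2 \<or> c = of_int (-1) \<or> c = of_int (-2)" using assms(2) by auto
    thus ?thesis using that by blast
  qed
  ultimately have "(of_int ((int n)\<^sup>2) :: complex) = of_int (z\<^sup>2 * k)" by simp
  hence eq: "(int n)\<^sup>2 = z\<^sup>2 * k" unfolding of_int_eq_iff .
  have "(int n)\<^sup>2 > 0" using assms(1) by simp
  moreover have "z\<^sup>2 \<ge> 0" by simp
  ultimately have "k \<noteq> -1" "k \<noteq> -2" using eq by auto
  thus False using k(2) eq square_ne_twice_square[OF assms(1), of z] by auto
qed

text \<open>The choice \<open>e = 2 \<bar>a\<bar>\<close> makes the factor \<open>e / a\<close>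
  equal to \<open>2\<close> or \<open>-2\<close>.\<close>

lemma generic_parameter_hermite:
  fixes a :: real
  assumes "a \<noteq> 0"
  shows "\<exists>e>0. \<forall>n>0. \<forall>z::int. (of_nat n)\<^sup>2 \<noteq> (of_int z)\<^sup>2 * (of_real (e / a) :: complex)"
proof (intro exI[of _ "2 * \<bar>a\<bar>"] conjI allI impI)
  fix n :: nat and z :: int assume "n > 0"
  moreover have "complex_of_real (2 * \<bar>a\<bar> / a) \<in> {2, -1, -2}" using assms by (auto simp: abs_if)
  ultimately show "(of_nat n)\<^sup>2 \<noteq> (of_int z)\<^sup>2 * (of_real (2 * \<bar>a\<bar> / a) :: complex)"
    by (rule square_ne)
qed (use assms in auto)

lemma generic_parameter_regular:
  fixes a :: real
  assumes "a \<noteq> 0"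
  shows "\<exists>e>0. \<forall>n>0. \<forall>z::int. (of_nat n)\<^sup>2 \<noteq> (of_int z)\<^sup>2 * (of_real (1 + 4 * a * e) :: complex)"
proof -
  \<comment> \<open>Makes \<open>1 + 4 a e\<close> equal to \<open>2\<close> for
    \<open>a > 0\<close> and to \<open>-1\<close> for \<open>a < 0\<close>.\<close>
  define e where "e = (if a > 0 then 1 / (4 * a) else - 1 / (2 * a))"
  have "e > 0" using assms by (auto simp: e_def divide_less_0_iff zero_less_divide_iff)
  moreover have "complex_of_real (1 + 4 * a * e) \<in> {2, -1, -2}" using assms by (auto simp: e_def)
  ultimately show ?thesis using square_ne by blast
qed

text \<open>Two square roots occur together, so countability replaces an explicit energy: each
  relation becomes a nonzero polynomial equation in \<open>e\<close>, and countably many finite sets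
  of roots do not fill an interval.\<close>

lemma generic_parameter_legendre:
  fixes a b :: real
  assumes "a \<noteq> 0" "b \<noteq> 0"
  shows "\<exists>e>0. \<forall>\<mu> \<eta> :: complex. \<mu>\<^sup>2 = of_real (b * e) \<longrightarrow> \<eta>\<^sup>2 = of_real (1 + 4 * a * e) \<longrightarrow>
    (\<forall>n>0. \<forall>z z' :: int. of_nat n + of_int z * \<mu> \<noteq> of_int z' * \<eta>)"
proof -
  \<comment> \<open>Squaring \<open>n + z \<mu> = z' \<eta>\<close> isolates
    \<open>2 n z \<mu>\<close>, and squaring again removes \<mu>; what remains is a polynomial in
    \<open>e\<close>.\<close>
  define P where "P = (\<lambda>(n :: nat, z :: int, z' :: int).
    [:(real_of_int z')\<^sup>2 - (real n)\<^sup>2, 4 * a * (real_of_int z')\<^sup>2 - (real_of_int z)\<^sup>2 * b:]\<^sup>2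
    - [:0, 4 * (real n)\<^sup>2 * (real_of_int z)\<^sup>2 * b:])"
  define I where "I = {n :: nat. n > 0} \<times> (UNIV :: int set) \<times> (UNIV :: int set)"
  have P0: "P t \<noteq> 0" if "t \<in> I" for t
  proof
    assume 0: "P t = 0"
    obtain n z z' where t: "t = (n, z, z')" by (cases t)
    have n: "n > 0" using that by (simp add: t I_def)
    define c0 where "c0 = (real_of_int z')\<^sup>2 - (real n)\<^sup>2"
    define c1 where "c1 = 4 * a * (real_of_int z')\<^sup>2 - (real_of_int z)\<^sup>2 * b"
    have "P t = [:c0, c1:]\<^sup>2 - [:0, 4 * (real n)\<^sup>2 * (real_of_int z)\<^sup>2 * b:]"
      by (simp add: P_def t c0_def c1_def)
    also have "\<dots> = [:c0\<^sup>2, 2 * c0 * c1 - 4 * (real n)\<^sup>2 * (real_of_int z)\<^sup>2 * b, c1\<^sup>2:]"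
      by (simp add: power2_eq_square)
    finally have c: "c0 = 0" "c1 = 0" "2 * c0 * c1 - 4 * (real n)\<^sup>2 * (real_of_int z)\<^sup>2 * b = 0"
      using 0 by auto
    hence "z = 0" using n assms by simp
    hence "z' = 0" using c(2) assms by (simp add: c1_def)
    thus False using c(1) n by (simp add: c0_def)
  qed
  have "countable I" unfolding I_def by auto
  hence "countable (\<Union>t\<in>I. {e. poly (P t) e = 0})"
    using poly_roots_finite[OF P0] by (intro countable_UN) (auto intro: countable_finite)
  moreover have "uncountable {0<..<1::real}" by (simp add: uncountable_open_interval)
  ultimately have "\<not> {0<..<1::real} \<subseteq> (\<Union>t\<in>I. {e. poly (P t) e = 0})" using countable_subset by blast
  then obtain e where "e \<in> {0<..<1}" "e \<notin> (\<Union>t\<in>I. {e. poly (P t) e = 0})" by blast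
  hence e: "e > 0" "\<And>t. t \<in> I \<Longrightarrow> poly (P t) e \<noteq> 0" by simp_all
  have False if \<mu>: "\<mu>\<^sup>2 = of_real (b * e)" and \<eta>: "\<eta>\<^sup>2 = of_real (1 + 4 * a * e)"
    and n: "n > 0" and eq: "of_nat n + of_int z * \<mu> = of_int z' * \<eta>" for \<mu> \<eta> :: complex and n and z z' :: int
  proof -
    define A where "A = (real_of_int z')\<^sup>2 * (1 + 4 * a * e) - (real n)\<^sup>2 - (real_of_int z)\<^sup>2 * (b * e)"
    have "complex_of_real A = (of_int z' * \<eta>)\<^sup>2 - (of_nat n)\<^sup>2 - (of_int z * \<mu>)\<^sup>2"
      unfolding A_def power_mult_distrib \<mu> \<eta> by simp
    also have "\<dots> = 2 * of_nat n * of_int z * \<mu>"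
      unfolding eq[symmetric] by (simp add: power2_eq_square algebra_simps)
    finally have "(complex_of_real A)\<^sup>2 = (2 * of_nat n * of_int z)\<^sup>2 * \<mu>\<^sup>2" by (simp add: power_mult_distrib)
    hence "complex_of_real (A\<^sup>2) = of_real (4 * (real n)\<^sup>2 * (real_of_int z)\<^sup>2 * (b * e))"
      unfolding \<mu> by (simp add: power_mult_distrib)
    hence "A\<^sup>2 = 4 * (real n)\<^sup>2 * (real_of_int z)\<^sup>2 * (b * e)" unfolding of_real_eq_iff .
    moreover have "poly (P (n, z, z')) e = A\<^sup>2 - 4 * (real n)\<^sup>2 * (real_of_int z)\<^sup>2 * (b * e)"
      by (simp add: P_def A_def poly_power algebra_simps)
    ultimately have "poly (P (n, z, z')) e = 0" by simp
    thus False using e(2)[of "(n, z, z')"] n by (simp add: I_def)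
  qed
  thus ?thesis using e(1) by blast
qed

section \<open>Laurent expansions of Liouvillian towers\<close>

lemma derivation_fls: "const_derivation (\<lambda>x :: complex fls. m * fls_deriv x) fls_const"
proof
  show "m * fls_deriv (x * y) = m * fls_deriv x * y + x * (m * fls_deriv y)" for x y
    by (simp add: algebra_simps)
  show "fls_const (x + y) = fls_const x + fls_const y" for x y :: complex
    by (simp add: fls_plus_const)
qed (auto simp: algebra_simps fls_times_fps_to_fls)

lemma laurent_const: "laurent_expansion (\<lambda>_. k) c = fls_const k"
  by (rule laurent_expansion_eqI) (intro laurent_expansion_intros)

context
  fixes D :: "complex set" and c :: complex
  assumes D: "c \<in> D"
begin

lemma laurent_at:
  "f meromorphic_on D \<Longrightarrow> (\<lambda>w. f (c + w)) has_laurent_expansion laurent_expansion f c"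
  using D meromorphic_on_imp_has_laurent_expansion by blast

lemma laurent_cosparse_cong:
  assumes "\<forall>\<^sub>\<approx>z\<in>D. f z = g z"
  shows "laurent_expansion f c = laurent_expansion g c"
  using eventually_cosparse_imp_eventually_at[OF assms D] by (intro laurent_expansion_cong) auto

lemma laurent_add:
  assumes "f meromorphic_on D" "g meromorphic_on D"
  shows "laurent_expansion (\<lambda>z. f z + g z) c = laurent_expansion f c + laurent_expansion g c"
  by (rule laurent_expansion_eqI) (intro laurent_expansion_intros laurent_at assms)

lemma laurent_mult:
  assumes "f meromorphic_on D" "g meromorphic_on D"
  shows "laurent_expansion (\<lambda>z. f z * g z) c = laurent_expansion f c * laurent_expansion g c"
  by (rule laurent_expansion_eqI) (intro laurent_expansion_intros laurent_at assms)

lemma laurent_uminus: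
  assumes "f meromorphic_on D"
  shows "laurent_expansion (\<lambda>z. - f z) c = - laurent_expansion f c"
  by (rule laurent_expansion_eqI) (intro laurent_expansion_intros laurent_at assms)

lemma laurent_inverse:
  assumes "f meromorphic_on D"
  shows "laurent_expansion (\<lambda>z. inverse (f z)) c = inverse (laurent_expansion f c)"
  by (rule laurent_expansion_eqI) (intro laurent_expansion_intros laurent_at assms)

lemma laurent_power:
  assumes "f meromorphic_on D"
  shows "laurent_expansion (\<lambda>z. f z ^ n) c = laurent_expansion f c ^ n"
  by (rule laurent_expansion_eqI) (intro laurent_expansion_intros laurent_at assms)

lemma laurent_sum:
  assumes "\<And>i. i \<in> I \<Longrightarrow> f i meromorphic_on D"
  shows "laurent_expansion (\<lambda>z. \<Sum>i\<in>I. f i z) c = (\<Sum>i\<in>I. laurent_expansion (f i) c)"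
  by (rule laurent_expansion_eqI) (intro laurent_expansion_intros laurent_at assms)

lemma laurent_deriv:
  assumes "f meromorphic_on D"
  shows "laurent_expansion (deriv f) c = fls_deriv (laurent_expansion f c)"
proof (rule laurent_expansion_eqI)
  have "deriv (\<lambda>w. f (c + w)) = (\<lambda>w. deriv f (c + w))"
  proof
    fix w
    show "deriv (\<lambda>w. f (c + w)) w = deriv f (c + w)"
      unfolding deriv_def using DERIV_shift[of f _ w c] by (simp add: add.commute)
  qed
  thus "(\<lambda>w. deriv f (c + w)) has_laurent_expansion fls_deriv (laurent_expansion f c)"
    using has_laurent_expansion_deriv[OF laurent_at[OF assms]] by simp
qed

end

context
  fixes D :: "complex set" and c :: complex
  assumes D: "open D" "connected D" "c \<in> D"
begin

text \<open>On a connected set a meromorphic function vanishes off a sparse set or is nonzero off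
  one. This keeps the leading coefficient of an algebraic relation nonzero after expansion at
  \<open>c\<close>.\<close>

lemma laurent_eq_0_imp_cosparse:
  assumes "f meromorphic_on D" "laurent_expansion f c = 0"
  shows "\<forall>\<^sub>\<approx>z\<in>D. f z = 0"
proof (rule ccontr)
  assume "\<not> (\<forall>\<^sub>\<approx>z\<in>D. f z = 0)"
  hence "\<forall>\<^sub>\<approx>z\<in>D. f z \<noteq> 0"
    using meromorphic_imp_constant_or_avoid[OF assms(1) D(1,2), of 0] by blast
  hence "eventually (\<lambda>z. f z \<noteq> 0) (at c)"
    using eventually_cosparse_imp_eventually_at D(3) by blast
  thus False
    using has_laurent_expansion_eventually_nonzero_iff[OF laurent_at[OF D(3) assms(1)]] assms(2) by simp
qed

text \<open>Towers of fields of functions are tracked by their Laurent expansions at \<open>c\<close>, inside the field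
  of formal Laurent series. The derivation is rescaled to \<open>m * d/dz\<close>.\<close>

lemma liouvillian_tower:
  fixes m :: "complex fls" and L :: "complex fls set"
  defines "d \<equiv> (\<lambda>x. m * fls_deriv x)"
  defines "H \<equiv> (\<lambda>L. {f. f meromorphic_on D \<and> laurent_expansion f c \<in> L})"
  assumes m: "m \<noteq> 0" "m \<in> L" and L: "derivation.is_subfield d L" "range fls_const \<subseteq> L"
    and tower: "(liouvillian_step D)\<^sup>*\<^sup>* (diff_field_gen D A) F" and A: "A \<subseteq> H L"
  shows "\<exists>L'. derivation.is_subfield d L' \<and> L \<subseteq> L' \<and> F \<subseteq> H L' \<and>
    (\<forall>Q\<in>L. \<forall>R\<in>L. derivation.has_darboux d L' Q R \<longrightarrow> derivation.has_darboux d L Q R)"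
proof -
  interpret const_derivation d fls_const unfolding d_def by (rule derivation_fls)
  have field: "diff_field_on D (H K)" if K: "is_subfield K" and LK: "L \<subseteq> K" for K
    unfolding diff_field_on_def
  proof (intro conjI ballI allI impI)
    fix f assume f: "f \<in> H K"
    hence f': "f meromorphic_on D" "laurent_expansion f c \<in> K" by (auto simp: H_def)
    show "f meromorphic_on D" by fact
    show "(\<lambda>z. - f z) \<in> H K" "(\<lambda>z. inverse (f z)) \<in> H K"
      using f' by (auto simp: H_def laurent_uminus[OF D(3)] laurent_inverse[OF D(3)] intro!: meromorphic_intros K_intros[OF K])
    \<comment> \<open>\<open>K\<close> is closed under \<open>d\<close>, which is \<open>m\<close>
      times the derivative; since \<open>m \<in> K\<close>, it is closed under the derivative
      itself.\<close>
    have "d (laurent_expansion f c) / m \<in> K" using f' m LK by (intro K_intros[OF K]) auto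
    thus "deriv f \<in> H K" using f' m(1) by (auto simp: H_def laurent_deriv[OF D(3)] d_def intro!: meromorphic_intros)
    show "g \<in> H K" if "g meromorphic_on D \<and> (\<forall>\<^sub>\<approx>z\<in>D. f z = g z)" for g
      using that laurent_cosparse_cong[OF D(3), of f g] f' by (auto simp: H_def)
    fix g assume "g \<in> H K"
    hence g': "g meromorphic_on D" "laurent_expansion g c \<in> K" by (auto simp: H_def)
    show "(\<lambda>z. f z + g z) \<in> H K" "(\<lambda>z. f z * g z) \<in> H K"
      using f' g' by (auto simp: H_def laurent_add[OF D(3)] laurent_mult[OF D(3)] intro!: meromorphic_intros K_intros[OF K])
  next
    fix k show "(\<lambda>_. k) \<in> H K" using L(2) LK by (auto simp: H_def laurent_const)
  qed
  show ?thesis using tower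
  proof (induction rule: rtranclp_induct)
    case base
    have "diff_field_gen D A \<subseteq> H L" unfolding diff_field_gen_def
      using field[OF L(1)] A by blast
    thus ?case using L(1) by blast
  next
    case (step F F')
    then obtain K where K: "is_subfield K" "L \<subseteq> K" "F \<subseteq> H K"
      and desc: "\<And>Q R. Q \<in> L \<Longrightarrow> R \<in> L \<Longrightarrow> has_darboux K Q R \<Longrightarrow> has_darboux L Q R" by blast
    obtain \<alpha> where \<alpha>: "\<alpha> meromorphic_on D" "F' = diff_field_gen D (insert \<alpha> F)"
      and cases: "algebraic_over D F \<alpha> \<or> (\<exists>h\<in>F. \<forall>\<^sub>\<approx>z\<in>D. deriv \<alpha> z = h z) \<or>
         (\<exists>h\<in>F. \<forall>\<^sub>\<approx>z\<in>D. deriv \<alpha> z = h z * \<alpha> z)"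
      using step.hyps(2) unfolding liouvillian_step_def by blast
    define a where "a = laurent_expansion \<alpha> c"
    have FK: "h meromorphic_on D" "laurent_expansion h c \<in> K" if "h \<in> F" for h
      using K(3) that by (auto simp: H_def)
    have mK: "m \<in> K" using m K by blast
    have ext: "algebraic_elem K a \<or> (\<exists>h0\<in>K. \<exists>h1\<in>K. d a = h0 + h1 * a)"
      using cases
    proof (elim disjE bexE)
      assume "algebraic_over D F \<alpha>"
      then obtain n k where k: "\<And>i. i \<le> n \<Longrightarrow> k i \<in> F" "\<not> (\<forall>\<^sub>\<approx>z\<in>D. k n z = 0)"
        "\<forall>\<^sub>\<approx>z\<in>D. (\<Sum>i\<le>n. k i z * \<alpha> z ^ i) = 0"
        unfolding algebraic_over_def by blast
      define p where "p = (\<Sum>i\<le>n. monom (laurent_expansion (k i) c) i)"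
      have mer: "(\<lambda>z. k i z * \<alpha> z ^ i) meromorphic_on D" if "i \<le> n" for i
        using FK(1)[OF k(1)[OF that]] \<alpha>(1) by (intro meromorphic_intros)
      have "poly p a = (\<Sum>i\<le>n. laurent_expansion (k i) c * a ^ i)"
        by (simp add: p_def poly_sum poly_monom)
      also have "\<dots> = (\<Sum>i\<le>n. laurent_expansion (\<lambda>z. k i z * \<alpha> z ^ i) c)"
        using FK(1)[OF k(1)] \<alpha>(1) unfolding a_def
        by (intro sum.cong) (auto simp: laurent_mult[OF D(3)] laurent_power[OF D(3)] meromorphic_intros)
      also have "\<dots> = laurent_expansion (\<lambda>z. \<Sum>i\<le>n. k i z * \<alpha> z ^ i) c"
        using mer by (intro laurent_sum[OF D(3), symmetric]) auto
      also have "\<dots> = 0" using laurent_cosparse_cong[OF D(3) k(3)] laurent_const[of 0] by simp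
      finally have "poly p a = 0" .
      moreover have "coeff p n \<noteq> 0"
        using laurent_eq_0_imp_cosparse[OF FK(1)[OF k(1)[OF order.refl]]] k(2)
        by (auto simp: p_def coeff_sum coeff_monom)
      hence "p \<noteq> 0" by auto
      moreover have "p \<in> polys K" unfolding p_def using FK(2)[OF k(1)]
        by (intro polys_intros[OF K(1)]) auto
      ultimately show ?thesis unfolding algebraic_elem_def by blast
    next
      fix h assume h: "h \<in> F" "\<forall>\<^sub>\<approx>z\<in>D. deriv \<alpha> z = h z"
      have "fls_deriv a = laurent_expansion h c"
        using laurent_cosparse_cong[OF D(3) h(2)] laurent_deriv[OF D(3) \<alpha>(1)] by (simp add: a_def)
      hence "d a = m * laurent_expansion h c + 0 * a" by (simp add: d_def)
      thus ?thesis using K_mult[OF K(1) mK FK(2)[OF h(1)]] K_0[OF K(1)] by blast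
    next
      fix h assume h: "h \<in> F" "\<forall>\<^sub>\<approx>z\<in>D. deriv \<alpha> z = h z * \<alpha> z"
      have "fls_deriv a = laurent_expansion h c * a"
        using laurent_cosparse_cong[OF D(3) h(2)] laurent_deriv[OF D(3) \<alpha>(1)] laurent_mult[OF D(3) FK(1)[OF h(1)] \<alpha>(1)]
        by (simp add: a_def)
      hence "d a = 0 + (m * laurent_expansion h c) * a" by (simp add: d_def mult.assoc)
      thus ?thesis using K_mult[OF K(1) mK FK(2)[OF h(1)]] K_0[OF K(1)] by blast
    qed
    define K' where "K' = adjoin K a"
    have K': "is_subfield K'" "K \<subseteq> K'" "a \<in> K'"
      unfolding K'_def using is_subfield_adjoin'[OF K(1) ext] subset_adjoin[OF K(1)] in_adjoin[OF K(1)] by auto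
    have "insert \<alpha> F \<subseteq> H K'" using K(3) K' \<alpha>(1) by (auto simp: H_def a_def)
    moreover have "diff_field_on D (H K')" using field K(2) K'(1,2) by blast
    ultimately have "F' \<subseteq> H K'" unfolding \<alpha>(2) diff_field_gen_def by blast
    moreover have "has_darboux L Q R" if QR: "Q \<in> L" "R \<in> L" and dar: "has_darboux K' Q R" for Q R
      using desc[OF QR] has_darboux_adjoin[OF K(1) ext] QR K(2) dar unfolding K'_def by blast
    ultimately show ?case using K' K(2) by blast
  qed
qed

end

text \<open>The Riccati solution \<open>m Y' / Y\<close> belongs to \<open>Q0\<close> and
  \<open>R0\<close>; subtracting \<open>q\<close> changes these to \<open>Q\<close> and
  \<open>R\<close>. The descent first ends in \<open>L0\<close>, that is
  \<open>\<complex>(v)(m)\<close>. As \<open>m^2\<close> is a polynomial in \<open>v\<close>, one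
  more algebraic step leads to \<open>\<complex>(v)\<close>.\<close>

lemma darboux_of_riccati:
  fixes m v r Y :: "complex fls" and L :: "complex fls set" and p Q0 R0 q S Q R :: "complex poly"
  defines "d \<equiv> (\<lambda>x. m * fls_deriv x)"
  defines "E \<equiv> const_derivation.ev fls_const"
  defines "L0 \<equiv> derivation.adjoin (derivation.adjoin (range fls_const) v) m"
  assumes m: "m \<noteq> 0" and v: "fls_deriv v \<noteq> 0" "m * fls_deriv v = E v p"
    and S: "m\<^sup>2 = E v S" and R0: "fls_deriv m = E v R0" and r: "m\<^sup>2 * r = E v Q0"
    and Y: "Y \<noteq> 0" "fls_deriv (fls_deriv Y) = r * Y" "Y \<in> L"
    and L: "derivation.is_subfield d L" "L0 \<subseteq> L"
    and desc: "\<forall>Q\<in>L0. \<forall>R\<in>L0. derivation.has_darboux d L Q R \<longrightarrow> derivation.has_darboux d L0 Q R"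
    and Q: "Q = Q0 + R0 * q - q * q - p * pderiv q" and R: "R = R0 - 2 * q"
  shows "\<exists>N\<ge>1. \<exists>G b. poly_darboux p Q R N G b"
proof -
  interpret const_derivation d fls_const unfolding d_def by (rule derivation_fls)
  let ?K = "adjoin (range fls_const) v"
  have evL: "E v x \<in> ?K" for x unfolding E_def by (rule ev_in_adjoin)
  have dv: "d v = E v p" "d v \<noteq> 0" using v m by (auto simp: d_def)
  have K: "is_subfield ?K" by (rule is_subfield_adjoin[OF is_subfield_range_\<kappa>]) (simp add: dv evL)
  have neg: "E v (x - y) = E v x - E v y" for x y
    unfolding E_def using ev_add[of v x "- y"] by (simp add: ev_minus)
  define W0 where "W0 = m * fls_deriv Y / Y"
  define W where "W = W0 - E v q"
  have dinv: "d (inverse Y) = - m * fls_deriv Y * inverse Y * inverse Y"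
    unfolding d_inverse by (simp add: d_def)
  have "d W0 = d (m * fls_deriv Y) * inverse Y + m * fls_deriv Y * d (inverse Y)"
    by (simp add: W0_def divide_inverse d_mult)
  also have "\<dots> = m * (E v R0 * fls_deriv Y + m * (r * Y)) * inverse Y
      + m * fls_deriv Y * (- m * fls_deriv Y * inverse Y * inverse Y)"
    unfolding dinv unfolding d_def fls_deriv_mult R0 Y by (simp add: algebra_simps)
  also have "\<dots> = E v R0 * W0 + m\<^sup>2 * r - W0\<^sup>2"
    using Y(1) by (simp add: W0_def field_simps power2_eq_square)
  finally have dW0: "d W0 = E v Q0 + E v R0 * W0 - W0\<^sup>2" unfolding r by simp
  have dq: "d (E v q) = E v p * E v (pderiv q)"
    using d_ev[of v q] dv by (simp add: E_def mult.commute)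
  have evm: "E v (x * y) = E v x * E v y" "E v (x + y) = E v x + E v y" for x y
    by (simp_all add: E_def ev_mult ev_add)
  have ev2: "E v 2 = 2" using evm(2)[of 1 1] by (simp add: E_def)
  have "d W = E v Q + E v R * W - W\<^sup>2"
    unfolding W_def d_diff dW0 dq Q R neg evm ev2 by (simp add: algebra_simps power2_eq_square)
  moreover have KL0: "?K \<subseteq> L0" unfolding L0_def by (rule subset_adjoin[OF K])
  have "d Y \<in> L" by (rule K_d[OF L(1) Y(3)])
  hence "W0 \<in> L" unfolding W0_def using Y(3) K_divide[OF L(1)] by (simp add: d_def)
  hence "W \<in> L" unfolding W_def using evL KL0 L(2) by (intro K_diff[OF L(1)]) auto
  ultimately have "has_darboux L (E v Q) (E v R)"
    using evL KL0 L(2) by (intro has_darboux_riccati[OF L(1)]) auto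
  hence h0: "has_darboux L0 (E v Q) (E v R)" using desc evL KL0 by blast
  have "algebraic_elem ?K m"
    unfolding algebraic_elem_def
  proof (intro bexI conjI)
    show "[:- E v S, 0, 1:] \<in> polys ?K" using evL by (intro polys_intros[OF K] K_intros[OF K])
    show "poly [:- E v S, 0, 1:] m = 0" using S by (simp add: power2_eq_square)
  qed simp
  hence "has_darboux ?K (E v Q) (E v R)"
    using has_darboux_algebraic[OF K] evL h0 unfolding L0_def by blast
  from has_darboux_poly[OF dv[unfolded E_def] this[unfolded E_def]]
  obtain N G b where "N \<ge> 1" "darboux_seq (\<lambda>q. p * pderiv q) Q R N G b"
    "\<And>z. \<exists>j. poly (b j) z \<noteq> 0" by blast
  thus ?thesis unfolding poly_darboux_def by blast
qed

section \<open>Passing between the real time axis and a complex disc\<close>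

lemma frequently_real_at:
  fixes c r :: real
  assumes "r > 0" "\<And>t. t \<in> {c-r<..<c+r} \<Longrightarrow> P (complex_of_real t)"
  shows "\<exists>\<^sub>F z in at (complex_of_real c). P z"
  unfolding frequently_def
proof
  assume "\<forall>\<^sub>F z in at (complex_of_real c). \<not> P z"
  then obtain e where e: "e > 0" "\<And>z. z \<noteq> of_real c \<Longrightarrow> dist z (of_real c) < e \<Longrightarrow> \<not> P z"
    unfolding eventually_at by auto
  define t where "t = c + min r e / 2"
  have t: "t \<in> {c-r<..<c+r}" "t \<noteq> c" "\<bar>t - c\<bar> < e" using assms(1) e(1) by (auto simp: t_def)
  have "dist (complex_of_real t) (of_real c) = \<bar>t - c\<bar>" by (simp add: dist_of_real dist_real_def)
  thus False using e(2)[of "of_real t"] t assms(2) by simp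
qed

text \<open>Identity theorem: the points of a real interval accumulate at its centre.\<close>

lemma laurent_eq_of_real_eq:
  fixes c r :: real
  assumes "f analytic_on {of_real c}" "g analytic_on {of_real c}"
    and "r > 0" "\<And>t. t \<in> {c-r<..<c+r} \<Longrightarrow> f (of_real t) = g (of_real t)"
  shows "laurent_expansion f (of_real c) = laurent_expansion g (of_real c)"
proof -
  let ?c = "complex_of_real c"
  have fg: "(\<lambda>w. f (?c + w)) has_laurent_expansion laurent_expansion f ?c"
    "(\<lambda>w. g (?c + w)) has_laurent_expansion laurent_expansion g ?c"
    using assms(1,2) by (auto intro!: meromorphic_on_imp_has_laurent_expansion analytic_on_imp_meromorphic_on)
  have "(\<lambda>w. f (?c + w) - g (?c + w)) has_laurent_expansion
      (laurent_expansion f ?c - laurent_expansion g ?c)"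
    by (intro laurent_expansion_intros fg)
  moreover have "\<exists>\<^sub>F z in at ?c. f z - g z = 0"
    by (rule frequently_real_at[OF assms(3)]) (use assms(4) in auto)
  ultimately have "laurent_expansion f ?c - laurent_expansion g ?c = 0"
    using has_laurent_expansion_eventually_nonzero_iff[of "\<lambda>z. f z - g z" ?c]
    unfolding frequently_def by blast
  thus ?thesis by simp
qed

lemma laurent_nonzero:
  assumes "f analytic_on {z}" "f z \<noteq> 0"
  shows "laurent_expansion f z \<noteq> 0"
proof -
  have "isCont f z" using assms(1) by (simp add: analytic_at_imp_isCont)
  hence "eventually (\<lambda>w. f w \<noteq> 0) (at z)"
    using assms(2) by (simp add: isCont_def tendsto_imp_eventually_ne)
  moreover have "(\<lambda>w. f (z + w)) has_laurent_expansion laurent_expansion f z"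
    using assms(1) by (auto intro!: meromorphic_on_imp_has_laurent_expansion analytic_on_imp_meromorphic_on)
  ultimately show ?thesis using has_laurent_expansion_eventually_nonzero_iff by blast
qed

text \<open>The complex derivative restricts to the real one along the axis, which carries the
  differential equation of \<phi> over to its holomorphic continuation.\<close>

lemma deriv_along_reals:
  fixes c r :: real and g :: "real \<Rightarrow> real"
  assumes f: "f holomorphic_on ball (of_real c) r"
    and eq: "\<And>t. t \<in> {c-r<..<c+r} \<Longrightarrow> f (of_real t) = k * of_real (g t)"
    and g: "\<And>t. t \<in> {c-r<..<c+r} \<Longrightarrow> (g has_real_derivative g' t) (at t)"
    and t: "t \<in> {c-r<..<c+r}"
  shows "deriv f (of_real t) = k * of_real (g' t)"
proof -
  have "complex_of_real t \<in> ball (of_real c) r"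
    using t by (auto simp: dist_of_real dist_real_def abs_if)
  hence "(f has_field_derivative deriv f (of_real t)) (at (of_real t))"
    using f by (auto intro: holomorphic_derivI)
  hence 1: "((\<lambda>t. f (of_real t)) has_vector_derivative deriv f (of_real t)) (at t)"
    using has_vector_derivative_real_field by blast
  have "((\<lambda>t. k * of_real (g t)) has_vector_derivative k * of_real (g' t)) (at t)"
    using g[OF t] by (intro has_vector_derivative_mult_right has_vector_derivative_of_real)
      (auto simp: has_real_derivative_iff_has_vector_derivative)
  hence "((\<lambda>t. f (of_real t)) has_vector_derivative k * of_real (g' t)) (at t)"
    by (rule has_vector_derivative_transform_within_open[of _ _ _ "{c-r<..<c+r}"]) (use t eq in auto)
  thus ?thesis using 1 vector_derivative_unique_at by blast
qed

text \<open>Solving the propagator for \<phi> gives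
  \<open>\<phi> / k0^2 = exp (2 i \<omega> t) / (t K^2)\<close>. So the tower of \<open>K\<close>,
  extended by \<open>t\<close> and by this exponential, contains a solution \<open>y\<close> of the
  normal variational equation. Every entry \<open>A i j\<close> is \<open>0\<close>,
  \<open>1\<close> or \<rho> on the axis, so the coefficient field expands into
  \<open>L0\<close>.\<close>

lemma wkb_darboux:
  fixes c r \<omega> :: real and \<rho> \<phi> \<phi>' :: "real \<Rightarrow> real" and K :: "complex \<Rightarrow> complex" and k0 :: complex
    and A :: "'i \<Rightarrow> 'i \<Rightarrow> complex \<Rightarrow> complex" and v m :: "complex fls" and p Q0 R0 q S Q R :: "complex poly"
  defines "I \<equiv> {c-r<..<c+r}"
  defines "E \<equiv> const_derivation.ev fls_const"
  assumes r: "r > 0" "c - r \<ge> 0"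
    and hol: "\<And>i j. A i j holomorphic_on ball (of_real c) r" "K holomorphic_on ball (of_real c) r"
    and A: "\<And>i j. (\<forall>t\<in>I. A i j (of_real t) = 0) \<or> (\<forall>t\<in>I. A i j (of_real t) = 1)
      \<or> (\<forall>t\<in>I. A i j (of_real t) = of_real (\<rho> t))"
    and A0: "\<And>t. t \<in> I \<Longrightarrow> A i0 j0 (of_real t) = of_real (\<rho> t)"
    and \<phi>: "\<And>t. t \<in> I \<Longrightarrow> \<phi> t > 0" "\<And>t. t \<in> I \<Longrightarrow> (\<phi> has_real_derivative \<phi>' t) (at t)"
      "\<And>t. t \<in> I \<Longrightarrow> (\<phi>' has_real_derivative \<rho> t * \<phi> t) (at t)"
    and k0: "k0 \<noteq> 0"
    and K: "\<And>t. t \<in> I \<Longrightarrow> K (of_real t) = k0 * (1 / of_real (sqrt (t * \<phi> t))) * exp (\<i> * of_real \<omega> * of_real t)"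
    and liouv: "liouvillian_over (ball (of_real c) r) (diff_field_gen (ball (of_real c) r) {A i j | i j. True}) K"
    and m: "m \<noteq> 0" and v: "fls_deriv v \<noteq> 0" "m * fls_deriv v = E v p"
    and S: "m\<^sup>2 = E v S" and R0: "fls_deriv m = E v R0"
    and Q0: "m\<^sup>2 * laurent_expansion (A i0 j0) (of_real c) = E v Q0"
    and Q: "Q = Q0 + R0 * q - q * q - p * pderiv q" and R: "R = R0 - 2 * q"
  shows "\<exists>N\<ge>1. \<exists>G b. poly_darboux p Q R N G b"
proof -
  define D where "D = ball (complex_of_real c) r"
  let ?c = "complex_of_real c"
  define X where "X f = laurent_expansion f ?c" for f
  define d where "d = (\<lambda>x. m * fls_deriv x)"
  interpret const_derivation d fls_const unfolding d_def by (rule derivation_fls)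
  have D: "open D" "connected D" "?c \<in> D" using r by (auto simp: D_def)
  have c: "c > 0" using r by simp
  have cI: "c \<in> I" using r by (simp add: I_def)
  have an: "f analytic_on {?c}" if "f holomorphic_on D" for f
    using that D by (meson analytic_on_holomorphic empty_subsetI insert_subset)
  define L0 where "L0 = adjoin (adjoin (range fls_const) v) m"
  let ?K = "adjoin (range fls_const) v"
  have evL: "E v x \<in> ?K" for x unfolding E_def by (rule ev_in_adjoin)
  have dv: "d v = E v p" using v m by (auto simp: d_def)
  have K1: "is_subfield ?K" by (rule is_subfield_adjoin[OF is_subfield_range_\<kappa>]) (simp add: dv evL)
  have "d m = 0 + E v R0 * m" by (simp add: d_def R0)
  hence L0: "is_subfield L0" unfolding L0_def
    using is_subfield_adjoin'[OF K1] evL K_0[OF K1] by blast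
  have mL0: "m \<in> L0" unfolding L0_def by (rule in_adjoin[OF K1])
  have KL0: "?K \<subseteq> L0" unfolding L0_def by (rule subset_adjoin[OF K1])
  have cL0: "range fls_const \<subseteq> L0" using KL0 subset_adjoin[OF is_subfield_range_\<kappa>, of v] by blast
  have rL0: "X (A i0 j0) \<in> L0"
  proof -
    have "E v Q0 / m\<^sup>2 \<in> L0" using evL KL0 mL0 by (intro K_divide[OF L0] K_power[OF L0]) auto
    moreover have "E v Q0 / m\<^sup>2 = X (A i0 j0)" using Q0 m by (simp add: X_def field_simps)
    ultimately show ?thesis by simp
  qed
  have AL0: "A i j meromorphic_on D \<and> X (A i j) \<in> L0" for i j
  proof
    show "A i j meromorphic_on D"
      using hol D by (auto intro!: analytic_on_imp_meromorphic_on simp: analytic_on_open D_def)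
    have eq: "X (A i j) = X g" if "g analytic_on {?c}" "\<forall>t\<in>I. A i j (of_real t) = g (of_real t)" for g
      unfolding X_def
      by (rule laurent_eq_of_real_eq[OF an that(1) r(1)]) (use that(2) hol(1) in \<open>auto simp: I_def D_def\<close>)
    from A[of i j] show "X (A i j) \<in> L0"
    proof (elim disjE)
      assume "\<forall>t\<in>I. A i j (of_real t) = 0"
      hence "X (A i j) = X (\<lambda>_. 0)" by (intro eq) auto
      thus ?thesis using laurent_const[of 0] K_0[OF L0] by (simp add: X_def)
    next
      assume "\<forall>t\<in>I. A i j (of_real t) = 1"
      hence "X (A i j) = X (\<lambda>_. 1)" by (intro eq) auto
      thus ?thesis using laurent_const[of 1] K_1[OF L0] by (simp add: X_def)
    next
      assume "\<forall>t\<in>I. A i j (of_real t) = of_real (\<rho> t)"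
      hence "X (A i j) = X (A i0 j0)" using A0 hol(1) by (intro eq an) (auto simp: D_def)
      thus ?thesis using rL0 by simp
    qed
  qed
  obtain F where F: "(liouvillian_step D)\<^sup>*\<^sup>* (diff_field_gen D {A i j | i j. True}) F" "K \<in> F"
    using liouv unfolding liouvillian_over_def D_def by blast
  have A': "{A i j | i j. True} \<subseteq> {f. f meromorphic_on D \<and> laurent_expansion f ?c \<in> L0}"
    using AL0 by (auto simp: X_def)
  obtain L1 where L1: "is_subfield L1" "L0 \<subseteq> L1" "X K \<in> L1"
    and desc1: "\<forall>Q\<in>L0. \<forall>R\<in>L0. has_darboux L1 Q R \<longrightarrow> has_darboux L0 Q R"
    using liouvillian_tower[OF D m mL0 L0[unfolded d_def] cL0 F(1) A'] F(2)
    unfolding d_def X_def by blast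
  define Tt where "Tt = X (\<lambda>z. z)"
  define Ee where "Ee = X (\<lambda>z. exp (2 * \<i> * of_real \<omega> * z))"
  have mer: "(\<lambda>z. z) meromorphic_on D" "(\<lambda>z. exp (2 * \<i> * of_real \<omega> * z)) meromorphic_on D"
    by (auto intro!: analytic_on_imp_meromorphic_on analytic_intros)
  have "fls_deriv Tt = 1"
    using laurent_deriv[OF D(3) mer(1)] laurent_const[of 1] by (simp add: Tt_def X_def)
  hence dT: "d Tt = m + 0 * Tt" by (simp add: d_def)
  have "deriv (\<lambda>z. exp (2 * \<i> * of_real \<omega> * z)) = (\<lambda>z. 2 * \<i> * of_real \<omega> * exp (2 * \<i> * of_real \<omega> * z))"
  proof
    fix z show "deriv (\<lambda>z. exp (2 * \<i> * of_real \<omega> * z)) z = 2 * \<i> * of_real \<omega> * exp (2 * \<i> * of_real \<omega> * z)"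
      by (rule DERIV_imp_deriv) (auto intro!: derivative_eq_intros)
  qed
  hence "fls_deriv Ee = fls_const (2 * \<i> * of_real \<omega>) * Ee"
    using laurent_deriv[OF D(3) mer(2)] laurent_mult[OF D(3) meromorphic_on_const mer(2), of "2 * \<i> * of_real \<omega>"]
      laurent_const[of "2 * \<i> * of_real \<omega>"] by (simp add: Ee_def X_def)
  hence dE: "d Ee = 0 + (m * fls_const (2 * \<i> * of_real \<omega>)) * Ee" by (simp add: d_def mult.assoc)
  define L2 where "L2 = adjoin L1 Tt"
  have ext2: "\<exists>h0\<in>L1. \<exists>h1\<in>L1. d Tt = h0 + h1 * Tt"
    using dT mL0 L1(2) K_0[OF L1(1)] by blast
  have L2: "is_subfield L2" "L1 \<subseteq> L2" "Tt \<in> L2" unfolding L2_def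
    using is_subfield_adjoin'[OF L1(1) disjI2[OF ext2]] subset_adjoin[OF L1(1)] in_adjoin[OF L1(1)] by auto
  define L3 where "L3 = adjoin L2 Ee"
  have "fls_const (2 * \<i> * of_real \<omega>) \<in> L2" using cL0 L1(2) L2(2) by blast
  hence "m * fls_const (2 * \<i> * of_real \<omega>) \<in> L2"
    using mL0 L1(2) L2(2) by (intro K_mult[OF L2(1)]) auto
  hence ext3: "\<exists>h0\<in>L2. \<exists>h1\<in>L2. d Ee = h0 + h1 * Ee"
    using dE K_0[OF L2(1)] by blast
  have L3: "is_subfield L3" "L2 \<subseteq> L3" "Ee \<in> L3" unfolding L3_def
    using is_subfield_adjoin'[OF L2(1) disjI2[OF ext3]] subset_adjoin[OF L2(1)] in_adjoin[OF L2(1)] by auto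
  have desc: "\<forall>Q\<in>L0. \<forall>R\<in>L0. has_darboux L3 Q R \<longrightarrow> has_darboux L0 Q R"
  proof (intro ballI impI)
    fix Q R assume QR: "Q \<in> L0" "R \<in> L0" and h3: "has_darboux L3 Q R"
    have in1: "Q \<in> L1" "R \<in> L1" and in2: "Q \<in> L2" "R \<in> L2" using QR L1(2) L2(2) by auto
    have "has_darboux L2 Q R"
      using has_darboux_adjoin[OF L2(1) disjI2[OF ext3] in2] h3 unfolding L3_def by blast
    hence "has_darboux L1 Q R"
      using has_darboux_adjoin[OF L1(1) disjI2[OF ext2] in1] unfolding L2_def by blast
    thus "has_darboux L0 Q R" using desc1 QR by blast
  qed
  define y where "y z = exp (2 * \<i> * of_real \<omega> * z) / (z * K z ^ 2)" for z
  have Kc: "K ?c \<noteq> 0" using K[OF cI] k0 \<phi>(1)[OF cI] c by auto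
  have yreal: "y (of_real t) = (1 / k0\<^sup>2) * of_real (\<phi> t)" if "t \<in> I" for t
  proof -
    have t: "t > 0" using that r by (simp add: I_def)
    have p: "t * \<phi> t > 0" using t \<phi>(1)[OF that] by simp
    have "(complex_of_real (sqrt (t * \<phi> t)))\<^sup>2 = of_real (t * \<phi> t)"
      using p by (metis less_imp_le of_real_power real_sqrt_pow2)
    moreover have "(exp (\<i> * of_real \<omega> * of_real t))\<^sup>2 = exp (2 * \<i> * of_real \<omega> * complex_of_real t)"
      by (simp add: exp_double[symmetric] mult.assoc)
    ultimately have K2: "K (of_real t) ^ 2 = k0\<^sup>2 * (1 / of_real (t * \<phi> t)) * exp (2 * \<i> * of_real \<omega> * of_real t)"
      unfolding K[OF that] by (simp add: power_mult_distrib power_divide)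
    have "e / (x * (k * (1 / (x * f)) * e)) = (1 / k) * f" if "e \<noteq> 0" "x \<noteq> 0" "k \<noteq> 0" "f \<noteq> 0"
      for e x k f :: complex using that by (simp add: field_simps)
    thus ?thesis unfolding y_def K2 using t k0 \<phi>(1)[OF that] by simp
  qed
  \<comment> \<open>On a smaller disc neither \<open>z\<close> nor \<open>K\<close> has a zero, so
    \<open>y\<close> is holomorphic there.\<close>
  obtain r' where r': "r' > 0" "r' \<le> r" "y holomorphic_on ball ?c r'"
  proof -
    have "isCont K ?c" using an[OF hol(2)[folded D_def]] by (rule analytic_at_imp_isCont)
    then obtain e where e: "e > 0" "\<And>z. dist ?c z < e \<Longrightarrow> K z \<noteq> 0"
      using continuous_at_avoid Kc by blast
    define r' where "r' = min (min e c) r"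
    have "r' > 0" "r' \<le> r" using e c r by (auto simp: r'_def)
    moreover have "y holomorphic_on ball ?c r'"
    proof -
      have "K holomorphic_on ball ?c r'"
        by (rule holomorphic_on_subset[OF hol(2)]) (auto simp: r'_def)
      moreover have "z \<noteq> 0" if "z \<in> ball ?c r'" for z
        using that c by (auto simp: r'_def)
      moreover have "K z \<noteq> 0" if "z \<in> ball ?c r'" for z
        using that e(2) by (auto simp: r'_def)
      ultimately show ?thesis unfolding y_def by (intro holomorphic_intros) auto
    qed
    ultimately show ?thesis by (rule that)
  qed
  define I' where "I' = {c-r'<..<c+r'}"
  have I': "t \<in> I" if "t \<in> I'" for t using that r' by (auto simp: I_def I'_def)
  have y1: "deriv y (of_real t) = (1 / k0\<^sup>2) * of_real (\<phi>' t)" if "t \<in> I'" for t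
    by (rule deriv_along_reals[OF r'(3)]) (use yreal \<phi>(2) I' that in \<open>auto simp: I'_def\<close>)
  have hy1: "deriv y holomorphic_on ball ?c r'" using r'(3) by (rule holomorphic_deriv) auto
  have y2: "deriv (deriv y) (of_real t) = (1 / k0\<^sup>2) * of_real (\<rho> t * \<phi> t)" if "t \<in> I'" for t
    by (rule deriv_along_reals[OF hy1]) (use y1 \<phi>(3) I' that in \<open>auto simp: I'_def\<close>)
  define B where "B = ball ?c r'"
  have B: "open B" "connected B" "?c \<in> B" using r' by (auto simp: B_def)
  have anB: "f analytic_on {?c}" if "f holomorphic_on B" for f
    using that B by (meson analytic_on_holomorphic empty_subsetI insert_subset)
  have hy: "y holomorphic_on B" "deriv y holomorphic_on B" "deriv (deriv y) holomorphic_on B"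
    using r'(3) hy1 holomorphic_deriv[OF hy1] by (auto simp: B_def)
  have merB: "f meromorphic_on B" if "f holomorphic_on B" for f
    using that B by (auto intro!: analytic_on_imp_meromorphic_on simp: analytic_on_open)
  have AB: "A i0 j0 holomorphic_on B" "K holomorphic_on B"
    unfolding B_def
    by (rule holomorphic_on_subset[OF hol(1)], use r'(2) in auto, rule holomorphic_on_subset[OF hol(2)], use r'(2) in auto)
  define Y where "Y = X y"
  have Y0: "Y \<noteq> 0" unfolding Y_def X_def
    using yreal[OF cI] \<phi>(1)[OF cI] k0 by (intro laurent_nonzero anB hy) auto
  have "fls_deriv (fls_deriv Y) = X (deriv (deriv y))"
    unfolding Y_def X_def using laurent_deriv[OF B(3) merB] hy by metis
  also have "\<dots> = X (\<lambda>z. A i0 j0 z * y z)" unfolding X_def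
    by (rule laurent_eq_of_real_eq[of _ _ _ r'])
      (use hy AB r' y2 yreal A0 I' in \<open>auto intro!: anB holomorphic_intros simp: I'_def\<close>)
  also have "\<dots> = X (A i0 j0) * Y" unfolding Y_def X_def
    by (rule laurent_mult[OF B(3)]) (intro merB AB hy)+
  finally have Yeq: "fls_deriv (fls_deriv Y) = X (A i0 j0) * Y" .
  have "Y = Ee * inverse (Tt * X K ^ 2)"
  proof -
    have my: "y = (\<lambda>z. exp (2 * \<i> * of_real \<omega> * z) * inverse (z * K z ^ 2))"
      by (auto simp: y_def divide_inverse)
    show ?thesis
      unfolding Y_def X_def my Ee_def Tt_def
      by (rule laurent_expansion_eqI)
        (intro laurent_expansion_intros laurent_at[OF B(3)] merB AB holomorphic_intros)
  qed
  also have "\<dots> \<in> L3"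
    using L3 L2 L1 by (intro K_mult[OF L3(1)] K_inverse[OF L3(1)] K_power[OF L3(1)]) auto
  finally have YL: "Y \<in> L3" .
  have "L0 \<subseteq> L3" using L1 L2 L3 by blast
  thus ?thesis
    using darboux_of_riccati[of m v p S R0 "X (A i0 j0)" Q0 Y L3 Q q R]
      m v S R0 Q0 Y0 Yeq YL L3(1) desc Q R
    unfolding d_def E_def X_def L0_def by blast
qed

text \<open>Picard iteration for the equation integrated twice, whose kernel is
  \<open>(t - s) q s\<close>. The smallness condition makes the operator halve distances; a short
  time interval is enough for the path along the axis.\<close>

lemma linear_ode_second_order:
  fixes q :: "real \<Rightarrow> real" and a b T :: real
  assumes T: "T > 0" and q: "continuous_on {0..T} q" and small: "\<And>t. t \<in> {0..T} \<Longrightarrow> T\<^sup>2 * \<bar>q t\<bar> \<le> 1 / 2"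
  shows "\<exists>\<xi> \<eta>. \<xi> 0 = a \<and> \<eta> 0 = b \<and> (\<forall>t\<in>{0..T}. (\<xi> has_real_derivative \<eta> t) (at t within {0..T})
     \<and> (\<eta> has_real_derivative - q t * \<xi> t) (at t within {0..T}))"
proof -
  \<comment> \<open>Clamping the time to \<open>{0..T}\<close> places the fixed point in the
    complete space of bounded continuous functions on the whole line.\<close>
  define cl where "cl t = max 0 (min T t)" for t
  have cl: "cl t \<in> {0..T}" "t \<in> {0..T} \<Longrightarrow> cl t = t" for t using T by (auto simp: cl_def)
  have clc: "continuous_on UNIV cl" unfolding cl_def by (intro continuous_intros)
  define g where "g \<xi> t = a + b * t - integral {0..t} (\<lambda>s. (t - s) * (q s * \<xi> s))" for \<xi> t
  have cont: "continuous_on {0..T} (\<lambda>s. q s * apply_bcontfun \<xi> s)" for \<xi>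
    by (intro continuous_intros q continuous_on_subset[OF continuous_on_apply_bcontfun]) auto
  have int: "continuous_on {0..t} h \<Longrightarrow> h integrable_on {0..t}" for h :: "real \<Rightarrow> real" and t
    by (rule integrable_continuous_interval)
  \<comment> \<open>Splitting the kernel \<open>t - s\<close> takes \<open>t\<close> out of the
    integral, so that the fundamental theorem of calculus applies.\<close>
  have split: "g (apply_bcontfun \<xi>) t = a + b * t - (t * integral {0..t} (\<lambda>s. q s * apply_bcontfun \<xi> s)
      - integral {0..t} (\<lambda>s. s * (q s * apply_bcontfun \<xi> s)))" if t: "t \<in> {0..T}" for \<xi> t
  proof -
    have c: "continuous_on {0..t} (\<lambda>s. q s * apply_bcontfun \<xi> s)"
      using continuous_on_subset[OF cont] t by auto
    have "integral {0..t} (\<lambda>s. (t - s) * (q s * apply_bcontfun \<xi> s))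
       = integral {0..t} (\<lambda>s. t * (q s * apply_bcontfun \<xi> s) - s * (q s * apply_bcontfun \<xi> s))"
      by (simp add: left_diff_distrib)
    also have "\<dots> = integral {0..t} (\<lambda>s. t * (q s * apply_bcontfun \<xi> s))
        - integral {0..t} (\<lambda>s. s * (q s * apply_bcontfun \<xi> s))"
      by (rule integral_diff) (intro int continuous_intros c)+
    finally show ?thesis by (simp add: g_def)
  qed
  have gc: "continuous_on {0..T} (g (apply_bcontfun \<xi>))" for \<xi>
  proof -
    have "continuous_on {0..T} (\<lambda>t. a + b * t - (t * integral {0..t} (\<lambda>s. q s * apply_bcontfun \<xi> s)
      - integral {0..t} (\<lambda>s. s * (q s * apply_bcontfun \<xi> s))))"
      by (intro continuous_intros indefinite_integral_continuous_1 int cont)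
    thus ?thesis by (rule continuous_on_eq) (simp add: split)
  qed
  define F where "F \<xi> = Bcontfun (\<lambda>t. g (apply_bcontfun \<xi>) (cl t))" for \<xi>
  have F: "apply_bcontfun (F \<xi>) t = g (apply_bcontfun \<xi>) (cl t)" for \<xi> t
  proof -
    have "continuous_on UNIV (\<lambda>t. g (apply_bcontfun \<xi>) (cl t))"
      by (rule continuous_on_compose2[OF gc clc]) (use cl in auto)
    moreover have "bounded (range (\<lambda>t. g (apply_bcontfun \<xi>) (cl t)))"
      by (rule bounded_subset[OF compact_imp_bounded[OF compact_continuous_image[OF gc]]]) (use cl in auto)
    ultimately show ?thesis unfolding F_def by (simp add: Bcontfun_inverse bcontfun_def)
  qed
  have "\<exists>!\<xi>. F \<xi> = \<xi>"
  proof (rule banach_fix_type[of "1 / 2"])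
    show "\<forall>\<xi> \<zeta>. dist (F \<xi>) (F \<zeta>) \<le> 1 / 2 * dist \<xi> \<zeta>"
    proof (intro allI)
      fix \<xi> \<zeta> :: "real \<Rightarrow>\<^sub>C real"
      show "dist (F \<xi>) (F \<zeta>) \<le> 1 / 2 * dist \<xi> \<zeta>"
      proof (rule dist_bound)
        fix x
        define t where "t = cl x"
        have t: "t \<in> {0..T}" using cl by (simp add: t_def)
        have sub: "continuous_on {0..t} (\<lambda>s. q s * apply_bcontfun \<xi> s)" for \<xi>
          using continuous_on_subset[OF cont] t by auto
        have i: "(\<lambda>s. (t - s) * (q s * apply_bcontfun \<xi> s)) integrable_on {0..t}" for \<xi>
          by (intro int continuous_intros sub)
        have "dist (apply_bcontfun (F \<xi>) x) (apply_bcontfun (F \<zeta>) x)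
          = norm (integral {0..t} (\<lambda>s. (t - s) * (q s * apply_bcontfun \<zeta> s) - (t - s) * (q s * apply_bcontfun \<xi> s)))"
          unfolding F t_def[symmetric] dist_norm g_def integral_diff[OF i i] by simp
        also have "\<dots> \<le> (1 / (2 * T) * dist \<xi> \<zeta>) * measure lborel (cbox 0 t)"
        proof (rule has_integral_bound)
          show "((\<lambda>s. (t - s) * (q s * apply_bcontfun \<zeta> s) - (t - s) * (q s * apply_bcontfun \<xi> s)) has_integral
            integral {0..t} (\<lambda>s. (t - s) * (q s * apply_bcontfun \<zeta> s) - (t - s) * (q s * apply_bcontfun \<xi> s))) (cbox 0 t)"
            using integrable_integral[OF integrable_diff[OF i i]] by simp
          show "0 \<le> 1 / (2 * T) * dist \<xi> \<zeta>" using T by simp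
          fix s assume s: "s \<in> cbox 0 t"
          have "\<bar>t - s\<bar> * \<bar>q s\<bar> \<le> T * \<bar>q s\<bar>" using s t by (intro mult_right_mono) auto
          also have "\<dots> \<le> 1 / (2 * T)" using small[of s] s t T by (simp add: field_simps power2_eq_square)
          finally have "\<bar>t - s\<bar> * \<bar>q s\<bar> * \<bar>apply_bcontfun \<zeta> s - apply_bcontfun \<xi> s\<bar> \<le> 1 / (2 * T) * dist \<xi> \<zeta>"
            using dist_bounded[of \<xi> s \<zeta>] T by (intro mult_mono) (auto simp: dist_real_def abs_minus_commute)
          thus "norm ((t - s) * (q s * apply_bcontfun \<zeta> s) - (t - s) * (q s * apply_bcontfun \<xi> s))
              \<le> 1 / (2 * T) * dist \<xi> \<zeta>"
            by (simp add: abs_mult[symmetric] algebra_simps)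
        qed
        also have "\<dots> \<le> (1 / (2 * T) * dist \<xi> \<zeta>) * T"
          using t T by (intro mult_left_mono) auto
        also have "\<dots> = 1 / 2 * dist \<xi> \<zeta>" using T by simp
        finally show "dist (apply_bcontfun (F \<xi>) x) (apply_bcontfun (F \<zeta>) x) \<le> 1 / 2 * dist \<xi> \<zeta>" .
      qed
    qed
  qed auto
  then obtain \<xi> where \<xi>: "F \<xi> = \<xi>" by blast
  define I where "I t = integral {0..t} (\<lambda>s. q s * apply_bcontfun \<xi> s)" for t
  define J where "J t = integral {0..t} (\<lambda>s. s * (q s * apply_bcontfun \<xi> s))" for t
  have fix1: "apply_bcontfun \<xi> t = a + b * t - (t * I t - J t)" if "t \<in> {0..T}" for t
    using F[of \<xi> t] split[OF that, of \<xi>] cl(2)[OF that] unfolding \<xi> I_def J_def by simp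
  show ?thesis
  proof (rule exI[of _ "apply_bcontfun \<xi>"], rule exI[of _ "\<lambda>t. b - I t"], intro conjI ballI)
    show "apply_bcontfun \<xi> 0 = a" using fix1[of 0] T by (simp add: J_def)
    show "b - I 0 = b" by (simp add: I_def)
    fix t assume t: "t \<in> {0..T}"
    have dI: "(I has_real_derivative q t * apply_bcontfun \<xi> t) (at t within {0..T})"
      unfolding I_def using integral_has_real_derivative[OF cont t] .
    have dJ: "(J has_real_derivative t * (q t * apply_bcontfun \<xi> t)) (at t within {0..T})"
      unfolding J_def by (rule integral_has_real_derivative[OF _ t]) (intro continuous_intros cont)
    show "((\<lambda>t. b - I t) has_real_derivative - q t * apply_bcontfun \<xi> t) (at t within {0..T})"
      by (rule derivative_eq_intros dI refl)+ simp
    have "((\<lambda>t. a + b * t - (t * I t - J t)) has_real_derivative b - I t) (at t within {0..T})"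
      by (rule derivative_eq_intros dI dJ refl)+ simp
    thus "(apply_bcontfun \<xi> has_real_derivative b - I t) (at t within {0..T})"
      by (rule has_field_derivative_transform_within[OF _ zero_less_one t]) (use fix1 in auto)
  qed
qed

section \<open>The variational equation along the axis\<close>

lemma d1_axis: "d1 (\<lambda>x y. y\<^sup>2 * f x y) x 0 = 0"
  by (simp add: d1_def)

context
  fixes f :: "real \<Rightarrow> real \<Rightarrow> real" and U x0
  assumes f: "real_analytic2_on f U" and x0: "(x0, 0) \<in> U"
begin

text \<open>The double series converges unconditionally and may be summed over \<open>j\<close>
  first. This makes \<open>f x y\<close> a power series in \<open>x - x0\<close> with coefficients
  \<open>C i y\<close> that are power series in \<open>y\<close>; \<open>C 0\<close> restricts
  \<open>f\<close> to \<open>x = x0\<close>, and \<open>g\<close> is \<open>C 1\<close>.\<close>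

lemma axis_power_series:
  "\<exists>R>0. \<exists>k g. (\<forall>y. \<bar>y\<bar> < R \<longrightarrow> (\<lambda>j. k j * y ^ j) sums f x0 y) \<and>
    (\<forall>y. \<bar>y\<bar> < R \<longrightarrow> ((\<lambda>x. f x y) has_real_derivative g y) (at x0)) \<and> isCont g 0"
proof -
  have "case (x0, 0) of (x0, y0) \<Rightarrow> \<exists>r>0. \<exists>c :: nat \<Rightarrow> nat \<Rightarrow> real. \<forall>x y. \<bar>x - x0\<bar> < r \<and> \<bar>y - y0\<bar> < r \<longrightarrow>
        ((\<lambda>(i, j). c i j * (x - x0) ^ i * (y - y0) ^ j) has_sum f x y) UNIV"
    using f x0 unfolding real_analytic2_on_def by blast
  then obtain R and k :: "nat \<Rightarrow> nat \<Rightarrow> real" where R: "R > 0"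
    and k': "\<forall>x y. \<bar>x - x0\<bar> < R \<and> \<bar>y - 0\<bar> < R \<longrightarrow>
        ((\<lambda>(i, j). k i j * (x - x0) ^ i * (y - 0) ^ j) has_sum f x y) UNIV" by auto
  have k: "((\<lambda>(i, j). k i j * (x - x0) ^ i * y ^ j) has_sum f x y) UNIV"
    if "\<bar>x - x0\<bar> < R" "\<bar>y\<bar> < R" for x y
    using k'[rule_format, of x y] that by simp
  \<comment> \<open>Convergence of a single row: evaluate at \<open>x - x0 = R / 2\<close> and
    divide by the power of \<open>R / 2\<close>.\<close>
  have summ: "(\<lambda>j. k i j * y ^ j) summable_on UNIV" if y: "\<bar>y\<bar> < R" for i y
  proof -
    define h where "h = R / 2"
    have h: "h > 0" "\<bar>(x0 + h) - x0\<bar> < R" using R by (auto simp: h_def)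
    have "(\<lambda>(i, j). k i j * h ^ i * y ^ j) summable_on (UNIV \<times> UNIV)"
      using has_sum_imp_summable[OF k[OF h(2) y]] by simp
    from summable_on_SigmaD1[OF this, of i]
    have "(\<lambda>j. inverse (h ^ i) * (k i j * h ^ i * y ^ j)) summable_on UNIV"
      by (intro summable_on_cmult_right) simp
    thus ?thesis using h(1) by (simp add: field_simps)
  qed
  define C where "C i y = (\<Sum>\<^sub>\<infinity>j. k i j * y ^ j)" for i y
  have Csum: "((\<lambda>j. k i j * y ^ j) has_sum C i y) UNIV" if "\<bar>y\<bar> < R" for i y
    unfolding C_def using summ[OF that] by (rule has_sum_infsum)
  have fx: "((\<lambda>i. C i y * (x - x0) ^ i) has_sum f x y) UNIV" if "\<bar>x - x0\<bar> < R" and y: "\<bar>y\<bar> < R" for x y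
  proof (rule has_sum_SigmaD[where f = "\<lambda>(i, j). k i j * (x - x0) ^ i * y ^ j" and A = UNIV and B = "\<lambda>_. UNIV"])
    show "((\<lambda>(i, j). k i j * (x - x0) ^ i * y ^ j) has_sum f x y) (UNIV \<times> UNIV)"
      using k[OF that] by simp
    fix i
    show "((\<lambda>j. case (i, j) of (i, j) \<Rightarrow> k i j * (x - x0) ^ i * y ^ j) has_sum C i y * (x - x0) ^ i) UNIV"
      using has_sum_cmult_left[OF Csum[OF y], of i "(x - x0) ^ i"] by (simp add: mult_ac)
  qed
  have 1: "(\<lambda>j. k 0 j * y ^ j) sums f x0 y" if y: "\<bar>y\<bar> < R" for y
  proof -
    have "(\<lambda>i. C i y * (x0 - x0) ^ i) sums f x0 y" using has_sum_imp_sums[OF fx[OF _ y, of x0]] R by simp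
    moreover have "(\<lambda>i. C i y * (x0 - x0) ^ i) sums C 0 y" using powser_sums_zero[of "\<lambda>i. C i y"] by simp
    ultimately have "f x0 y = C 0 y" using sums_unique2 by blast
    thus ?thesis using has_sum_imp_sums[OF Csum[OF y, of 0]] by simp
  qed
  have 2: "((\<lambda>x. f x y) has_real_derivative C 1 y) (at x0)" if y: "\<bar>y\<bar> < R" for y
  proof -
    have s: "(\<lambda>i. C i y * h ^ i) sums f (x0 + h) y" if "\<bar>h\<bar> < R" for h
      using has_sum_imp_sums[OF fx[OF _ y, of "x0 + h"]] that by simp
    have "((\<lambda>h. \<Sum>i. C i y * h ^ i) has_real_derivative (\<Sum>i. diffs (\<lambda>i. C i y) i * 0 ^ i)) (at 0)"
      by (rule termdiffs_strong'[of R]) (use s R sums_summable in \<open>auto simp: real_norm_def\<close>)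
    also have "(\<Sum>i. diffs (\<lambda>i. C i y) i * 0 ^ i) = C 1 y" unfolding powser_zero by (simp add: diffs_def)
    finally have "((\<lambda>h. f (x0 + h) y) has_real_derivative C 1 y) (at 0)"
    proof (rule has_field_derivative_transform_within_open[of _ _ _ "{-R<..<R}"])
      fix h assume "h \<in> {-R<..<R}"
      thus "(\<Sum>i. C i y * h ^ i) = f (x0 + h) y" using s[of h] sums_unique by force
    qed (use R in auto)
    thus ?thesis using DERIV_shift[of "\<lambda>x. f x y" _ 0 x0] by (simp add: add.commute)
  qed
  have 3: "isCont (C 1) 0"
  proof -
    have s: "(\<lambda>j. k 1 j * y ^ j) sums C 1 y" if "\<bar>y\<bar> < R" for y
      using has_sum_imp_sums[OF Csum[OF that]] .
    have "isCont (\<lambda>y. \<Sum>j. k 1 j * y ^ j) 0"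
      by (rule isCont_powser[of _ "R / 2"]) (use s[of "R/2"] R sums_summable in auto)
    moreover have "eventually (\<lambda>y. (\<Sum>j. k 1 j * y ^ j) = C 1 y) (nhds 0)"
    proof (rule eventually_mono)
      show "eventually (\<lambda>y. y \<in> {-R<..<R}) (nhds 0)" using R by (intro eventually_nhds_in_open) auto
      show "(\<Sum>j. k 1 j * y ^ j) = C 1 y" if "y \<in> {-R<..<R}" for y
        by (rule sums_unique[symmetric], rule s) (use that in auto)
    qed
    ultimately show ?thesis using isCont_cong by fast
  qed
  show ?thesis using R 1 2 3 by blast
qed

lemma axis_isCont: "isCont (\<lambda>x. f x 0) x0"
proof -
  obtain R g where "R > 0" "\<And>y. \<bar>y\<bar> < R \<Longrightarrow> ((\<lambda>x. f x y) has_real_derivative g y) (at x0)"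
    using axis_power_series by blast
  hence "((\<lambda>x. f x 0) has_real_derivative g 0) (at x0)" by simp
  thus ?thesis by (rule DERIV_isCont)
qed

lemma d2_axis:
  shows "d2 (\<lambda>x y. y\<^sup>2 * f x y) x0 0 = 0" "d2 (d2 (\<lambda>x y. y\<^sup>2 * f x y)) x0 0 = 2 * f x0 0"
proof -
  obtain R k where R: "R > 0" and k: "\<And>y. \<bar>y\<bar> < R \<Longrightarrow> (\<lambda>j. k j * y ^ j) sums f x0 y"
    using axis_power_series by blast
  define F where "F y = (\<Sum>j. k j * y ^ j)" for y :: real
  define F1 where "F1 y = (\<Sum>j. diffs k j * y ^ j)" for y :: real
  have sm: "summable (\<lambda>j. k j * y ^ j)" if "norm y < R" for y
    using k[of y] that sums_summable by auto
  have Ff: "F y = f x0 y" if "\<bar>y\<bar> < R" for y unfolding F_def using k[OF that] sums_unique by force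
  have dF: "(F has_real_derivative F1 y) (at y)" if "\<bar>y\<bar> < R" for y
    unfolding F_def F1_def by (rule termdiffs_strong'[of R]) (use sm that in auto)
  have sm1: "summable (\<lambda>j. diffs k j * y ^ j)" if "norm y < R" for y
    by (rule termdiff_converges[of _ R]) (use sm that in auto)
  have "(F1 has_real_derivative (\<Sum>j. diffs (diffs k) j * 0 ^ j)) (at 0)"
    unfolding F1_def by (rule termdiffs_strong'[of R]) (use sm1 R in auto)
  then obtain F2 where dF1: "(F1 has_real_derivative F2) (at 0)" by blast
  have dV: "d2 (\<lambda>x y. y\<^sup>2 * f x y) x0 y = 2 * y * F y + y\<^sup>2 * F1 y" if y: "\<bar>y\<bar> < R" for y
    unfolding d2_def
  proof (rule DERIV_imp_deriv)
    have "((\<lambda>s. s\<^sup>2 * F s) has_real_derivative 2 * y * F y + y\<^sup>2 * F1 y) (at y)"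
      by (rule derivative_eq_intros dF[OF y] refl)+ (simp add: mult_ac)
    thus "((\<lambda>s. s\<^sup>2 * f x0 s) has_real_derivative 2 * y * F y + y\<^sup>2 * F1 y) (at y)"
      by (rule has_field_derivative_transform_within_open[of _ _ _ "{-R<..<R}"]) (use Ff y in auto)
  qed
  show "d2 (\<lambda>x y. y\<^sup>2 * f x y) x0 0 = 0" using dV[of 0] R by simp
  have "((\<lambda>y. 2 * y * F y + y\<^sup>2 * F1 y) has_real_derivative 2 * F 0) (at 0)"
    by (rule derivative_eq_intros dF dF1 refl | use R in simp)+
  hence "(d2 (\<lambda>x y. y\<^sup>2 * f x y) x0 has_real_derivative 2 * F 0) (at 0)"
    by (rule has_field_derivative_transform_within_open[of _ _ _ "{-R<..<R}"]) (use dV R in auto)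
  thus "d2 (d2 (\<lambda>x y. y\<^sup>2 * f x y)) x0 0 = 2 * f x0 0"
    unfolding d2_def[of "d2 _"] using Ff[of 0] R by (simp add: DERIV_imp_deriv)
qed

text \<open>On \<open>x = x0\<close> the derivative in \<open>x\<close> is \<open>y^2 g y\<close>
  near the axis; with \<open>g\<close> continuous at \<open>0\<close> its difference quotient
  \<open>y g y\<close> tends to \<open>0\<close>.\<close>

lemma d12_axis: "d2 (d1 (\<lambda>x y. y\<^sup>2 * f x y)) x0 0 = 0"
proof -
  obtain R g where R: "R > 0" and g: "\<And>y. \<bar>y\<bar> < R \<Longrightarrow> ((\<lambda>x. f x y) has_real_derivative g y) (at x0)"
    "isCont g 0" using axis_power_series by blast
  have d: "d1 (\<lambda>x y. y\<^sup>2 * f x y) x0 y = y\<^sup>2 * g y" if "\<bar>y\<bar> < R" for y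
    unfolding d1_def by (rule DERIV_imp_deriv) (rule DERIV_cmult g that)+
  have "((\<lambda>y. y\<^sup>2 * g y) has_real_derivative 0) (at 0)"
    unfolding DERIV_def
  proof (rule Lim_transform_eventually)
    have "(g \<longlongrightarrow> g 0) (at 0)" using g(2) by (simp add: isCont_def)
    from tendsto_mult[OF tendsto_ident_at this] show "((\<lambda>h. h * g h) \<longlongrightarrow> 0) (at 0)" by simp
    show "\<forall>\<^sub>F h in at 0. h * g h = ((0 + h)\<^sup>2 * g (0 + h) - 0\<^sup>2 * g 0) / h"
      by (auto simp: eventually_at_filter power2_eq_square)
  qed
  hence "(d1 (\<lambda>x y. y\<^sup>2 * f x y) x0 has_real_derivative 0) (at 0)"
    by (rule has_field_derivative_transform_within_open[of _ _ _ "{-R<..<R}"]) (use d R in auto)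
  thus ?thesis unfolding d2_def by (rule DERIV_imp_deriv)
qed

end

text \<open>Only the second derivative in \<open>y\<close> survives, so the variational equation
  splits into free motion along the axis and the normal equation.\<close>

lemma hessian_axis:
  assumes "real_analytic2_on f U" "open U" "(x0, 0) \<in> U"
  defines "V \<equiv> \<lambda>x y. y\<^sup>2 * f x y"
  shows "hessian V x0 0 $ i $ j = (if i = 2 \<and> j = 2 then 2 * f x0 0 else 0)"
proof -
  have "open ((\<lambda>x. (x, 0)) -` U)" using assms(2) by (intro open_vimage continuous_intros)
  moreover have "x0 \<in> (\<lambda>x. (x, 0)) -` U" using assms(3) by simp
  ultimately have "eventually (\<lambda>x. (x, 0) \<in> U) (nhds x0)"
    by (metis (mono_tags, lifting) eventually_nhds vimageD)
  hence "eventually (\<lambda>x. d2 V x 0 = 0) (nhds x0)"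
    by eventually_elim (unfold V_def, rule d2_axis[OF assms(1)])
  hence "deriv (\<lambda>x. d2 V x 0) x0 = deriv (\<lambda>_. 0) x0" by (intro deriv_cong_ev) auto
  hence "d1 (d2 V) x0 0 = 0" by (simp add: d1_def)
  moreover have "d1 (d1 V) x0 0 = 0" unfolding d1_def[of "d1 V"] by (simp only: V_def d1_axis deriv_const)
  ultimately show ?thesis
    using d12_axis[OF assms(1,3)] d2_axis(2)[OF assms(1,3)] exhaust_2[of i] exhaust_2[of j]
    unfolding hessian_def V_def by auto
qed

lemma has_vector_derivative_matrix:
  fixes F :: "real \<Rightarrow> real^'n^'m"
  assumes "\<And>i j. ((\<lambda>t. F t $ i $ j) has_real_derivative F' $ i $ j) (at t within S)"
  shows "(F has_vector_derivative F') (at t within S)"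
  unfolding has_vector_derivative_def
proof (subst has_derivative_componentwise_within, rule ballI)
  fix b :: "real^'n^'m" assume "b \<in> Basis"
  then obtain i u where u: "b = axis i u" "u \<in> Basis" unfolding Basis_vec_def by blast
  then obtain j v where "u = axis j v" "v \<in> Basis" unfolding Basis_vec_def by blast
  hence b: "b = axis i (axis j 1)" using u by simp
  have in1: "M \<bullet> b = M $ i $ j" for M :: "real^'n^'m" by (simp add: b inner_axis)
  show "((\<lambda>x. F x \<bullet> b) has_derivative (\<lambda>x. x *\<^sub>R F' \<bullet> b)) (at t within S)"
    using assms[of i j] unfolding has_field_derivative_def in1 vector_scaleR_component real_scaleR_def
    by (rule has_derivative_eq_rhs) (simp add: fun_eq_iff)
qed

lemma sum_UNIV_Plus:
  fixes g :: "'a::finite + 'b::finite \<Rightarrow> 'c::comm_monoid_add"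
  shows "sum g UNIV = (\<Sum>a\<in>UNIV. g (Inl a)) + (\<Sum>b\<in>UNIV. g (Inr b))"
  by (simp add: UNIV_Plus_UNIV[symmetric] sum.Plus del: UNIV_Plus_UNIV)

text \<open>The free path with momentum \<open>s\<close> is followed for a short time in which it
  stays in the domain, the normal equation is solved by contraction, and no focal point occurs.
  \<open>C\<close> and \<open>S\<close> are the solutions with initial data \<open>(1, 0)\<close>
  and \<open>(0, 1)\<close>; \<open>S\<close> is the \<phi> of the conclusion.\<close>

lemma wkb_integrable_axis:
  fixes f :: "real \<Rightarrow> real \<Rightarrow> real" and s hbar x0 :: real
  assumes hbar: "hbar > 0" and U: "open U" "real_analytic2_on f U" "(x0, 0) \<in> U" and s: "s > 0"
    and int: "wkb_integrable hbar U (\<lambda>x y. y\<^sup>2 * f x y)"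
  defines "\<rho> \<equiv> \<lambda>t. - 2 * f (x0 + s * t) 0"
  shows "\<exists>(c::real) r (A :: 2 + 2 \<Rightarrow> 2 + 2 \<Rightarrow> complex \<Rightarrow> complex) K \<phi> \<phi>' k0.
    r > 0 \<and> c - r \<ge> 0 \<and> (\<forall>t\<in>{c-r<..<c+r}. (x0 + s * t, 0) \<in> U) \<and>
    (\<forall>i j. A i j holomorphic_on ball (of_real c) r) \<and> K holomorphic_on ball (of_real c) r \<and>
    (\<forall>i j. (\<forall>t\<in>{c-r<..<c+r}. A i j (of_real t) = 0) \<or> (\<forall>t\<in>{c-r<..<c+r}. A i j (of_real t) = 1)
      \<or> (\<forall>t\<in>{c-r<..<c+r}. A i j (of_real t) = of_real (\<rho> t))) \<and>
    (\<forall>t\<in>{c-r<..<c+r}. A (Inr 2) (Inl 2) (of_real t) = of_real (\<rho> t) \<and> \<phi> t > 0 \<and>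
       (\<phi> has_real_derivative \<phi>' t) (at t) \<and> (\<phi>' has_real_derivative \<rho> t * \<phi> t) (at t) \<and>
       K (of_real t) = k0 * (1 / of_real (sqrt (t * \<phi> t)))
          * exp (\<i> * of_real (s\<^sup>2 / (2 * hbar)) * of_real t)) \<and>
    k0 \<noteq> 0 \<and>
    liouvillian_over (ball (of_real c) r) (diff_field_gen (ball (of_real c) r) {A i j | i j. True}) K"
proof -
  define V where "V = (\<lambda>x y. y\<^sup>2 * f x y)"
  have "open ((\<lambda>x. (x, 0)) -` U)" using U(1) by (intro open_vimage continuous_intros)
  moreover have "x0 \<in> (\<lambda>x. (x, 0)) -` U" using U(3) by simp
  ultimately obtain e where e: "e > 0" "ball x0 e \<subseteq> (\<lambda>x. (x, 0)) -` U"
    using open_contains_ball by blast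
  have inU: "(x, 0) \<in> U" if "\<bar>x - x0\<bar> < e" for x
    using e(2) that by (auto simp: dist_real_def abs_minus_commute)
  define T0 where "T0 = e / (2 * s)"
  have T0: "T0 > 0" using e s by (simp add: T0_def)
  have pathU: "(x0 + s * t, 0) \<in> U" if "t \<in> {0..T0}" for t
  proof (rule inU)
    have "s * t \<le> s * T0" using that s by (intro mult_left_mono) auto
    hence "s * t < e" using e s by (simp add: T0_def)
    moreover have "s * t \<ge> 0" using that s by simp
    ultimately show "\<bar>x0 + s * t - x0\<bar> < e" by simp
  qed
  define q where "q t = 2 * f (x0 + s * t) 0" for t
  have q: "continuous_on {0..T0} q"
    unfolding continuous_on_eq_continuous_within q_def
  proof
    fix t assume t: "t \<in> {0..T0}"
    have 1: "isCont (\<lambda>x. f x 0) (x0 + s * t)" by (rule axis_isCont[OF U(2) pathU[OF t]])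
    have 2: "isCont (\<lambda>t. x0 + s * t) t" by (intro continuous_intros)
    have "isCont (\<lambda>t. f (x0 + s * t) 0) t" by (rule isCont_o2[OF 2 1])
    hence "isCont (\<lambda>t. 2 * f (x0 + s * t) 0) t" by (rule continuous_mult_left)
    thus "continuous (at t within {0..T0}) (\<lambda>t. 2 * f (x0 + s * t) 0)"
      by (rule continuous_at_imp_continuous_at_within)
  qed
  obtain B where B: "B > 0" "\<And>t. t \<in> {0..T0} \<Longrightarrow> \<bar>q t\<bar> \<le> B"
    using compact_imp_bounded[OF compact_continuous_image[OF q]] unfolding bounded_pos by auto
  \<comment> \<open>\<open>T1 \<le> 1\<close> and \<open>T1 * B \<le> 1 / 2\<close> together give
    the smallness required by \<open>linear_ode_second_order\<close>.\<close>
  define T1 where "T1 = min T0 (min 1 (1 / (2 * B)))"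
  have T1: "T1 > 0" "T1 \<le> T0" "T1 \<le> 1" using T0 B(1) by (auto simp: T1_def)
  have "T1 \<le> 1 / (2 * B)" by (simp add: T1_def)
  hence T1B: "T1 * B \<le> 1 / 2" using B(1) by (simp add: field_simps)
  have "T1\<^sup>2 * \<bar>q t\<bar> \<le> 1 / 2" if "t \<in> {0..T1}" for t
  proof -
    have "T1\<^sup>2 * \<bar>q t\<bar> \<le> (T1 * 1) * B" unfolding power2_eq_square
      using T1 B(2)[of t] that by (intro mult_mono) auto
    thus ?thesis using T1B by simp
  qed
  note ode = linear_ode_second_order[OF T1(1) continuous_on_subset[OF q] this]
  obtain C C' where C: "C 0 = 1" "C' 0 = 0" "\<And>t. t \<in> {0..T1} \<Longrightarrow> (C has_real_derivative C' t) (at t within {0..T1})"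
    "\<And>t. t \<in> {0..T1} \<Longrightarrow> (C' has_real_derivative - q t * C t) (at t within {0..T1})"
    using ode[of 1 0] T1 by auto
  obtain S S' where S: "S 0 = 0" "S' 0 = 1" "\<And>t. t \<in> {0..T1} \<Longrightarrow> (S has_real_derivative S' t) (at t within {0..T1})"
    "\<And>t. t \<in> {0..T1} \<Longrightarrow> (S' has_real_derivative - q t * S t) (at t within {0..T1})"
    using ode[of 0 1] T1 by auto
  have "continuous (at 0 within {0..T1}) S'" using S(4)[of 0] T1 DERIV_continuous by auto
  hence "\<forall>\<^sub>F t in at 0 within {0..T1}. S' t > 0"
    unfolding continuous_within using order_tendstoD(1)[of S' "S' 0" _ 0] S(2) by simp
  then obtain \<delta> where \<delta>: "\<delta> > 0" "\<And>t. t \<in> {0..T1} \<Longrightarrow> t \<noteq> 0 \<Longrightarrow> \<bar>t\<bar> < \<delta> \<Longrightarrow> S' t > 0"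
    unfolding eventually_at by (auto simp: dist_real_def)
  \<comment> \<open>Up to \<open>T\<close> the derivative \<open>S'\<close> stays positive. So
    \<open>S > 0\<close> on \<open>{0<..T}\<close>, and the determinant \<open>t * S t\<close> has
    no zero there.\<close>
  define T where "T = min T1 (\<delta> / 2)"
  have T: "T > 0" "T \<le> T1" "T < \<delta>" using \<delta>(1) T1 by (auto simp: T_def)
  have sub: "{0..T} \<subseteq> {0..T1}" using T by auto
  have Cd: "(C has_real_derivative C' t) (at t within {0..T})" "(C' has_real_derivative - q t * C t) (at t within {0..T})"
    and Sd: "(S has_real_derivative S' t) (at t within {0..T})" "(S' has_real_derivative - q t * S t) (at t within {0..T})"
    if "t \<in> {0..T}" for t
    using C(3,4)[of t] S(3,4)[of t] that sub DERIV_subset[OF _ sub] by auto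
  have Spos: "S t > 0" if t: "t \<in> {0<..T}" for t
  proof -
    have "\<exists>z\<in>{0<..<t}. S t - S 0 = (t - 0) * S' z"
    proof (rule mvt_simple[where f' = "\<lambda>x h. h * S' x"])
      show "0 < t" using t by simp
      fix x assume x: "0 \<le> x" "x \<le> t"
      have "(S has_real_derivative S' x) (at x within {0..t})"
        using DERIV_subset[OF Sd(1)[of x]] x t by auto
      thus "(S has_derivative (\<lambda>h. h * S' x)) (at x within {0..t})"
        by (simp add: has_field_derivative_def mult.commute[of _ "S' x"])
    qed
    then obtain z where z: "z \<in> {0<..<t}" "S t = t * S' z" using S(1) by auto
    have "S' z > 0" using \<delta>(2)[of z] z t T by auto
    thus ?thesis using z t by simp
  qed
  have index: "k = Inl 1 \<or> k = Inl 2 \<or> k = Inr 1 \<or> k = Inr 2" for k :: "2 + 2"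
    by (cases k) (use exhaust_2 in auto)
  define \<Phi> :: "real \<Rightarrow> real^(2 + 2)^(2 + 2)" where "\<Phi> t = (\<chi> i j. case (i, j) of
      (Inl a, Inl b) \<Rightarrow> (if a = b then if a = 2 then C t else 1 else 0)
    | (Inl a, Inr b) \<Rightarrow> (if a = b then if a = 2 then S t else t else 0)
    | (Inr a, Inl b) \<Rightarrow> (if a = b then if a = 2 then C' t else 0 else 0)
    | (Inr a, Inr b) \<Rightarrow> (if a = b then if a = 2 then S' t else 1 else 0))" for t
  define x where "x t = x0 + s * t" for t
  have xU: "(x t, 0) \<in> U" if "t \<in> {0..T}" for t
    unfolding x_def using pathU that T T1 by auto
  have hess: "hessian V (x t) 0 $ i $ j = (if i = 2 \<and> j = 2 then q t else 0)" if "t \<in> {0..T}" for t i j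
    unfolding V_def hessian_axis[OF U(2,1) xU[OF that]] by (simp add: q_def x_def)
  have vm: "variational_matrix V (x t) 0 $ i $ j = (case (i, j) of (Inl a, Inr b) \<Rightarrow> (if a = b then 1 else 0)
     | (Inr a, Inl b) \<Rightarrow> (if a = 2 \<and> b = 2 then - q t else 0) | _ \<Rightarrow> 0)" if "t \<in> {0..T}" for t i j
    unfolding variational_matrix_def using hess[OF that] by (simp split: sum.splits)
  have phase: "phase_curve U V T x (\<lambda>_. s) (\<lambda>_. 0) (\<lambda>_. 0)"
    unfolding phase_curve_def
  proof (intro ballI conjI)
    fix t assume t: "t \<in> {0..T}"
    show "(x t, 0) \<in> U" by (rule xU[OF t])
    show "(x has_real_derivative s) (at t within {0..T})"
      unfolding x_def by (rule derivative_eq_intros refl | simp)+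
    show "((\<lambda>_. s) has_real_derivative - d1 V (x t) 0) (at t within {0..T})"
      unfolding V_def d1_axis by simp
    show "((\<lambda>_. 0) has_real_derivative - d2 V (x t) 0) (at t within {0..T})"
      unfolding V_def d2_axis(1)[OF U(2) xU[OF t]] by simp
  qed simp
  have fund: "fundamental_matrix V T x (\<lambda>_. 0) \<Phi>"
    unfolding fundamental_matrix_def
  proof (intro conjI ballI)
    show "\<Phi> 0 = mat 1"
      unfolding vec_eq_iff \<Phi>_def mat_def using C(1,2) S(1,2) by (auto split: sum.splits)
    fix t assume t: "t \<in> {0..T}"
    show "(\<Phi> has_vector_derivative variational_matrix V (x t) 0 ** \<Phi> t) (at t within {0..T})"
    proof (rule has_vector_derivative_matrix)
      fix i j :: "2 + 2"
      have prod: "(variational_matrix V (x t) 0 ** \<Phi> t) $ i $ j =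
        (case i of Inl a \<Rightarrow> \<Phi> t $ Inr a $ j | Inr a \<Rightarrow> (if a = 2 then - q t * \<Phi> t $ Inl 2 $ j else 0))"
        unfolding matrix_matrix_mult_def using exhaust_2
        by (auto simp: sum_UNIV_Plus vm[OF t] sum_2 split: sum.splits)
      show "((\<lambda>t. \<Phi> t $ i $ j) has_real_derivative (variational_matrix V (x t) 0 ** \<Phi> t) $ i $ j) (at t within {0..T})"
        unfolding prod using index[of i] index[of j] Cd[OF t] Sd[OF t]
        by (elim disjE) (simp_all add: \<Phi>_def)
    qed
  qed
  have det: "det (morette_block (\<Phi> t)) = t * S t" for t
    by (simp add: det_2 morette_block_def \<Phi>_def)
  have act: "action V x (\<lambda>_. s) (\<lambda>_. 0) (\<lambda>_. 0) t = s\<^sup>2 / 2 * t" if "t \<ge> 0" for t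
  proof -
    have "deriv x u = s" for u
      unfolding x_def by (rule DERIV_imp_deriv) (rule derivative_eq_intros refl | simp)+
    hence "action V x (\<lambda>_. s) (\<lambda>_. 0) (\<lambda>_. 0) t = integral {0..t} (\<lambda>_. s\<^sup>2 / 2)"
      unfolding action_def hamiltonian_def V_def by (simp add: power2_eq_square)
    also have "\<dots> = s\<^sup>2 / 2 * t" using that by simp
    finally show ?thesis .
  qed
  have "\<forall>t\<in>{0<..T}. det (morette_block (\<Phi> t)) \<noteq> 0"
    unfolding det using Spos by fastforce
  hence "wkb_liouvillian hbar V T x (\<lambda>_. s) (\<lambda>_. 0) (\<lambda>_. 0) \<Phi>"
    using int T(1) phase fund unfolding wkb_integrable_def V_def[symmetric] by blast
  then obtain c r and A :: "2 + 2 \<Rightarrow> 2 + 2 \<Rightarrow> complex \<Rightarrow> complex" and K where r: "0 < r" "{c-r<..<c+r} \<subseteq> {0<..<T}"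
    and hol: "\<forall>i j. A i j holomorphic_on ball (of_real c) r" "K holomorphic_on ball (of_real c) r"
    and AK: "\<And>t. t \<in> {c-r<..<c+r} \<Longrightarrow>
           (\<forall>i j. A i j (of_real t) = of_real (variational_matrix V (x t) 0 $ i $ j)) \<and>
           K (of_real t) = K_WKB hbar V x (\<lambda>_. s) (\<lambda>_. 0) (\<lambda>_. 0) \<Phi> t"
    and liouv: "liouvillian_over (ball (of_real c) r) (diff_field_gen (ball (of_real c) r) {A i j | i j. True}) K"
    unfolding wkb_liouvillian_def by auto
  have I: "t \<in> {0..T}" "t > 0" "t < T" if "t \<in> {c-r<..<c+r}" for t using r(2) that by auto
  have cr: "c - r \<ge> 0"
  proof (rule ccontr)
    assume "\<not> c - r \<ge> 0"
    hence "c - r < min 0 (c + r)" using r(1) I(2)[of c] by auto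
    then obtain t where "c - r < t" "t < min 0 (c + r)" using dense by blast
    thus False using I(2)[of t] by auto
  qed
  have \<rho>: "\<rho> t = - q t" for t by (simp add: \<rho>_def q_def)
  have Aval: "A i j (of_real t) = of_real (case (i, j) of (Inl a, Inr b) \<Rightarrow> (if a = b then 1 else 0)
     | (Inr a, Inl b) \<Rightarrow> (if a = 2 \<and> b = 2 then \<rho> t else 0) | _ \<Rightarrow> 0)" if "t \<in> {c-r<..<c+r}" for t i j
    using AK[OF that] vm[OF I(1)[OF that]] unfolding \<rho> by presburger
  have tri: "(\<forall>t\<in>{c-r<..<c+r}. A i j (of_real t) = 0) \<or> (\<forall>t\<in>{c-r<..<c+r}. A i j (of_real t) = 1)
      \<or> (\<forall>t\<in>{c-r<..<c+r}. A i j (of_real t) = of_real (\<rho> t))" for i j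
    using Aval[of _ i j] by (cases i; cases j; auto)
  define k0 where "k0 = 1 / (2 * complex_of_real pi * \<i> * of_real hbar)"
  have pt: "A (Inr 2) (Inl 2) (of_real t) = of_real (\<rho> t) \<and> S t > 0 \<and>
       (S has_real_derivative S' t) (at t) \<and> (S' has_real_derivative \<rho> t * S t) (at t) \<and>
       K (of_real t) = k0 * (1 / of_real (sqrt (t * S t)))
          * exp (\<i> * of_real (s\<^sup>2 / (2 * hbar)) * of_real t)" if t: "t \<in> {c-r<..<c+r}" for t
  proof (intro conjI)
    show "A (Inr 2) (Inl 2) (of_real t) = of_real (\<rho> t)" using Aval[OF t] by simp
    show "S t > 0" using Spos I[OF t] by auto
    have in0: "t \<in> interior {0..T}" using I[OF t] by simp
    show "(S has_real_derivative S' t) (at t)" "(S' has_real_derivative \<rho> t * S t) (at t)"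
      using Sd[OF I(1)[OF t]] at_within_interior[OF in0] unfolding \<rho> by auto
    have "\<i> / of_real hbar * of_real (s\<^sup>2 / 2 * t) = \<i> * of_real (s\<^sup>2 / (2 * hbar)) * complex_of_real t"
      using hbar by (simp add: field_simps)
    thus "K (of_real t) = k0 * (1 / of_real (sqrt (t * S t)))
          * exp (\<i> * of_real (s\<^sup>2 / (2 * hbar)) * of_real t)"
      using AK[OF t] act[of t] I[OF t] unfolding K_WKB_def det k0_def by auto
  qed
  have "k0 \<noteq> 0" using hbar by (simp add: k0_def)
  moreover have "\<forall>t\<in>{c-r<..<c+r}. (x0 + s * t, 0) \<in> U" using xU I(1) unfolding x_def by blast
  ultimately show ?thesis
    using r(1) cr hol tri pt liouv
    by (intro exI[of _ c] exI[of _ r] exI[of _ A] exI[of _ K] exI[of _ S] exI[of _ S'] exI[of _ k0] conjI) blast+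
qed

section \<open>The Weierstrass function\<close>

text \<open>The exponent is half of the 3 in \<open>1 / norm w ^ 3\<close>, because
  \<open>norm_lat_bound\<close> estimates the squared norm by a product of two one-variable
  factors.\<close>

lemma summable_on_int_powr:
  "(\<lambda>m::int. (1 + \<bar>real_of_int m\<bar>) powr (- (3/2))) summable_on UNIV"
proof -
  let ?g = "\<lambda>m::int. (1 + \<bar>real_of_int m\<bar>) powr (- (3/2))"
  have "summable (\<lambda>n. real (Suc n) powr (- (3/2)))"
    using summable_real_powr_iff[of "- (3/2)"] by (subst summable_Suc_iff) simp
  hence s: "(\<lambda>n. real (Suc n) powr (- (3/2))) summable_on UNIV"
    by (intro norm_summable_imp_summable_on) simp
  have "?g summable_on range int"
    using s by (subst summable_on_reindex) (auto simp: o_def add.commute)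
  moreover have "?g summable_on range (\<lambda>n. - int n)"
    using s by (subst summable_on_reindex) (auto simp: o_def add.commute inj_on_def)
  moreover have "UNIV = range int \<union> range (\<lambda>n. - int n)"
  proof -
    have "m \<in> range int \<union> range (\<lambda>n. - int n)" for m
    proof (cases "m \<ge> 0")
      case True
      thus ?thesis using nonneg_int_cases by blast
    next
      case False
      hence "m = - int (nat (- m))" by simp
      thus ?thesis by blast
    qed
    thus ?thesis by blast
  qed
  ultimately show ?thesis using summable_on_union by metis
qed

context
  fixes \<omega>1 \<omega>3 :: complex
  assumes \<omega>: "\<omega>1 \<noteq> 0" "Im \<omega>1 = 0" "\<omega>3 \<noteq> 0" "Re \<omega>3 = 0"
begin

definition lat :: "int \<times> int \<Rightarrow> complex" where
  "lat = (\<lambda>(m, n). 2 * of_int m * \<omega>1 + 2 * of_int n * \<omega>3)"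

lemma re_im_nz: "Re \<omega>1 \<noteq> 0" "Im \<omega>3 \<noteq> 0"
  using \<omega> by (auto simp: complex_eq_iff)

lemma lat_Re_Im: "Re (lat (m, n)) = 2 * m * Re \<omega>1" "Im (lat (m, n)) = 2 * n * Im \<omega>3"
  using \<omega> by (auto simp: lat_def)

lemma inj_lat: "inj lat"
proof (rule injI)
  fix x y assume eq: "lat x = lat y"
  obtain m n m' n' where xy: "x = (m, n)" "y = (m', n')" by (cases x, cases y)
  show "x = y" using eq re_im_nz unfolding xy by (auto simp: complex_eq_iff lat_Re_Im)
qed

lemma period_lattice_eq: "period_lattice \<omega>1 \<omega>3 = range lat"
  by (auto simp: period_lattice_def lat_def image_iff)

lemma period_lattice_minus_0: "period_lattice \<omega>1 \<omega>3 - {0} = lat ` (UNIV - {(0, 0)})"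
proof -
  have "lat (0, 0) = 0" by (simp add: lat_def)
  hence "lat x = 0 \<longleftrightarrow> x = (0, 0)" for x using inj_eq[OF inj_lat, of x "(0, 0)"] by simp
  hence "{x. lat x \<noteq> 0} = UNIV - {(0, 0)}" by auto
  moreover have "range lat - {0} = lat ` {x. lat x \<noteq> 0}" by auto
  ultimately show ?thesis unfolding period_lattice_eq by simp
qed

text \<open>The product form lets the lattice sum be compared with a product of two simple sums. The
  constant comes from \<open>(1 + x) (1 + y) \<le> 3 (x^2 + y^2)\<close> for
  \<open>x^2 + y^2 \<ge> 1\<close>, and from the factors 2 in the real and imaginary parts of
  lattice points.\<close>

lemma norm_lat_bound:
  obtains k where "k > 0" "\<And>m n. (m, n) \<noteq> (0, 0) \<Longrightarrow>
    k * ((1 + \<bar>real_of_int m\<bar>) * (1 + \<bar>real_of_int n\<bar>)) \<le> (norm (lat (m, n)))\<^sup>2"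
proof -
  define d where "d = min \<bar>Re \<omega>1\<bar> \<bar>Im \<omega>3\<bar>"
  have d: "d > 0" "d\<^sup>2 \<le> (Re \<omega>1)\<^sup>2" "d\<^sup>2 \<le> (Im \<omega>3)\<^sup>2"
    using re_im_nz by (auto simp: d_def abs_le_square_iff[symmetric])
  show ?thesis
  proof (rule that[of "4 * d\<^sup>2 / 3"])
    fix m n :: int assume mn: "(m, n) \<noteq> (0, 0)"
    define x y where "x = \<bar>real_of_int m\<bar>" and "y = \<bar>real_of_int n\<bar>"
    have "m\<^sup>2 + n\<^sup>2 \<ge> 1"
    proof -
      have "m\<^sup>2 + n\<^sup>2 \<noteq> 0" using mn by (simp add: sum_power2_eq_zero_iff)
      moreover have "m\<^sup>2 + n\<^sup>2 \<ge> 0" by simp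
      ultimately show ?thesis by linarith
    qed
    hence "real_of_int (m\<^sup>2 + n\<^sup>2) \<ge> 1" by (metis of_int_1_le_iff)
    hence 1: "x\<^sup>2 + y\<^sup>2 \<ge> 1" by (simp add: x_def y_def)
    have "(1 - x)\<^sup>2 \<ge> 0" "(1 - y)\<^sup>2 \<ge> 0" "(x - y)\<^sup>2 \<ge> 0" by auto
    hence "(1 + x) * (1 + y) \<le> 3 * (x\<^sup>2 + y\<^sup>2)" using 1
      by (simp add: power2_eq_square algebra_simps)
    hence "4 * d\<^sup>2 / 3 * ((1 + x) * (1 + y)) \<le> 4 * d\<^sup>2 / 3 * (3 * (x\<^sup>2 + y\<^sup>2))"
      by (intro mult_left_mono) auto
    also have "\<dots> = 4 * (x\<^sup>2 * d\<^sup>2 + y\<^sup>2 * d\<^sup>2)" by (simp add: algebra_simps)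
    also have "\<dots> \<le> 4 * (x\<^sup>2 * (Re \<omega>1)\<^sup>2 + y\<^sup>2 * (Im \<omega>3)\<^sup>2)"
      using d by (intro mult_left_mono add_mono) auto
    also have "\<dots> = (norm (lat (m, n)))\<^sup>2"
      unfolding cmod_power2 lat_Re_Im by (simp add: x_def y_def power_mult_distrib)
    finally show "4 * d\<^sup>2 / 3 * ((1 + \<bar>real_of_int m\<bar>) * (1 + \<bar>real_of_int n\<bar>)) \<le> (norm (lat (m, n)))\<^sup>2"
      by (simp add: x_def y_def)
  qed (use d in simp)
qed

lemma lattice_cube_summable: "(\<lambda>w. 1 / norm w ^ 3) summable_on (period_lattice \<omega>1 \<omega>3 - {0})"
proof -
  obtain k where k: "k > 0" "\<And>m n. (m, n) \<noteq> (0, 0) \<Longrightarrow>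
    k * ((1 + \<bar>real_of_int m\<bar>) * (1 + \<bar>real_of_int n\<bar>)) \<le> (norm (lat (m, n)))\<^sup>2"
    using norm_lat_bound by blast
  define g where "g m = (1 + \<bar>real_of_int m\<bar>) powr (- (3/2))" for m
  have g: "g summable_on UNIV" unfolding g_def by (rule summable_on_int_powr)
  have "(\<lambda>(m, n). g m * g n) summable_on (UNIV \<times> UNIV)"
  proof (rule summable_on_SigmaI)
    show "((\<lambda>y. case (x, y) of (m, n) \<Rightarrow> g m * g n) has_sum g x * infsum g UNIV) UNIV" for x
      using has_sum_cmult_right[OF has_sum_infsum[OF g], of "g x"] by simp
    show "(\<lambda>x. g x * infsum g UNIV) summable_on UNIV" by (rule summable_on_cmult_left[OF g])
  qed (auto simp: g_def)
  hence "(\<lambda>(m, n). g m * g n) summable_on (UNIV - {(0, 0)})"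
    by (rule summable_on_subset_banach) auto
  hence s: "(\<lambda>x. k powr (- (3/2)) * (case x of (m, n) \<Rightarrow> g m * g n)) summable_on (UNIV - {(0, 0)})"
    by (rule summable_on_cmult_right)
  have "(\<lambda>x. 1 / norm (lat x) ^ 3) summable_on (UNIV - {(0, 0)})"
  proof (rule summable_on_comparison_test[OF s])
    fix x :: "int \<times> int" assume "x \<in> UNIV - {(0, 0)}"
    moreover obtain m n where x: "x = (m, n)" by (cases x)
    ultimately have mn: "(m, n) \<noteq> (0, 0)" by simp
    have pos: "0 < k * ((1 + \<bar>real_of_int m\<bar>) * (1 + \<bar>real_of_int n\<bar>))"
      using k(1) by (intro mult_pos_pos) auto
    hence np: "norm (lat (m, n)) > 0" using k(2)[OF mn] by (smt (verit) norm_ge_zero power2_eq_square mult_eq_0_iff)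
    have pp: "0 < (k * ((1 + \<bar>real_of_int m\<bar>) * (1 + \<bar>real_of_int n\<bar>))) powr (3/2)"
      unfolding powr_gt_zero using pos by (rule less_imp_neq[symmetric])
    have "norm (lat (m, n)) ^ 3 = ((norm (lat (m, n)))\<^sup>2) powr (3/2)"
    proof -
      have "((norm (lat (m, n)))\<^sup>2) powr (3/2) = (norm (lat (m, n)) powr 2) powr (3/2)"
        using np by simp
      also have "\<dots> = norm (lat (m, n)) powr 3" unfolding powr_powr by simp
      also have "\<dots> = norm (lat (m, n)) ^ 3" using np by simp
      finally show ?thesis by simp
    qed
    also have "\<dots> \<ge> (k * ((1 + \<bar>real_of_int m\<bar>) * (1 + \<bar>real_of_int n\<bar>))) powr (3/2)"
      using k(2)[OF mn] pos by (intro powr_mono2) auto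
    finally have "1 / norm (lat (m, n)) ^ 3 \<le> 1 / (k * ((1 + \<bar>real_of_int m\<bar>) * (1 + \<bar>real_of_int n\<bar>))) powr (3/2)"
      using pp np by (intro divide_left_mono mult_pos_pos zero_less_power zero_le_one)
    also have "\<dots> = k powr (- (3/2)) * (g m * g n)"
      using k(1) by (simp add: g_def powr_mult powr_minus_divide)
    finally show "1 / norm (lat x) ^ 3 \<le> k powr (- (3/2)) * (case x of (m, n) \<Rightarrow> g m * g n)"
      by (simp add: x)
  qed auto
  thus ?thesis
    unfolding period_lattice_minus_0
    by (subst summable_on_reindex) (auto simp: o_def intro: inj_on_subset[OF inj_lat])
qed

lemma finite_lattice_ball: "finite {w \<in> period_lattice \<omega>1 \<omega>3. norm w < R}"
proof -
  have "{w \<in> period_lattice \<omega>1 \<omega>3. norm w < R} \<subseteq> lat ` ({- \<lceil>R / \<bar>Re \<omega>1\<bar>\<rceil>..\<lceil>R / \<bar>Re \<omega>1\<bar>\<rceil>} \<times> {- \<lceil>R / \<bar>Im \<omega>3\<bar>\<rceil>..\<lceil>R / \<bar>Im \<omega>3\<bar>\<rceil>})"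
  proof
    fix w assume "w \<in> {w \<in> period_lattice \<omega>1 \<omega>3. norm w < R}"
    then obtain m n where w: "w = lat (m, n)" "norm (lat (m, n)) < R"
      unfolding period_lattice_eq by auto
    have b: "\<bar>real_of_int m\<bar> \<le> of_int \<lceil>R / \<bar>c\<bar>\<rceil>" if "c \<noteq> 0" "\<bar>2 * real_of_int m * c\<bar> < R" for m c
    proof -
      have "2 * (\<bar>real_of_int m\<bar> * \<bar>c\<bar>) < R" using that(2) by (simp add: abs_mult)
      moreover have "0 \<le> \<bar>real_of_int m\<bar> * \<bar>c\<bar>" by simp
      ultimately have "\<bar>real_of_int m\<bar> * \<bar>c\<bar> \<le> R" by linarith
      hence "\<bar>real_of_int m\<bar> \<le> R / \<bar>c\<bar>" using that(1) by (simp add: field_simps)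
      thus ?thesis by linarith
    qed
    have "\<bar>Re (lat (m, n))\<bar> < R" "\<bar>Im (lat (m, n))\<bar> < R"
      using w(2) abs_Re_le_cmod abs_Im_le_cmod le_less_trans by blast+
    hence "\<bar>real_of_int m\<bar> \<le> of_int \<lceil>R / \<bar>Re \<omega>1\<bar>\<rceil>" "\<bar>real_of_int n\<bar> \<le> of_int \<lceil>R / \<bar>Im \<omega>3\<bar>\<rceil>"
      using b[OF re_im_nz(1), of m] b[OF re_im_nz(2), of n] unfolding lat_Re_Im by auto
    hence "\<bar>m\<bar> \<le> \<lceil>R / \<bar>Re \<omega>1\<bar>\<rceil>" "\<bar>n\<bar> \<le> \<lceil>R / \<bar>Im \<omega>3\<bar>\<rceil>"
      by (metis of_int_abs of_int_le_iff)+
    thus "w \<in> lat ` ({- \<lceil>R / \<bar>Re \<omega>1\<bar>\<rceil>..\<lceil>R / \<bar>Re \<omega>1\<bar>\<rceil>} \<times> {- \<lceil>R / \<bar>Im \<omega>3\<bar>\<rceil>..\<lceil>R / \<bar>Im \<omega>3\<bar>\<rceil>})"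
      unfolding w(1) by (intro imageI) auto
  qed
  thus ?thesis by (rule finite_subset) auto
qed

text \<open>Lattice points of norm at least \<open>2 R\<close> contribute a series that converges
  uniformly on the disc, so its sum is holomorphic inside; the finitely many other nonzero ones
  contribute explicit rational terms.\<close>

lemma weierstrass_p_local:
  assumes R: "R > 0"
  shows "\<exists>h. h holomorphic_on (ball 0 R - ({w \<in> period_lattice \<omega>1 \<omega>3. norm w < 2 * R} - {0}))
    \<and> (\<forall>z\<in>ball 0 R. weierstrass_p \<omega>1 \<omega>3 z = 1 / z\<^sup>2 + h z)"
proof -
  let ?L = "period_lattice \<omega>1 \<omega>3"
  define F where "F = {w \<in> ?L. norm w < 2 * R} - {0}"
  define X where "X = {w \<in> ?L. norm w \<ge> 2 * R}"
  define t where "t w z = 1 / (z - w)\<^sup>2 - 1 / w\<^sup>2" for w z :: complex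
  have fin: "finite F" unfolding F_def using finite_lattice_ball by simp
  \<comment> \<open>On a common denominator \<open>t w z\<close> is
    \<open>z (2 w - z) / (w^2 (z - w)^2)\<close>. The bounds
    \<open>norm (2 w - z) \<le> 5/2 norm w\<close> and \<open>norm (z - w) \<ge> norm w / 2\<close>
    then produce the constant 10.\<close>
  have bound: "norm (t w z) \<le> 10 * R * (1 / norm w ^ 3)" if w: "w \<in> X" and z: "z \<in> cball 0 R" for w z
  proof -
    have nw: "norm w \<ge> 2 * R" "norm w > 0" and nz: "norm z \<le> R" using w z R by (auto simp: X_def)
    have zw: "norm (z - w) \<ge> norm w / 2"
      using norm_triangle_ineq2[of w z] nw nz by (simp add: norm_minus_commute)
    have n0: "w \<noteq> 0" "z - w \<noteq> 0" using nw zw by auto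
    have "t w z = z * (2 * w - z) / (w\<^sup>2 * (z - w)\<^sup>2)"
      using n0 unfolding t_def by (simp add: field_simps) (simp add: power2_eq_square algebra_simps)
    hence "norm (t w z) = norm z * norm (2 * w - z) / (norm w ^ 2 * norm (z - w) ^ 2)"
      by (simp add: norm_mult norm_divide norm_power)
    also have "\<dots> \<le> R * (5 / 2 * norm w) / (norm w ^ 2 * (norm w / 2) ^ 2)"
    proof (rule frac_le)
      have "norm (2 * w - z) \<le> 2 * norm w + norm z"
        using norm_triangle_ineq4[of "2 * w" z] by (simp add: norm_mult)
      hence "norm (2 * w - z) \<le> 5 / 2 * norm w" using nz nw by linarith
      thus "norm z * norm (2 * w - z) \<le> R * (5 / 2 * norm w)"
        using nz R by (intro mult_mono) auto
      show "norm w ^ 2 * (norm w / 2) ^ 2 \<le> norm w ^ 2 * norm (z - w) ^ 2"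
        using zw by (intro mult_left_mono power_mono) auto
    qed (use nw R in auto)
    also have "\<dots> = 10 * R * (1 / norm w ^ 3)"
      using nw by (simp add: field_simps power2_eq_square power3_eq_cube)
    finally show ?thesis .
  qed
  have XL: "X \<subseteq> ?L - {0}" using R by (auto simp: X_def)
  have sumM: "(\<lambda>w. 10 * R * (1 / norm w ^ 3)) summable_on X"
    by (intro summable_on_cmult_right summable_on_subset_banach[OF lattice_cube_summable XL])
  define g where "g z = (\<Sum>\<^sub>\<infinity>w\<in>X. t w z)" for z
  have ul: "uniform_limit (cball 0 R) (\<lambda>A z. \<Sum>w\<in>A. t w z) g (finite_subsets_at_top X)"
    unfolding g_def by (rule Weierstrass_m_test_general[OF bound sumM])
  have holt: "t w holomorphic_on S" if "w \<notin> S" for w S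
    unfolding t_def using that by (intro holomorphic_intros) auto
  have "\<forall>\<^sub>F A in finite_subsets_at_top X. continuous_on (cball 0 R) (\<lambda>z. \<Sum>w\<in>A. t w z) \<and>
      (\<lambda>z. \<Sum>w\<in>A. t w z) holomorphic_on ball 0 R"
  proof (rule eventually_finite_subsets_at_top_weakI)
    fix A assume A: "A \<subseteq> X"
    have "w \<notin> cball 0 R" if "w \<in> A" for w using A that R by (auto simp: X_def)
    hence "(\<lambda>z. \<Sum>w\<in>A. t w z) holomorphic_on cball 0 R"
      by (intro holomorphic_on_sum holt) auto
    thus "continuous_on (cball 0 R) (\<lambda>z. \<Sum>w\<in>A. t w z) \<and> (\<lambda>z. \<Sum>w\<in>A. t w z) holomorphic_on ball 0 R"
      using holomorphic_on_imp_continuous_on holomorphic_on_subset ball_subset_cball by blast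
  qed
  then obtain g: "g holomorphic_on ball 0 R"
    using holomorphic_uniform_limit[OF _ ul] by auto
  define h where "h z = (\<Sum>w\<in>F. t w z) + g z" for z
  have "(\<lambda>z. \<Sum>w\<in>F. t w z) holomorphic_on ball 0 R - F"
    by (intro holomorphic_on_sum holt) auto
  moreover have "g holomorphic_on ball 0 R - F" using g by (rule holomorphic_on_subset) auto
  ultimately have "h holomorphic_on ball 0 R - F" unfolding h_def by (rule holomorphic_on_add)
  moreover have "weierstrass_p \<omega>1 \<omega>3 z = 1 / z\<^sup>2 + h z" if z: "z \<in> ball 0 R" for z
  proof -
    have "(\<lambda>w. norm (t w z)) summable_on X"
      by (rule summable_on_comparison_test[OF sumM]) (use bound z in auto)
    hence sX: "(\<lambda>w. t w z) summable_on X" by (rule abs_summable_summable)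
    have un: "?L - {0} = F \<union> X" using R by (auto simp: F_def X_def)
    have "(\<Sum>\<^sub>\<infinity>w\<in>?L - {0}. t w z) = (\<Sum>\<^sub>\<infinity>w\<in>F. t w z) + (\<Sum>\<^sub>\<infinity>w\<in>X. t w z)"
      unfolding un using fin sX by (intro infsum_Un_disjoint) (auto simp: F_def X_def)
    thus ?thesis using fin by (simp add: weierstrass_p_def t_def[symmetric] h_def g_def)
  qed
  ultimately show ?thesis unfolding F_def by blast
qed

text \<open>If the function were constant near \<open>z0\<close>, continuation in a disc without its
  lattice points would make it constant near \<open>0\<close>, against the double pole
  there.\<close>

lemma weierstrass_p_analytic:
  assumes z0: "z0 \<notin> period_lattice \<omega>1 \<omega>3"
  shows "weierstrass_p \<omega>1 \<omega>3 analytic_on {z0}" "\<not> (\<forall>\<^sub>F z in at z0. weierstrass_p \<omega>1 \<omega>3 z = k)"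
proof -
  define R where "R = norm z0 + 1"
  have R: "R > 0" "norm z0 < R" by (auto simp: R_def add_nonneg_pos)
  define F where "F = {w \<in> period_lattice \<omega>1 \<omega>3. norm w < 2 * R}"
  have fin: "finite F" unfolding F_def by (rule finite_lattice_ball)
  obtain h where h: "h holomorphic_on ball 0 R - (F - {0})"
    "\<And>z. z \<in> ball 0 R \<Longrightarrow> weierstrass_p \<omega>1 \<omega>3 z = 1 / z\<^sup>2 + h z"
    using weierstrass_p_local[OF R(1)] unfolding F_def by blast
  define S where "S = ball 0 R - F"
  have "0 \<in> period_lattice \<omega>1 \<omega>3" unfolding period_lattice_def
    by (intro CollectI exI[of _ "0 :: int"]) simp
  hence F0: "0 \<in> F" using R by (simp add: F_def)
  have S: "open S" "connected S" "z0 \<in> S"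
    unfolding S_def using fin z0 R
    by (auto intro!: open_Diff finite_imp_closed connected_open_diff_countable countable_finite simp: F_def)
  have "(\<lambda>z. 1 / z\<^sup>2 + h z) holomorphic_on S"
    using F0 unfolding S_def by (intro holomorphic_intros holomorphic_on_subset[OF h(1)]) auto
  hence hol: "weierstrass_p \<omega>1 \<omega>3 holomorphic_on S"
    by (rule holomorphic_transform) (use h(2) in \<open>auto simp: S_def\<close>)
  thus "weierstrass_p \<omega>1 \<omega>3 analytic_on {z0}"
    using S by (meson analytic_on_holomorphic empty_subsetI insert_subset)
  show "\<not> (\<forall>\<^sub>F z in at z0. weierstrass_p \<omega>1 \<omega>3 z = k)"
  proof
    assume "\<forall>\<^sub>F z in at z0. weierstrass_p \<omega>1 \<omega>3 z = k"
    then obtain B where B: "open B" "z0 \<in> B"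
      "\<And>z. z \<in> B \<Longrightarrow> z \<noteq> z0 \<Longrightarrow> weierstrass_p \<omega>1 \<omega>3 z = k"
      unfolding eventually_at_topological by blast
    have "open (B \<inter> S)" "z0 \<in> B \<inter> S" using B S by auto
    hence "B \<inter> S - {z0} \<noteq> {}" by (metis insert_Diff not_open_singleton)
    have const: "weierstrass_p \<omega>1 \<omega>3 z = k" if "z \<in> S" for z
      by (rule analytic_continuation_open[of "B \<inter> S - {z0}" S "weierstrass_p \<omega>1 \<omega>3" "\<lambda>_. k"])
        (use B S hol that \<open>B \<inter> S - {z0} \<noteq> {}\<close> in auto)
    have op: "open (ball 0 R - (F - {0}))" using fin by (intro open_Diff finite_imp_closed) auto
    have 0: "0 \<in> ball 0 R - (F - {0})" using R by auto
    have "isCont h 0"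
      using h(1) op 0 holomorphic_on_imp_continuous_on continuous_on_eq_continuous_at by blast
    hence lim0: "((\<lambda>z. z\<^sup>2 * (k - h z)) \<longlongrightarrow> 0\<^sup>2 * (k - h 0)) (at 0)"
      unfolding isCont_def by (intro tendsto_intros)
    have "\<forall>\<^sub>F z in at 0. z\<^sup>2 * (k - h z) = 1"
    proof -
      have "\<forall>\<^sub>F z in at 0. z \<in> (ball 0 R - (F - {0})) - {0}"
        using op 0 by (intro eventually_at_in_open)
      thus ?thesis
      proof eventually_elim
        case (elim z)
        hence "z \<in> S" "z \<noteq> 0" "z \<in> ball 0 R" by (auto simp: S_def)
        hence "k = 1 / z\<^sup>2 + h z" using const[of z] h(2)[of z] by simp
        thus ?case using \<open>z \<noteq> 0\<close> by (simp add: field_simps)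
      qed
    qed
    hence "((\<lambda>z. z\<^sup>2 * (k - h z)) \<longlongrightarrow> 1) (at 0)" by (rule tendsto_eventually)
    from tendsto_unique[OF _ lim0 this] show False by simp
  qed
qed

end

section \<open>The four families\<close>

abbreviation evp :: "complex fls \<Rightarrow> complex poly \<Rightarrow> complex fls" where
  "evp \<equiv> const_derivation.ev fls_const"

lemma evp_simps [simp]: "evp v 0 = 0" "evp v (pCons a q) = fls_const a + v * evp v q"
  using const_derivation.ev_0[OF derivation_fls] const_derivation.ev_pCons[OF derivation_fls] by auto

lemma evp_mult: "evp v (p * q) = evp v p * evp v q"
  and evp_smult: "evp v (smult a q) = fls_const a * evp v q"
  using const_derivation.ev_mult[OF derivation_fls] const_derivation.ev_smult[OF derivation_fls] by auto

lemma fls_deriv_evp: "fls_deriv (evp v q) = evp v (pderiv q) * fls_deriv v"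
  using const_derivation.d_ev[OF derivation_fls[of 1], of v q] by simp

lemma fls_const_half: "fls_const (1 / 2 :: complex) * 2 = 1"
  unfolding mult_2_right fls_plus_const by simp

text \<open>
  The shift \<open>W = m Y' / Y - q\<close> by a polynomial \<open>q\<close> in \<open>v\<close> lowers the growth of \<open>Q\<close>, so that an
  irregular singularity at infinity (Hermite, Bessel) can be treated by weights as well.
\<close>

definition forces_darboux :: "complex fls \<Rightarrow> bool" where
  "forces_darboux r \<longleftrightarrow> (\<forall>v m p Q0 R0 q S Q R.
     m \<noteq> 0 \<longrightarrow> fls_deriv v \<noteq> 0 \<longrightarrow> m * fls_deriv v = evp v p \<longrightarrow> m\<^sup>2 = evp v S \<longrightarrow>
     fls_deriv m = evp v R0 \<longrightarrow> m\<^sup>2 * r = evp v Q0 \<longrightarrow>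
     Q = Q0 + R0 * q - q * q - p * pderiv q \<longrightarrow> R = R0 - 2 * q \<longrightarrow>
     (\<exists>N\<ge>1. \<exists>G b. poly_darboux p Q R N G b))"

lemma forces_darbouxD:
  assumes "forces_darboux r" "m \<noteq> 0" "fls_deriv v \<noteq> 0" "m * fls_deriv v = evp v p" "m\<^sup>2 = evp v S"
    "fls_deriv m = evp v R0" "m\<^sup>2 * r = evp v Q0"
    "Q = Q0 + R0 * q - q * q - p * pderiv q" "R = R0 - 2 * q"
  obtains N G b where "N \<ge> 1" "poly_darboux p Q R N G b"
  using assms unfolding forces_darboux_def by blast

text \<open>\<open>g\<close> is any analytic function that continues the coefficient of the normal
  equation. Each family supplies an explicit one, and only its Laurent expansion at the centre
  matters.\<close>

lemma axis_darboux:
  fixes f :: "real \<Rightarrow> real \<Rightarrow> real" and s hbar x0 :: real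
  assumes "hbar > 0" "open U" "real_analytic2_on f U" "(x0, 0) \<in> U" "s > 0"
    and "wkb_integrable hbar U (\<lambda>x y. y\<^sup>2 * f x y)"
  shows "\<exists>(c :: real) r. r > 0 \<and> (\<forall>t\<in>{c-r<..<c+r}. (x0 + s * t, 0) \<in> U) \<and>
    (\<forall>g. g analytic_on {of_real c} \<longrightarrow>
       (\<forall>t\<in>{c-r<..<c+r}. g (of_real t) = of_real (- 2 * f (x0 + s * t) 0)) \<longrightarrow>
       forces_darboux (laurent_expansion g (of_real c)))"
proof -
  obtain c r and A :: "2 + 2 \<Rightarrow> 2 + 2 \<Rightarrow> complex \<Rightarrow> complex" and K \<phi> \<phi>' k0 where
    r: "r > 0" "c - r \<ge> 0" and inU: "\<forall>t\<in>{c-r<..<c+r}. (x0 + s * t, 0) \<in> U"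
    and hol: "\<forall>i j. A i j holomorphic_on ball (of_real c) r" "K holomorphic_on ball (of_real c) r"
    and tri: "\<forall>i j. (\<forall>t\<in>{c-r<..<c+r}. A i j (of_real t) = 0) \<or> (\<forall>t\<in>{c-r<..<c+r}. A i j (of_real t) = 1)
      \<or> (\<forall>t\<in>{c-r<..<c+r}. A i j (of_real t) = of_real (- 2 * f (x0 + s * t) 0))"
    and pt: "\<forall>t\<in>{c-r<..<c+r}. A (Inr 2) (Inl 2) (of_real t) = of_real (- 2 * f (x0 + s * t) 0) \<and> \<phi> t > 0 \<and>
       (\<phi> has_real_derivative \<phi>' t) (at t) \<and> (\<phi>' has_real_derivative - 2 * f (x0 + s * t) 0 * \<phi> t) (at t) \<and>
       K (of_real t) = k0 * (1 / of_real (sqrt (t * \<phi> t)))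
          * exp (\<i> * of_real (s\<^sup>2 / (2 * hbar)) * of_real t)"
    and k0: "k0 \<noteq> 0"
    and liouv: "liouvillian_over (ball (of_real c) r) (diff_field_gen (ball (of_real c) r) {A i j | i j. True}) K"
    using wkb_integrable_axis[OF assms] by blast
  have dar: "\<exists>N\<ge>1. \<exists>G b. poly_darboux p Q R N G b"
    if g: "g analytic_on {of_real c}" "\<And>t. t \<in> {c-r<..<c+r} \<Longrightarrow> g (of_real t) = of_real (- 2 * f (x0 + s * t) 0)"
      and m: "m \<noteq> 0" "fls_deriv v \<noteq> 0" "m * fls_deriv v = evp v p" "m\<^sup>2 = evp v S"
       "fls_deriv m = evp v R0" "m\<^sup>2 * laurent_expansion g (of_real c) = evp v Q0"
       "Q = Q0 + R0 * q - q * q - p * pderiv q" "R = R0 - 2 * q" for g v m p Q0 R0 q S Q R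
  proof -
    have anA: "A (Inr 2) (Inl 2) analytic_on {of_real c}"
      using hol(1) r(1) by (meson analytic_on_holomorphic centre_in_ball empty_subsetI insert_subset open_ball)
    have eq: "laurent_expansion (A (Inr 2) (Inl 2)) (of_real c) = laurent_expansion g (of_real c)"
      by (rule laurent_eq_of_real_eq[OF anA g(1) r(1)]) (use g(2) pt in auto)
    show ?thesis
    proof (rule wkb_darboux[where A = A and \<rho> = "\<lambda>t. - 2 * f (x0 + s * t) 0" and \<phi> = \<phi> and \<phi>' = \<phi>'
          and ?k0.0 = k0 and c = c and r = r and K = K and v = v and m = m and ?i0.0 = "Inr 2" and ?j0.0 = "Inl 2"
          and S = S and ?R0.0 = R0 and ?Q0.0 = Q0 and q = q and \<omega> = "s\<^sup>2 / (2 * hbar)"])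
    qed (use r hol tri pt k0 liouv m eq in \<open>simp_all\<close>)
  qed
  have "forces_darboux (laurent_expansion g (of_real c))"
    if "g analytic_on {complex_of_real c}"
      "\<forall>t\<in>{c-r<..<c+r}. g (of_real t) = of_real (- 2 * f (x0 + s * t) 0)" for g
    unfolding forces_darboux_def using dar[OF that(1)] that(2) by (intro allI impI) blast
  thus ?thesis using r(1) inU by blast
qed

definition affine :: "real \<Rightarrow> real \<Rightarrow> complex \<Rightarrow> complex" where
  "affine x0 s z = of_real x0 + of_real s * z"

lemma affine_laurent:
  shows "(\<lambda>w. affine x0 s (c + w)) has_laurent_expansion laurent_expansion (affine x0 s) c"
    and "fls_deriv (laurent_expansion (affine x0 s) c) = fls_const (of_real s)"
    and "s \<noteq> 0 \<Longrightarrow> laurent_expansion (affine x0 s) c \<noteq> 0"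
    and "affine x0 s analytic_on {c}"
proof -
  show an: "affine x0 s analytic_on {c}" unfolding affine_def by (intro analytic_intros)
  hence mer: "affine x0 s meromorphic_on {c}" by (rule analytic_on_imp_meromorphic_on)
  thus "(\<lambda>w. affine x0 s (c + w)) has_laurent_expansion laurent_expansion (affine x0 s) c"
    by (rule meromorphic_on_imp_has_laurent_expansion) simp
  have "deriv (affine x0 s) = (\<lambda>_. of_real s)"
  proof
    fix z show "deriv (affine x0 s) z = of_real s"
      unfolding affine_def by (rule DERIV_imp_deriv) (auto intro!: derivative_eq_intros)
  qed
  thus d: "fls_deriv (laurent_expansion (affine x0 s) c) = fls_const (of_real s)"
    using laurent_deriv[OF _ mer, of c] laurent_const[of "of_real s" c] by simp
  show "laurent_expansion (affine x0 s) c \<noteq> 0" if "s \<noteq> 0"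
  proof
    assume "laurent_expansion (affine x0 s) c = 0"
    with d have "fls_const (complex_of_real s) = 0" by simp
    thus False using that by simp
  qed
qed

text \<open>Translates a condition on \<open>e\<close> into the momentum \<open>s\<close>, hence the
  energy \<open>s^2 / 2\<close>, of the path.\<close>

lemma scale:
  assumes "e > 0"
  obtains s :: real where "s > 0" "s\<^sup>2 * e = 1"
proof
  show "1 / sqrt e > 0" using assms by simp
  show "(1 / sqrt e)\<^sup>2 * e = 1" using assms by (simp add: power_divide)
qed

section \<open>The Hermite family\<close>

context
  fixes f :: "real \<Rightarrow> real \<Rightarrow> real" and U :: "(real \<times> real) set" and a b hbar x0 :: real
  assumes hbar: "hbar > 0" and U: "open U" "real_analytic2_on f U" "(x0, 0) \<in> U" and a: "a \<noteq> 0"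
    and int: "wkb_integrable hbar U (\<lambda>x y. y\<^sup>2 * f x y)"
begin

text \<open>For \<open>v = x^2\<close> and \<open>m = x / (2 s)\<close> one has
  \<open>d v = v\<close>, and the equation takes the confluent form shared with the Bessel family.
  The exponents at \<open>v = 0\<close> are \<open>0\<close> and \<open>1 / 2\<close>.\<close>

lemma hermite_not_integrable:
  assumes fam: "hermite_family a {x. (x, 0) \<in> U} (\<lambda>x. 2 * f x 0)"
  shows False
proof -
  obtain e where e: "e > 0"
    "\<And>n z. n > 0 \<Longrightarrow> (of_nat n)\<^sup>2 \<noteq> (of_int z)\<^sup>2 * (of_real (e / a) :: complex)"
    using generic_parameter_hermite[OF a] by blast
  obtain s where s: "s > 0" "s\<^sup>2 * e = 1" using scale[OF e(1)] .
  obtain c r where r: "r > 0" "\<forall>t\<in>{c-r<..<c+r}. (x0 + s * t, 0) \<in> U"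
    and dar: "\<forall>g. g analytic_on {of_real c} \<longrightarrow>
       (\<forall>t\<in>{c-r<..<c+r}. g (of_real t) = of_real (- 2 * f (x0 + s * t) 0)) \<longrightarrow>
       forces_darboux (laurent_expansion g (of_real c))"
    using axis_darboux[OF hbar U s(1) int] by blast
  let ?c = "complex_of_real c"
  define X where "X = laurent_expansion (affine x0 s) ?c"
  have X: "(\<lambda>w. affine x0 s (?c + w)) has_laurent_expansion X" "fls_deriv X = fls_const (of_real s)" "X \<noteq> 0"
    using affine_laurent s(1) by (auto simp: X_def)
  define g where "g z = of_real a * affine x0 s z ^ 2 - 1" for z
  have gan: "g analytic_on {?c}" unfolding g_def by (intro analytic_intros affine_laurent(4))
  have geq: "g (of_real t) = of_real (- 2 * f (x0 + s * t) 0)" if "t \<in> {c-r<..<c+r}" for t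
  proof -
    have "2 * f (x0 + s * t) 0 = 1 - a * (x0 + s * t)\<^sup>2"
      using r(2) that fam unfolding hermite_family_def by auto
    hence "- 2 * f (x0 + s * t) 0 = a * (x0 + s * t)\<^sup>2 - 1" by simp
    thus ?thesis by (simp add: g_def affine_def)
  qed
  have gX: "laurent_expansion g ?c = fls_const (of_real a) * X ^ 2 - 1"
    unfolding g_def by (rule laurent_expansion_eqI) (intro laurent_expansion_intros X(1))
  \<comment> \<open>The quadratic term of \<open>Q0\<close> is \<open>a e / 4\<close>; the shift by
    \<open>q = \<alpha> v\<close> cancels it, and \<beta> is the linear term that remains.\<close>
  define \<alpha> where "\<alpha> = csqrt (of_real (a * e / 4))"
  have \<alpha>: "\<alpha>\<^sup>2 = of_real (a * e / 4)" "\<alpha> \<noteq> 0" using a e(1) by (auto simp: \<alpha>_def)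
  have "\<alpha> * \<alpha> = of_real (a * e / 4)" using \<alpha>(1) by (simp only: power2_eq_square)
  hence aa: "\<alpha> * \<alpha> = of_real (e / 4 * a)" by simp
  define \<beta> where "\<beta> = - of_real e / 4 - \<alpha> / 2"
  define m where "m = fls_const (of_real (1 / (2 * s))) * X"
  have se: "1 / (2 * s) * (1 / (2 * s)) = e / 4" using s by (simp add: field_simps power2_eq_square)
  have m2: "m\<^sup>2 = fls_const (of_real (e / 4)) * X\<^sup>2"
    by (simp add: m_def power_mult_distrib power2_eq_square fls_const_mult_const[symmetric] se[symmetric] flip: of_real_mult)
  have ev1: "m\<^sup>2 * laurent_expansion g ?c = evp (X\<^sup>2) [:0, - of_real (e / 4), of_real (e / 4 * a):]"
    unfolding m2 gX by (simp add: algebra_simps fls_const_mult_const[symmetric] fls_const_uminus)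
  have forces: "forces_darboux (laurent_expansion g ?c)" using dar gan geq by blast
  obtain N G b where N: "N \<ge> 1" and pd: "poly_darboux [:0, 1:] [:0, \<beta>:] [:1 / 2, - 2 * \<alpha>:] N G b"
  proof (rule forces_darbouxD[OF forces _ _ _ _ _ ev1,
        where S = "[:0, of_real (e / 4):]" and ?R0.0 = "[:1/2:]" and q = "[:0, \<alpha>:]"])
    show "m \<noteq> 0" using X(3) s by (simp add: m_def)
    show "fls_deriv (X\<^sup>2) \<noteq> 0" using X s by (simp add: power2_eq_square)
    have h: "fls_const (of_real (1 / (2 * s))) * fls_const (of_real s) = fls_const (1 / 2 :: complex)"
      using s by (simp add: fls_const_mult_const)
    show "fls_deriv m = evp (X\<^sup>2) [:1 / 2:]" using h by (simp add: m_def X(2))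
    have "m * fls_deriv (X\<^sup>2) = (fls_const (of_real (1 / (2 * s))) * fls_const (of_real s)) * 2 * X\<^sup>2"
      by (simp add: m_def X(2) power2_eq_square algebra_simps)
    also have "\<dots> = X\<^sup>2" unfolding h fls_const_half by simp
    finally show "m * fls_deriv (X\<^sup>2) = evp (X\<^sup>2) [:0, 1:]" by simp
    show "m\<^sup>2 = evp (X\<^sup>2) [:0, of_real (e / 4):]" unfolding m2 by simp
    show "[:0, \<beta>:] = [:0, - of_real (e / 4), of_real (e / 4 * a):] + [:1 / 2:] * [:0, \<alpha>:]
      - [:0, \<alpha>:] * [:0, \<alpha>:] - [:0, 1:] * pderiv [:0, \<alpha>:]"
      by (simp add: pderiv_pCons \<beta>_def aa)
    show "[:1 / 2, - 2 * \<alpha>:] = [:1 / 2:] - 2 * [:0, \<alpha>:]" by (simp add: numeral_poly)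
  qed
  obtain M i j where M: "M \<ge> N" "i \<le> N" "j \<le> N" and eq: "of_nat j * 0 + of_nat (N - j) * (1 / 2)
    = of_nat M + (1 / 2 - 1) * of_nat i + \<beta> / (2 * \<alpha>) * (of_nat N - 2 * of_nat i)"
    using confluent_darboux[OF pd N \<alpha>(2), of 0 "1 / 2"] by auto
  \<comment> \<open>Four times the exponent relation collects its integers in \<open>n\<close>; the
    factor \<open>e / (2 \<alpha>)\<close> left on the other side has square
    \<open>e / a\<close>.\<close>
  define n where "n = 4 * M - N - 2 * (N - j)"
  have le: "N + 2 * (N - j) < 4 * M" using M N by linarith
  have n: "n > 0" using le by (simp add: n_def)
  have "of_nat n = 4 * of_nat M - of_nat N - 2 * (of_nat (N - j) :: complex)"
  proof -
    have "n + N + 2 * (N - j) = 4 * M" using le by (simp add: n_def)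
    hence "of_nat n + of_nat N + 2 * of_nat (N - j) = (4 * of_nat M :: complex)"
      by (metis of_nat_add of_nat_mult of_nat_numeral)
    thus ?thesis by (simp add: algebra_simps)
  qed
  also have "\<dots> = of_real e / (2 * \<alpha>) * (of_nat N - 2 * of_nat i)"
  proof -
    define x where "x = of_real e / (2 * \<alpha>)"
    have "\<beta> / (2 * \<alpha>) = - x / 4 - 1 / 4"
      using \<alpha>(2) by (simp add: \<beta>_def x_def field_simps)
    from eq[unfolded this] have K: "of_nat (N - j) = 2 * (of_nat M + (1 / 2 - 1) * of_nat i
        + (- x / 4 - 1 / 4) * (of_nat N - 2 * of_nat i))" by simp
    have "4 * of_nat M - of_nat N - 2 * of_nat (N - j) = x * (of_nat N - 2 * of_nat i)"
      unfolding K by (simp add: algebra_simps)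
    thus ?thesis by (simp add: x_def)
  qed
  finally have "(of_nat n)\<^sup>2 = (of_int (int N - 2 * int i))\<^sup>2 * ((of_real e)\<^sup>2 / (4 * \<alpha>\<^sup>2))"
    by (simp add: power_mult_distrib power_divide mult.commute)
  also have "(of_real e)\<^sup>2 / (4 * \<alpha>\<^sup>2) = of_real (e / a)"
    unfolding \<alpha>(1) using e(1) a by (simp add: power2_eq_square)
  finally show False using e(2)[OF n] by blast
qed

end

section \<open>The Bessel and Legendre families\<close>

context
  fixes f :: "real \<Rightarrow> real \<Rightarrow> real" and U :: "(real \<times> real) set" and a b hbar x0 :: real
  assumes hbar: "hbar > 0" and U: "open U" "real_analytic2_on f U" "(x0, 0) \<in> U" and a: "a \<noteq> 0"
    and int: "wkb_integrable hbar U (\<lambda>x y. y\<^sup>2 * f x y)"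
begin

text \<open>For \<open>v = x\<close> and \<open>m = x / s\<close> one has \<open>d v = v\<close>.
  The shift by \<open>\<alpha> v\<close> with \<open>\<alpha>^2 = - b e\<close> cancels the
  quadratic term of \<open>Q0\<close> and leaves \<open>Q\<close> constant;
  \<open>b \<noteq> 0\<close> makes \<alpha> nonzero, so that infinity is irregular. The exponents
  at \<open>0\<close> are \<open>(1 + \<eta>) / 2\<close> and
  \<open>(1 - \<eta>) / 2\<close>.\<close>

lemma bessel_not_integrable:
  assumes fam: "bessel_family a b {x. (x, 0) \<in> U} (\<lambda>x. 2 * f x 0)"
  shows False
proof -
  obtain e where e: "e > 0"
    "\<And>n z. n > 0 \<Longrightarrow> (of_nat n)\<^sup>2 \<noteq> (of_int z)\<^sup>2 * (of_real (1 + 4 * a * e) :: complex)"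
    using generic_parameter_regular[OF a] by blast
  obtain s where s: "s > 0" "s\<^sup>2 * e = 1" using scale[OF e(1)] .
  obtain c r where r: "r > 0" "\<forall>t\<in>{c-r<..<c+r}. (x0 + s * t, 0) \<in> U"
    and dar: "\<forall>g. g analytic_on {of_real c} \<longrightarrow>
       (\<forall>t\<in>{c-r<..<c+r}. g (of_real t) = of_real (- 2 * f (x0 + s * t) 0)) \<longrightarrow>
       forces_darboux (laurent_expansion g (of_real c))"
    using axis_darboux[OF hbar U s(1) int] by blast
  let ?c = "complex_of_real c"
  have b: "b \<noteq> 0" using fam by (simp add: bessel_family_def)
  define X where "X = laurent_expansion (affine x0 s) ?c"
  have X: "(\<lambda>w. affine x0 s (?c + w)) has_laurent_expansion X" "fls_deriv X = fls_const (of_real s)" "X \<noteq> 0"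
    using affine_laurent s(1) by (auto simp: X_def)
  have fx: "x0 + s * t \<noteq> 0" "- 2 * f (x0 + s * t) 0 = a / (x0 + s * t)\<^sup>2 - b"
    if "t \<in> {c-r<..<c+r}" for t
  proof -
    have "(x0 + s * t, 0) \<in> U" using r(2) that by blast
    hence "x0 + s * t \<noteq> 0 \<and> 2 * f (x0 + s * t) 0 = b - a / (x0 + s * t)\<^sup>2"
      using fam unfolding bessel_family_def by blast
    thus "x0 + s * t \<noteq> 0" "- 2 * f (x0 + s * t) 0 = a / (x0 + s * t)\<^sup>2 - b" by simp_all
  qed
  define g where "g z = of_real a * inverse (affine x0 s z ^ 2) - of_real b" for z
  have "complex_of_real (x0 + s * c) \<noteq> 0" using fx(1)[of c] r(1) by (subst of_real_eq_0_iff) simp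
  hence "affine x0 s ?c \<noteq> 0" by (simp add: affine_def)
  hence gan: "g analytic_on {?c}" unfolding g_def by (intro analytic_intros affine_laurent(4)) auto
  have geq: "g (of_real t) = of_real (- 2 * f (x0 + s * t) 0)" if "t \<in> {c-r<..<c+r}" for t
    unfolding fx(2)[OF that] by (simp add: g_def affine_def divide_inverse)
  have gX: "laurent_expansion g ?c = fls_const (of_real a) * inverse (X ^ 2) - fls_const (of_real b)"
    unfolding g_def by (rule laurent_expansion_eqI) (intro laurent_expansion_intros X(1))
  have forces: "forces_darboux (laurent_expansion g ?c)" using dar gan geq by blast
  define \<alpha> where "\<alpha> = csqrt (of_real (- b * e))"
  have \<alpha>: "\<alpha>\<^sup>2 = of_real (- b * e)" "\<alpha> \<noteq> 0" using b e(1) by (auto simp: \<alpha>_def)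
  have aa: "\<alpha> * \<alpha> = of_real (- (e * b))" using \<alpha>(1) by (simp only: power2_eq_square) simp
  define m where "m = fls_const (of_real (1 / s)) * X"
  have se: "1 / s * (1 / s) = e" using s by (simp add: field_simps power2_eq_square)
  have m2: "m\<^sup>2 = fls_const (of_real e) * X\<^sup>2"
    by (simp add: m_def power_mult_distrib power2_eq_square fls_const_mult_const[symmetric] se[symmetric] flip: of_real_mult)
  have km: "fls_const (complex_of_real (x * y)) = fls_const (of_real x) * fls_const (of_real y)" for x y
    by (simp add: fls_const_mult_const)
  have "fls_const (of_real e) * X\<^sup>2 * (fls_const (of_real a) * inverse (X\<^sup>2))
     = fls_const (of_real e) * fls_const (of_real a)" using X(3) by (simp add: field_simps)
  hence "m\<^sup>2 * laurent_expansion g ?c = fls_const (of_real e) * fls_const (of_real a)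
      - X * (X * (fls_const (of_real e) * fls_const (of_real b)))"
    unfolding m2 gX right_diff_distrib by (simp only: power2_eq_square mult_ac)
  hence ev1: "m\<^sup>2 * laurent_expansion g ?c = evp X [:of_real (e * a), 0, - of_real (e * b):]"
    by (simp only: evp_simps km fls_const_uminus[symmetric]) simp
  obtain N G B where N: "N \<ge> 1" and pd: "poly_darboux [:0, 1:] [:of_real (e * a), 0:] [:1, - 2 * \<alpha>:] N G B"
  proof (rule forces_darbouxD[OF forces _ _ _ _ _ ev1,
        where S = "[:0, 0, of_real e:]" and ?R0.0 = "[:1:]" and q = "[:0, \<alpha>:]"])
    show "m \<noteq> 0" using X(3) s by (simp add: m_def)
    show "fls_deriv X \<noteq> 0" using X s by simp
    have h: "fls_const (of_real (1 / s)) * fls_const (of_real s) = (1 :: complex fls)"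
      using s by (simp add: fls_const_mult_const)
    show "fls_deriv m = evp X [:1:]" using h by (simp add: m_def X(2))
    have "m * fls_deriv X = (fls_const (of_real (1 / s)) * fls_const (of_real s)) * X"
      by (simp add: m_def X(2) algebra_simps)
    thus "m * fls_deriv X = evp X [:0, 1:]" unfolding h by simp
    show "m\<^sup>2 = evp X [:0, 0, of_real e:]" unfolding m2 by (simp add: power2_eq_square mult_ac)
    show "[:of_real (e * a), 0:] = [:of_real (e * a), 0, - of_real (e * b):] + [:1:] * [:0, \<alpha>:]
      - [:0, \<alpha>:] * [:0, \<alpha>:] - [:0, 1:] * pderiv [:0, \<alpha>:]"
      by (simp add: pderiv_pCons aa)
    show "[:1, - 2 * \<alpha>:] = [:1:] - 2 * [:0, \<alpha>:]" by (simp add: numeral_poly)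
  qed
  define \<eta> where "\<eta> = csqrt (of_real (1 + 4 * a * e))"
  have \<eta>: "\<eta>\<^sup>2 = of_real (1 + 4 * a * e)" by (simp add: \<eta>_def)
  have "(1 + \<eta>) / 2 + (1 - \<eta>) / 2 = 1" by (simp add: field_simps)
  moreover have "(1 + \<eta>) / 2 * ((1 - \<eta>) / 2) = - of_real (e * a)"
    using \<eta> by (simp add: field_simps power2_eq_square)
  ultimately obtain M i j where M: "M \<ge> N" "i \<le> N" "j \<le> N"
    and eq: "of_nat j * ((1 + \<eta>) / 2) + of_nat (N - j) * ((1 - \<eta>) / 2)
      = of_nat M + (1 - 1) * of_nat i + 0 / (2 * \<alpha>) * (of_nat N - 2 * of_nat i)"
    using confluent_darboux[OF pd N \<alpha>(2)] by blast
  define n where "n = 2 * M - N"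
  have n: "n > 0" using M(1) N by (simp add: n_def)
  have "complex_of_nat n = 2 * of_nat M - of_nat N" using M(1) by (simp add: n_def of_nat_diff)
  also have "of_nat M = of_nat j * ((1 + \<eta>) / 2) + of_nat (N - j) * ((1 - \<eta>) / 2)" using eq by simp
  also have "2 * \<dots> - of_nat N = of_int (2 * int j - int N) * \<eta>"
    using M(3) by (simp add: of_nat_diff field_simps)
  finally have "(of_nat n)\<^sup>2 = (of_int (2 * int j - int N))\<^sup>2 * (of_real (1 + 4 * a * e) :: complex)"
    using \<eta> by (simp only: power_mult_distrib)
  thus False using e(2)[OF n] by blast
qed

text \<open>\<open>m = 1 / s\<close> turns \<open>d\<close> into \<open>d/dx\<close>, and
  \<open>1 - tanh^2 = 1 / cosh^2\<close> makes both \<open>d v\<close> and the coefficient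
  polynomial in \<open>v = tanh x\<close>. The singular points \<open>1\<close>, \<open>-1\<close>
  and infinity are regular, hence no shift is made.\<close>

lemma legendre_not_integrable:
  assumes fam: "legendre_family a b {x. (x, 0) \<in> U} (\<lambda>x. 2 * f x 0)"
  shows False
proof -
  have b: "b \<noteq> 0" using fam by (simp add: legendre_family_def)
  obtain e where e: "e > 0"
    "\<And>\<mu> \<eta> n z z'. \<mu>\<^sup>2 = complex_of_real (b * e) \<Longrightarrow> \<eta>\<^sup>2 = complex_of_real (1 + 4 * a * e) \<Longrightarrow>
      n > 0 \<Longrightarrow> of_nat n + of_int z * \<mu> \<noteq> of_int z' * \<eta>"
    using generic_parameter_legendre[OF a b] by blast
  obtain s where s: "s > 0" "s\<^sup>2 * e = 1" using scale[OF e(1)] .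
  obtain c r where r: "r > 0" "\<forall>t\<in>{c-r<..<c+r}. (x0 + s * t, 0) \<in> U"
    and dar: "\<forall>g. g analytic_on {of_real c} \<longrightarrow>
       (\<forall>t\<in>{c-r<..<c+r}. g (of_real t) = of_real (- 2 * f (x0 + s * t) 0)) \<longrightarrow>
       forces_darboux (laurent_expansion g (of_real c))"
    using axis_darboux[OF hbar U s(1) int] by blast
  let ?c = "complex_of_real c"
  define T where "T z = sinh (affine x0 s z) / cosh (affine x0 s z)" for z
  have cosh_of_real: "cosh (complex_of_real x) = of_real (cosh x)"
    and sinh_of_real: "sinh (complex_of_real x) = of_real (sinh x)" for x
    by (simp_all add: cosh_field_def sinh_field_def exp_of_real flip: of_real_minus)
  have "cosh (complex_of_real (x0 + s * c)) = of_real (cosh (x0 + s * c))" by (rule cosh_of_real)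
  moreover have "cosh (x0 + s * c) \<noteq> 0" using cosh_real_pos[of "x0 + s * c"] by simp
  ultimately have cc: "cosh (affine x0 s ?c) \<noteq> 0" by (simp add: affine_def)
  have Tan: "T analytic_on {?c}"
    unfolding T_def sinh_field_def cosh_field_def
    using cc by (intro analytic_intros affine_laurent(4)) (auto simp: cosh_field_def)
  define X where "X = laurent_expansion T ?c"
  have Tm: "T meromorphic_on {?c}" using Tan by (rule analytic_on_imp_meromorphic_on)
  have XT: "(\<lambda>w. T (?c + w)) has_laurent_expansion X"
    unfolding X_def by (rule laurent_at[OF _ Tm]) simp
  have "\<forall>\<^sub>F z in at ?c. cosh (affine x0 s z) \<noteq> 0"
  proof (rule tendsto_imp_eventually_ne[OF _ cc])
    have "isCont (\<lambda>z. cosh (affine x0 s z)) ?c"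
      unfolding affine_def cosh_field_def by (intro continuous_intros) auto
    thus "((\<lambda>z. cosh (affine x0 s z)) \<longlongrightarrow> cosh (affine x0 s ?c)) (at ?c)"
      by (simp only: isCont_def)
  qed
  hence "\<forall>\<^sub>F z in at ?c. deriv T z = of_real s * (1 - T z ^ 2)"
  proof eventually_elim
    case (elim z)
    have "(T has_field_derivative of_real s * (1 - T z ^ 2)) (at z)"
      unfolding T_def affine_def using elim[unfolded affine_def]
      by (auto intro!: derivative_eq_intros simp: field_simps power2_eq_square)
    thus ?case using DERIV_imp_deriv by blast
  qed
  hence "laurent_expansion (deriv T) ?c = laurent_expansion (\<lambda>z. of_real s * (1 - T z ^ 2)) ?c"
    by (intro laurent_expansion_cong) auto
  also have "\<dots> = fls_const (of_real s) * (1 - X\<^sup>2)"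
    by (rule laurent_expansion_eqI) (intro laurent_expansion_intros XT)
  finally have dX: "fls_deriv X = fls_const (of_real s) * (1 - X\<^sup>2)"
    using laurent_deriv[OF _ Tm] by (simp add: X_def)
  define g where "g z = of_real b - of_real a * (1 - T z ^ 2)" for z
  have gan: "g analytic_on {?c}" unfolding g_def by (intro analytic_intros Tan)
  have geq: "g (of_real t) = of_real (- 2 * f (x0 + s * t) 0)" if "t \<in> {c-r<..<c+r}" for t
  proof -
    define x where "x = x0 + s * t"
    have pos: "cosh x > 0" by (rule cosh_real_pos)
    have "(x, 0) \<in> U" using r(2) that unfolding x_def by blast
    hence "2 * f x 0 = - b + a * (1 / (cosh x)\<^sup>2)"
      using fam unfolding legendre_family_def by auto
    moreover have "1 - (sinh x / cosh x)\<^sup>2 = ((cosh x)\<^sup>2 - (sinh x)\<^sup>2) / (cosh x)\<^sup>2"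
      using pos by (simp add: power_divide diff_divide_distrib)
    hence "1 / (cosh x)\<^sup>2 = 1 - (sinh x / cosh x)\<^sup>2" unfolding hyperbolic_pythagoras by simp
    ultimately have "- 2 * f x 0 = b - a * (1 - (sinh x / cosh x)\<^sup>2)" by (simp only:)
    moreover have "T (of_real t) = of_real (sinh x / cosh x)"
      by (simp add: T_def affine_def x_def sinh_of_real cosh_of_real flip: of_real_mult of_real_add)
    ultimately show ?thesis unfolding x_def[symmetric] by (simp add: g_def)
  qed
  have gX: "laurent_expansion g ?c = fls_const (of_real b) - fls_const (of_real a) * (1 - X\<^sup>2)"
    unfolding g_def by (rule laurent_expansion_eqI) (intro laurent_expansion_intros XT)
  have forces: "forces_darboux (laurent_expansion g ?c)" using dar gan geq by blast
  have X1: "1 - X\<^sup>2 \<noteq> 0"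
  proof
    assume "1 - X\<^sup>2 = 0"
    moreover have "laurent_expansion (\<lambda>z. 1 - T z ^ 2) ?c = 1 - X\<^sup>2"
      by (rule laurent_expansion_eqI) (intro laurent_expansion_intros XT)
    ultimately have "laurent_expansion (\<lambda>z. 1 - T z ^ 2) ?c = 0" by simp
    moreover have "1 - T ?c ^ 2 \<noteq> 0"
    proof -
      have "1 - T ?c ^ 2 = (cosh (affine x0 s ?c) ^ 2 - sinh (affine x0 s ?c) ^ 2) / cosh (affine x0 s ?c) ^ 2"
        using cc by (simp add: T_def power_divide diff_divide_distrib)
      thus ?thesis unfolding hyperbolic_pythagoras using cc by simp
    qed
    moreover have "(\<lambda>z. 1 - T z ^ 2) analytic_on {?c}" by (intro analytic_intros Tan)
    ultimately show False using laurent_nonzero by blast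
  qed
  define m where "m = (fls_const (of_real (1 / s)) :: complex fls)"
  have se: "1 / s * (1 / s) = e" using s by (simp add: field_simps power2_eq_square)
  have m2: "m\<^sup>2 = fls_const (of_real e)"
    by (simp add: m_def power2_eq_square fls_const_mult_const se[symmetric])
  have ev1: "m\<^sup>2 * laurent_expansion g ?c = evp X [:of_real (b * e) - of_real (a * e), 0, of_real (a * e):]"
  proof -
    have km: "fls_const (complex_of_real (x * y)) = fls_const (of_real x) * fls_const (of_real y)" for x y
      by (simp add: fls_const_mult_const)
    have kd: "fls_const (x - y) = fls_const x - fls_const y" for x y :: complex
      by (simp add: fls_minus_const)
    have "ke * (kb - ka * (1 - X\<^sup>2)) = (kb * ke - ka * ke) + X * (fls_const 0 + X * (ka * ke + X * 0))"
      for ke kb ka :: "complex fls" by (simp add: algebra_simps power2_eq_square)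
    thus ?thesis unfolding m2 gX evp_simps kd km .
  qed
  obtain N G B where N: "N \<ge> 1"
    and pd: "poly_darboux [:1, 0, -1:] [:of_real (b * e) - of_real (a * e), 0, of_real (a * e):] 0 N G B"
  proof (rule forces_darbouxD[OF forces _ _ _ _ _ ev1,
        where S = "[:of_real e:]" and ?R0.0 = 0 and q = 0 and p = "[:1, 0, -1:]"])
    show "m \<noteq> 0" using s by (simp add: m_def)
    show "fls_deriv X \<noteq> 0" unfolding dX using X1 s by simp
    have h: "m * fls_const (of_real s) = 1"
      using s by (simp add: m_def fls_const_mult_const)
    have "m * fls_deriv X = (m * fls_const (of_real s)) * (1 - X\<^sup>2)" by (simp add: dX mult.assoc)
    thus "m * fls_deriv X = evp X [:1, 0, -1:]" unfolding h by (simp add: power2_eq_square fls_const_uminus)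
    show "m\<^sup>2 = evp X [:of_real e:]" unfolding m2 by simp
    show "fls_deriv m = evp X 0" by (simp add: m_def)
  qed simp_all
  define \<mu> \<eta> where "\<mu> = csqrt (of_real (b * e))" and "\<eta> = csqrt (of_real (1 + 4 * a * e))"
  have \<mu>\<eta>: "\<mu>\<^sup>2 = of_real (b * e)" "\<eta>\<^sup>2 = of_real (1 + 4 * a * e)" by (simp_all add: \<mu>_def \<eta>_def)
  have "\<eta>\<^sup>2 = 1 + 4 * of_real (a * e)" using \<mu>\<eta>(2) by simp
  from legendre_darboux[OF pd N \<mu>\<eta>(1) this] show False using e(2)[OF \<mu>\<eta>] by blast
qed

end

text \<open>One root comes from the fundamental theorem of algebra, the other two from the remaining
  quadratic. The discriminant is 16 times the squared product of the root differences, so it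
  separates the roots.\<close>

lemma cubic_factorization:
  fixes g2 g3 :: complex
  assumes disc: "g2 ^ 3 - 27 * g3\<^sup>2 \<noteq> 0"
  obtains e1 e2 e3 where "[:- g3, - g2, 0, 4:] = smult 4 ([:-e1, 1:] * [:-e2, 1:] * [:-e3, 1:])"
    "e1 \<noteq> e2" "e1 \<noteq> e3" "e2 \<noteq> e3"
proof -
  have "\<exists>z. poly [:- g3, - g2, 0, 4:] z = 0"
    by (rule Fundamental_Theorem_Algebra.fundamental_theorem_of_algebra) (simp add: constant_degree)
  then obtain e1 where "poly [:- g3, - g2, 0, 4:] e1 = 0" by blast
  hence g3: "g3 = 4 * e1 ^ 3 - g2 * e1" by (simp add: algebra_simps power3_eq_cube)
  define w where "w = csqrt (g2 - 3 * e1\<^sup>2)"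
  have g2: "g2 = w\<^sup>2 + 3 * e1\<^sup>2" by (simp add: w_def)
  define e2 e3 where "e2 = (- e1 + w) / 2" and "e3 = (- e1 - w) / 2"
  have s: "e1 + e2 + e3 = 0" by (simp add: e2_def e3_def field_simps)
  have p: "e2 * e3 = e1\<^sup>2 - g2 / 4" unfolding g2 e2_def e3_def by (simp add: field_simps power2_eq_square)
  have e3: "e3 = - e1 - e2" using s by (simp add: algebra_simps eq_neg_iff_add_eq_0)
  have G2: "g2 = 4 * (e1\<^sup>2 + e1 * e2 + e2\<^sup>2)"
    using p unfolding e3 by (simp add: field_simps power2_eq_square)
  have G3: "g3 = - 4 * e1 * e2 * (e1 + e2)"
    unfolding g3 G2 by (simp add: algebra_simps power2_eq_square power3_eq_cube)
  have fac: "[:- g3, - g2, 0, 4:] = smult 4 ([:-e1, 1:] * [:-e2, 1:] * [:-e3, 1:])"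
    unfolding e3 by (simp add: G2 G3 algebra_simps power2_eq_square)
  have D: "g2 ^ 3 - 27 * g3\<^sup>2 = 16 * ((e1 - e2) * (2 * e1 + e2) * (e1 + 2 * e2))\<^sup>2"
    unfolding G2 G3 by (simp add: algebra_simps power2_eq_square power3_eq_cube)
  have "e1 \<noteq> e2" "2 * e1 + e2 \<noteq> 0" "e1 + 2 * e2 \<noteq> 0" using disc D by auto
  moreover have "e1 - e3 = 2 * e1 + e2" "e2 - e3 = e1 + 2 * e2" unfolding e3 by simp_all
  ultimately have "e1 \<noteq> e2" "e1 - e3 \<noteq> 0" "e2 - e3 \<noteq> 0" by metis+
  thus ?thesis using that[OF fac] by simp
qed

section \<open>The Lame family\<close>

context
  fixes f :: "real \<Rightarrow> real \<Rightarrow> real" and U :: "(real \<times> real) set" and a b hbar x0 :: real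
  assumes hbar: "hbar > 0" and U: "open U" "real_analytic2_on f U" "(x0, 0) \<in> U" and a: "a \<noteq> 0"
    and int: "wkb_integrable hbar U (\<lambda>x y. y\<^sup>2 * f x y)"
begin

text \<open>With \<open>m = 1 / s\<close> one would get \<open>d v = \<wp>'\<close>, which is not a
  polynomial in \<open>v = \<wp>\<close>. The additional factor \<wp>' in \<open>m\<close> turns
  \<open>d v\<close> into the cubic \<open>p\<close>, and \<open>m\<close> remains quadratic over
  the field of \<open>v\<close> by \<open>m^2 = e p\<close>.\<close>

lemma lame_not_integrable:
  assumes fam: "lame_family a b {x. (x, 0) \<in> U} (\<lambda>x. 2 * f x 0)"
  shows False
proof -
  obtain g2 g3 \<omega>1 \<omega>3 where wp: "real_rectangular_weierstrass g2 g3 \<omega>1 \<omega>3"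
    and fam': "\<And>x. (x, 0) \<in> U \<Longrightarrow>
      of_real (2 * f x 0) = - of_real b - of_real a * weierstrass_p \<omega>1 \<omega>3 (of_real x + \<omega>3)"
    using fam unfolding lame_family_def by blast
  have \<omega>: "\<omega>1 \<noteq> 0" "Im \<omega>1 = 0" "\<omega>3 \<noteq> 0" "Re \<omega>3 = 0"
    and ode: "\<And>z. z \<notin> period_lattice \<omega>1 \<omega>3 \<Longrightarrow> (deriv (weierstrass_p \<omega>1 \<omega>3) z)\<^sup>2 =
          4 * weierstrass_p \<omega>1 \<omega>3 z ^ 3 - of_real g2 * weierstrass_p \<omega>1 \<omega>3 z - of_real g3"
    and disc: "g2 ^ 3 - 27 * g3\<^sup>2 > 0"
    using wp unfolding real_rectangular_weierstrass_def by auto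
  obtain e where e: "e > 0"
    "\<And>n z. n > 0 \<Longrightarrow> (of_nat n)\<^sup>2 \<noteq> (of_int z)\<^sup>2 * (of_real (1 + 4 * a * e) :: complex)"
    using generic_parameter_regular[OF a] by blast
  obtain s where s: "s > 0" "s\<^sup>2 * e = 1" using scale[OF e(1)] .
  obtain c r where r: "r > 0" "\<forall>t\<in>{c-r<..<c+r}. (x0 + s * t, 0) \<in> U"
    and dar: "\<forall>g. g analytic_on {of_real c} \<longrightarrow>
       (\<forall>t\<in>{c-r<..<c+r}. g (of_real t) = of_real (- 2 * f (x0 + s * t) 0)) \<longrightarrow>
       forces_darboux (laurent_expansion g (of_real c))"
    using axis_darboux[OF hbar U s(1) int] by blast
  let ?c = "complex_of_real c"
  define P where "P = weierstrass_p \<omega>1 \<omega>3"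
  define l where "l z = affine x0 s z + \<omega>3" for z
  have lan: "l analytic_on {z}" for z unfolding l_def by (intro analytic_intros affine_laurent(4))
  \<comment> \<open>Imaginary parts of lattice points are even multiples of
    \<open>Im \<omega>3\<close>; here the imaginary part is \<open>Im \<omega>3\<close> itself, so
    the path avoids the poles.\<close>
  have notin: "of_real x + \<omega>3 \<notin> period_lattice \<omega>1 \<omega>3" for x
  proof
    assume "of_real x + \<omega>3 \<in> period_lattice \<omega>1 \<omega>3"
    then obtain m n :: int where "of_real x + \<omega>3 = 2 * of_int m * \<omega>1 + 2 * of_int n * \<omega>3"
      unfolding period_lattice_def by blast
    hence "Im (of_real x + \<omega>3) = Im (2 * of_int m * \<omega>1 + 2 * of_int n * \<omega>3)" by simp
    hence "Im \<omega>3 = 2 * real_of_int n * Im \<omega>3" using \<omega> by simp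
    moreover have "Im \<omega>3 \<noteq> 0" using \<omega> by (auto simp: complex_eq_iff)
    ultimately have "2 * real_of_int n = 1" by simp
    hence "real_of_int (2 * n) = real_of_int 1" by simp
    hence "2 * n = 1" unfolding of_int_eq_iff .
    thus False by presburger
  qed
  have lc: "l ?c = of_real (x0 + s * c) + \<omega>3" by (simp add: l_def affine_def)
  have lnot: "l ?c \<notin> period_lattice \<omega>1 \<omega>3" unfolding lc by (rule notin)
  have Pan: "P analytic_on {l ?c}" unfolding P_def by (rule weierstrass_p_analytic(1)[OF \<omega> lnot])
  define T where "T z = P (l z)" for z
  have Tan: "T analytic_on {?c}"
  proof -
    have "(P \<circ> l) analytic_on {?c}" by (rule analytic_on_compose[OF lan]) (use Pan in simp)
    thus ?thesis by (simp add: T_def[abs_def] o_def)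
  qed
  have Tm: "T meromorphic_on {?c}" using Tan by (rule analytic_on_imp_meromorphic_on)
  define X where "X = laurent_expansion T ?c"
  have XT: "(\<lambda>w. T (?c + w)) has_laurent_expansion X"
    unfolding X_def by (rule laurent_at[OF _ Tm]) simp
  define p where "p = [:- complex_of_real g3, - of_real g2, 0, 4:]"
  \<comment> \<open>A neighbourhood without lattice points, where \<open>P\<close> is analytic and
    its differential equation holds.\<close>
  obtain B where B: "open B" "l ?c \<in> B" "P analytic_on B" "B \<inter> period_lattice \<omega>1 \<omega>3 = {}"
  proof -
    obtain S where S: "open S" "l ?c \<in> S" "P holomorphic_on S"
      using Pan unfolding analytic_at by blast
    have "finite {w \<in> period_lattice \<omega>1 \<omega>3. norm w < norm (l ?c) + 1}" by (rule finite_lattice_ball[OF \<omega>])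
    hence "open (S \<inter> ball 0 (norm (l ?c) + 1) - {w \<in> period_lattice \<omega>1 \<omega>3. norm w < norm (l ?c) + 1})"
      (is "open ?B") using S by (intro open_Diff finite_imp_closed) auto
    moreover have "l ?c \<in> ?B" using S lnot by auto
    moreover have "P analytic_on S" using S by (simp add: analytic_on_open)
    hence "P analytic_on ?B" by (rule analytic_on_subset) auto
    moreover have "?B \<inter> period_lattice \<omega>1 \<omega>3 = {}" by auto
    ultimately show ?thesis using that by blast
  qed
  have "\<forall>\<^sub>F z in at ?c. l z \<in> B"
    by (rule topological_tendstoD[OF _ B(1,2)]) (use analytic_at_imp_isCont[OF lan] in \<open>simp add: isCont_def\<close>)
  hence "\<forall>\<^sub>F z in at ?c. (deriv T z)\<^sup>2 = (of_real s)\<^sup>2 * (4 * T z ^ 3 - of_real g2 * T z - of_real g3)"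
  proof eventually_elim
    case (elim z)
    have "(P has_field_derivative deriv P (l z)) (at (l z))"
      using B(3) elim analytic_on_imp_differentiable_at DERIV_deriv_iff_field_differentiable by blast
    moreover have "(l has_field_derivative of_real s) (at z)"
      unfolding l_def affine_def by (auto intro!: derivative_eq_intros)
    ultimately have "(T has_field_derivative deriv P (l z) * of_real s) (at z)"
      unfolding T_def[abs_def] using DERIV_chain2 by blast
    hence "deriv T z = deriv P (l z) * of_real s" by (rule DERIV_imp_deriv)
    moreover have "(deriv P (l z))\<^sup>2 = 4 * P (l z) ^ 3 - of_real g2 * P (l z) - of_real g3"
      unfolding P_def by (rule ode) (use elim B(4) in auto)
    ultimately show ?case by (simp add: power_mult_distrib T_def)
  qed
  hence "laurent_expansion (\<lambda>z. deriv T z ^ 2) ?c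
      = laurent_expansion (\<lambda>z. (of_real s)\<^sup>2 * (4 * T z ^ 3 - of_real g2 * T z - of_real g3)) ?c"
    by (intro laurent_expansion_cong) auto
  also have "\<dots> = fls_const ((of_real s)\<^sup>2) * (4 * X ^ 3 - fls_const (of_real g2) * X - fls_const (of_real g3))"
    by (rule laurent_expansion_eqI) (intro laurent_expansion_intros XT)
  also have "4 * X ^ 3 - fls_const (of_real g2) * X - fls_const (of_real g3) = evp X p"
  proof -
    have k4: "(4 :: complex fls) = fls_const 4" by (metis fls_const_numeral)
    have ku: "fls_const (- x) = - fls_const x" for x :: complex by (simp add: fls_const_uminus)
    have "k * X ^ 3 - u * X - v = - v + X * (- u + X * (fls_const 0 + X * (k + X * 0)))"
      for k u v :: "complex fls" by (simp add: algebra_simps power3_eq_cube)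
    thus ?thesis unfolding p_def evp_simps ku k4 .
  qed
  also have "laurent_expansion (\<lambda>z. deriv T z ^ 2) ?c = (fls_deriv X)\<^sup>2"
    using laurent_power[OF _ meromorphic_on_deriv[OF Tm], of ?c 2] laurent_deriv[OF _ Tm, of ?c] by (simp add: X_def)
  finally have dX: "(fls_deriv X)\<^sup>2 = fls_const ((of_real s)\<^sup>2) * evp X p" .
  \<comment> \<open>If \<open>T\<close> were constant near the centre, then so would be
    \<open>P\<close> near its image, since \<open>l\<close> is an invertible affine map.\<close>
  have dX0: "fls_deriv X \<noteq> 0"
  proof
    assume "fls_deriv X = 0"
    then obtain k where k: "X = fls_const k" using fls_deriv_eq_0_iff by blast
    have "(\<lambda>w. T (?c + w) - k) has_laurent_expansion X - fls_const k"
      by (intro laurent_expansion_intros XT)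
    hence "\<forall>\<^sub>F z in at ?c. T z - k = 0"
      using has_laurent_expansion_eventually_zero_iff[of "\<lambda>z. T z - k" ?c] k by simp
    hence "\<forall>\<^sub>F z in at ?c. T z = k" by simp
    then obtain d where d: "d > 0" "\<And>z. z \<noteq> ?c \<Longrightarrow> dist z ?c < d \<Longrightarrow> T z = k"
      unfolding eventually_at by auto
    have "\<forall>\<^sub>F z in at (l ?c). P z = k"
      unfolding eventually_at
    proof (intro exI[of _ "d * s"] conjI ballI impI)
      show "d * s > 0" using d s by simp
      fix z assume z: "z \<noteq> l ?c \<and> dist z (l ?c) < d * s"
      define u where "u = (z - \<omega>3 - of_real x0) / of_real s"
      have lu: "l u = z" using s by (simp add: u_def l_def affine_def)
      have "u - ?c = (z - l ?c) / of_real s" using s by (simp add: u_def l_def affine_def field_simps)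
      hence "dist u ?c = dist z (l ?c) / s" using s by (simp add: dist_norm norm_divide)
      hence "dist u ?c < d" using z s(1) by (simp add: pos_divide_less_eq)
      moreover have "u \<noteq> ?c" using lu z by auto
      ultimately have "T u = k" using d(2) by blast
      thus "P z = k" by (simp add: T_def lu)
    qed
    thus False using weierstrass_p_analytic(2)[OF \<omega> lnot] unfolding P_def by blast
  qed
  define \<sigma> where "\<sigma> = fls_const (complex_of_real s)"
  have \<sigma>: "\<sigma> \<noteq> 0" "fls_deriv \<sigma> = 0" using s by (auto simp: \<sigma>_def)
  have \<sigma>2: "fls_const ((of_real s)\<^sup>2) = \<sigma>\<^sup>2" by (simp add: \<sigma>_def power2_eq_square fls_const_mult_const)
  have \<sigma>e: "\<sigma>\<^sup>2 * fls_const (of_real e) = 1"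
  proof -
    have "(complex_of_real s)\<^sup>2 * of_real e = of_real (s\<^sup>2 * e)" by simp
    also have "\<dots> = 1" unfolding s(2) by simp
    finally show ?thesis unfolding \<sigma>2[symmetric] fls_const_mult_const by simp
  qed
  have ddX: "fls_deriv (fls_deriv X) * 2 = \<sigma>\<^sup>2 * evp X (pderiv p)"
  proof -
    have "fls_deriv ((fls_deriv X)\<^sup>2) = fls_deriv (\<sigma>\<^sup>2 * evp X p)" using dX \<sigma>2 by simp
    hence "(fls_deriv (fls_deriv X) * 2) * fls_deriv X = (\<sigma>\<^sup>2 * evp X (pderiv p)) * fls_deriv X"
      using \<sigma>(2) by (simp add: power2_eq_square fls_deriv_evp algebra_simps)
    thus ?thesis using dX0 by simp
  qed
  define m where "m = fls_const (of_real e) * fls_deriv X"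
  define g where "g z = of_real b + of_real a * T z" for z
  have gan: "g analytic_on {?c}" unfolding g_def by (intro analytic_intros Tan)
  have geq: "g (of_real t) = of_real (- 2 * f (x0 + s * t) 0)" if "t \<in> {c-r<..<c+r}" for t
  proof -
    have "(x0 + s * t, 0) \<in> U" using r(2) that by blast
    from fam'[OF this] have "of_real (2 * f (x0 + s * t) 0) = - of_real b - of_real a * T (of_real t)"
      by (simp add: T_def P_def l_def affine_def)
    moreover have "complex_of_real (- 2 * f (x0 + s * t) 0) = - of_real (2 * f (x0 + s * t) 0)" by simp
    ultimately show ?thesis by (simp add: g_def)
  qed
  have gX: "laurent_expansion g ?c = fls_const (of_real b) + fls_const (of_real a) * X"
    unfolding g_def by (rule laurent_expansion_eqI) (intro laurent_expansion_intros XT)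
  have forces: "forces_darboux (laurent_expansion g ?c)" using dar gan geq by blast
  have mX: "m * fls_deriv X = evp X p"
  proof -
    have "m * fls_deriv X = fls_const (of_real e) * (fls_deriv X)\<^sup>2" by (simp add: m_def power2_eq_square)
    also have "\<dots> = (\<sigma>\<^sup>2 * fls_const (of_real e)) * evp X p" unfolding dX \<sigma>2 by (simp only: mult_ac)
    finally show ?thesis unfolding \<sigma>e by simp
  qed
  have m2: "m\<^sup>2 = fls_const (of_real e) * evp X p"
  proof -
    have "m\<^sup>2 = fls_const (of_real e) * (m * fls_deriv X)" by (simp add: m_def power2_eq_square mult_ac)
    thus ?thesis unfolding mX .
  qed
  have dm: "fls_deriv m = evp X (smult (1/2) (pderiv p))"
  proof -
    have "fls_deriv m = fls_const (of_real e) * fls_deriv (fls_deriv X)" by (simp add: m_def)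
    also have "\<dots> = fls_const (of_real e) * fls_deriv (fls_deriv X) * (fls_const (1/2) * 2)"
      unfolding fls_const_half by simp
    also have "\<dots> = fls_const (1/2) * (fls_const (of_real e) * (fls_deriv (fls_deriv X) * 2))" by (simp only: mult_ac)
    also have "\<dots> = fls_const (1/2) * ((\<sigma>\<^sup>2 * fls_const (of_real e)) * evp X (pderiv p))"
      unfolding ddX by (simp only: mult_ac)
    finally show ?thesis unfolding \<sigma>e evp_smult by simp
  qed
  have km: "fls_const (complex_of_real (x * y)) = fls_const (of_real x) * fls_const (of_real y)" for x y
    by (simp add: fls_const_mult_const)
  have ev1: "m\<^sup>2 * laurent_expansion g ?c = evp X (p * [:of_real (b * e), of_real (a * e):])"
  proof -
    have "ke * Y * (kb + ka * X) = Y * (kb * ke + X * (ka * ke + X * 0))"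
      for ke kb ka Y :: "complex fls" by (simp add: algebra_simps)
    thus ?thesis unfolding m2 gX evp_mult evp_simps km .
  qed
  have "(complex_of_real g2) ^ 3 - 27 * (of_real g3)\<^sup>2 = of_real (g2 ^ 3 - 27 * g3\<^sup>2)" by simp
  also have "\<dots> \<noteq> 0" using disc by (subst of_real_eq_0_iff) simp
  finally have disc': "(complex_of_real g2) ^ 3 - 27 * (of_real g3)\<^sup>2 \<noteq> 0" .
  obtain e1 e2 e3 where fac: "p = smult 4 ([:-e1, 1:] * [:-e2, 1:] * [:-e3, 1:])"
    and dist: "e1 \<noteq> e2" "e1 \<noteq> e3" "e2 \<noteq> e3"
    using cubic_factorization[OF disc'] unfolding p_def by metis
  obtain N G B where N: "N \<ge> 1"
    and pd: "poly_darboux p (p * [:of_real (b * e), of_real (a * e):]) (smult (1/2) (pderiv p)) N G B"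
  proof (rule forces_darbouxD[OF forces _ dX0 mX _ dm ev1, where S = "smult (of_real e) p" and q = 0])
    show "m \<noteq> 0" using e(1) dX0 by (simp add: m_def)
    show "m\<^sup>2 = evp X (smult (of_real e) p)" unfolding m2 evp_smult ..
  qed simp_all
  define \<eta> where "\<eta> = csqrt (of_real (1 + 4 * a * e))"
  have \<eta>: "\<eta>\<^sup>2 = of_real (1 + 4 * a * e)" by (simp add: \<eta>_def)
  hence "\<eta>\<^sup>2 = 1 + 4 * of_real (a * e)" by simp
  from lame_darboux[OF pd[unfolded fac] N dist this] obtain n z where n: "n > 0" "of_nat n = of_int z * \<eta>"
    by blast
  have "(of_nat n)\<^sup>2 = (of_int z)\<^sup>2 * complex_of_real (1 + 4 * a * e)"
    unfolding n(2) power_mult_distrib \<eta> ..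
  thus False using e(2)[OF n(1)] by blast
qed

end

theorem corollary1:
  fixes f :: "real \<Rightarrow> real \<Rightarrow> real" and U :: "(real \<times> real) set" and a b hbar :: real
  assumes "hbar > 0"
    and "open U"
    and "real_analytic2_on f U"
    and "\<exists>x. (x, 0) \<in> U \<and> f x 0 \<noteq> 0"
    and "a \<noteq> 0"
    and "hermite_family a {x. (x, 0) \<in> U} (\<lambda>x. 2 * f x 0) \<or>
         bessel_family a b {x. (x, 0) \<in> U} (\<lambda>x. 2 * f x 0) \<or>
         legendre_family a b {x. (x, 0) \<in> U} (\<lambda>x. 2 * f x 0) \<or>
         lame_family a b {x. (x, 0) \<in> U} (\<lambda>x. 2 * f x 0)"
  shows "\<not> wkb_integrable hbar U (\<lambda>x y. y\<^sup>2 * f x y)"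
proof
  assume int: "wkb_integrable hbar U (\<lambda>x y. y\<^sup>2 * f x y)"
  obtain x0 where "(x0, 0) \<in> U" using assms(4) by blast
  note prems = assms(1-3) this \<open>a \<noteq> 0\<close> int
  show False
    using assms(6) hermite_not_integrable[OF prems] bessel_not_integrable[OF prems]
      legendre_not_integrable[OF prems] lame_not_integrable[OF prems] by blast
qed

end
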